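(* Every transduction realized by a downward streaming string-to-term transducer is also realized by a downward streaming string-to-term transducer that is algebraically minimal (in the category of downward streaming string-to-term transducers realizing that transduction). Moreover, minimization can be performed effectively on finite transducers: there is an algorithm that, given a finite downward streaming string-to-term transducer, computes an algebraically minimal one realizing the same transduction.
   Context: Conventions. $f;g$ denotes composition in diagrammatic order. Equality of partial functions means same source set, same domain of definition, same codomain, same values. Leaf substitution algebra. Fix a ranked alphabet $\Gamma$. A linear term of type $\tau\in\mathbb N$ is a term over $\Gamma$ (a non-empty finite tree where each node labelled by a symbol of rank $k$ has $k$ children) some of whose leaves, exactly $\tau$ many, are placeholders (equivalently, variables $x_1,\dots,x_\tau$, each occurring exactly once, in this left-to-right order). For a linear term $t$ with $\alpha$ placeholders and a tuple $\bar u=(u_1,\dots,u_\alpha)$ of linear terms, $t[\bar u]$ is obtained by replacing the $i$-th placeholder of $t$ by $u_i$, for all $i$. The leaf substitution algebra $\mathbb D$ is the data structure whose types are natural numbers, with $\mathbb D_\tau$ the set of linear terms of type $\tau$; the updates from type $\alpha$ to type $\beta$ are the maps $t\mapsto t[\bar u]$, where $\bar u$ is an $\alpha$-tuple of linear terms having exactly $\beta$ placeholders in total. Updates contain identities and are closed under composition. There is also an initial type $\triangleright$ with a singleton domain $\{d_\triangleright\}$ (think of $d_\triangleright$ as the single placeholder, so that updates from $\triangleright$ to $\beta$ are $d_\triangleright\mapsto u$ with $u$ a linear term of type $\beta$), and a final type $\triangleleft$ whose domain is the set of output values, namely ground terms (type $0$). Constrained domains. A constraint of type $\tau$ is a (possibly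 infinite) set $\gamma$ of pairs $(f,g)$ of updates with input type $\tau$; $\mathbb D_\gamma=\{d\in\mathbb D_\tau: f(d)=g(d)\ \forall (f,g)\in\gamma\}$. Constraints are also available as types, with domain $\mathbb D_\gamma$; updates from $\gamma$ are restrictions of updates from $\tau$, and codomains of updates may be constrained domains containing all images. Transducers. A set $Q$ of control states comes with a type $\tau(q)$ for each $q\in Q$; the configuration space is $\langle Q\rangle=\{(q,d): q\in Q, d\in\mathbb D_{\tau(q)}\}$. A transformation $f:\langle Q\rangle\to\langle Q'\rangle$ is a partial function specified by a pair $(\hat f,\check f)$, where $\hat f:Q\to Q'$ is a partial function and $\check f$, with the same domain of definition, maps each $q$ to an update from $\tau(q)$ to $\tau(\hat f(q))$; $f$ is defined on exactly the $(q,d)$ with $q\in\mathrm{Dom}(\hat f)$, and $f(q,d)=(\hat f(q),\check f(q)(d))$. There are fixed special states $q_\triangleright,q_\triangleleft$ of types $\triangleright,\triangleleft$. A transducer over input alphabet $\Sigma$ is a tuple $A=(Q,\delta_\triangleright,(\delta_a)_{a\in\Sigma},\delta_\triangleleft)$ with $Q$ a (possibly infinite) typed set of states and transformations $\delta_\triangleright:\langle\{q_\triangleright\}\rangle\to\langle Q\rangle$, $\delta_a:\langle Q\rangle\to\langle Q\rangle$, $\delta_\triangleleft:\langle Q\rangle\to\langle\{q_\triangleleft\}\rangle$. It is finite if $Q$ is finite. It realizes the transduction $\varphi:\Sigma^*\to\mathbb D_\triangleleft$ (a partial function) that maps $w=a_1\cdots a_n$ to $d_w$ whenever $(\delta_\triangleright;\delta_{a_1};\dots;\delta_{a_n};\delta_\triangleleft)(q_\triangleright,d_\triangleright)=(q_\triangleleft,d_w)$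 is defined, and is undefined otherwise. A downward streaming string-to-term transducer (downward STT) is a transducer over the leaf substitution algebra. Morphisms. A morphism from $A=(Q_A,\delta_\triangleright,(\delta_a)_a,\delta_\triangleleft)$ to $B=(Q_B,\kappa_\triangleright,(\kappa_a)_a,\kappa_\triangleleft)$ is a transformation $h:\langle Q_A\rangle\to\langle Q_B\rangle$ that is a total function with $\kappa_\triangleright=\delta_\triangleright;h$, $h;\kappa_a=\delta_a;h$ for all $a\in\Sigma$, and $h;\kappa_\triangleleft=\delta_\triangleleft$. Algebraic minimality. For fixed $\varphi$, the transducers realizing $\varphi$ with their morphisms form a category. An epi is an arrow $f$ such that $f;h=f;h'$ implies $h=h'$. An arrow $g:C\to D$ is a strong mono if for every epi $f:A\to B$ and arrows $h:A\to C$, $h':B\to D$ with $f;h'=h;g$ there is a unique $d:B\to C$ with $h=f;d$ and $h'=d;g$. $A$ is a quotient of $B$ if there is an epi $B\to A$; a subobject of $B$ if there is a strong mono $A\to B$; a subquotient of $B$ if it is a quotient of a subobject of $B$. An object is algebraically minimal if it is a subquotient of every object of the category.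
   Formalization: Minimality is among realizers whose run on a word is defined only if it extends to a word in the transduction's domain; among all realizers the claim fails, e.g. for the nowhere-defined transduction. States lie in a fixed infinite universe; alphabets are finite for the algorithm. *)

theory Defs
  imports Complex_Main "HOL-Library.Nat_Bijection"
begin

section \<open>Linear terms and their leaf substitutions\<close>

datatype 'g trm = Hole | Node 'g "'g trm list"

fun ranked :: "('g \<Rightarrow> nat) \<Rightarrow> 'g trm \<Rightarrow> bool" where
  "ranked rank Hole = True"
| "ranked rank (Node g ts) = (length ts = rank g \<and> (\<forall>t\<in>set ts. ranked rank t))"

fun holes :: "'g trm \<Rightarrow> nat" where
  "holes Hole = 1"
| "holes (Node g ts) = sum_list (map holes ts)"

definition linear_terms :: "('g \<Rightarrow> nat) \<Rightarrow> nat \<Rightarrow> 'g trm set" where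
  "linear_terms rank n = {t. ranked rank t \<and> holes t = n}"

text \<open>\<open>fill t us\<close> is \<open>t[us]\<close>; it is only meaningful if \<open>length us = holes t\<close>.\<close>

fun fill :: "'g trm \<Rightarrow> 'g trm list \<Rightarrow> 'g trm"
  and fills :: "'g trm list \<Rightarrow> 'g trm list \<Rightarrow> 'g trm list" where
  "fill Hole us = hd us"
| "fill (Node g ts) us = Node g (fills ts us)"
| "fills [] us = []"
| "fills (t # ts) us = fill t (take (holes t) us) # fills ts (drop (holes t) us)"


section \<open>Types and updates\<close>

text \<open>\<open>Init\<close> is the initial type; its only element is the single placeholder \<open>Hole\<close>.
  The final type is \<open>Arity 0\<close>, the type of ground terms.\<close>

datatype base = Init | Arity nat

fun width :: "base \<Rightarrow> nat" where
  "width Init = 1"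
| "width (Arity n) = n"

fun base_dom :: "('g \<Rightarrow> nat) \<Rightarrow> base \<Rightarrow> 'g trm set" where
  "base_dom rank Init = {Hole}"
| "base_dom rank (Arity n) = linear_terms rank n"

text \<open>The update \<open>t \<mapsto> t[us]\<close> is given by the tuple \<open>us\<close>. The only update into the initial
  type is its identity.\<close>

fun updates :: "('g \<Rightarrow> nat) \<Rightarrow> base \<Rightarrow> base \<Rightarrow> 'g trm list set" where
  "updates rank b (Arity m) =
     {us. length us = width b \<and> (\<forall>u\<in>set us. ranked rank u) \<and> sum_list (map holes us) = m}"
| "updates rank Init Init = {[Hole]}"
| "updates rank (Arity n) Init = {}"

text \<open>A type is a base type with a constraint on it, a possibly infinite set of pairs of
  updates; the base types themselves carry the empty constraint.\<close>

type_synonym 'g ty = "base \<times> ('g trm list \<times> 'g trm list) set"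

definition is_ty :: "('g \<Rightarrow> nat) \<Rightarrow> 'g ty \<Rightarrow> bool" where
  "is_ty rank = (\<lambda>(b, \<gamma>). \<forall>(us, vs)\<in>\<gamma>.
     (\<exists>c. us \<in> updates rank b c) \<and> (\<exists>c. vs \<in> updates rank b c))"

definition ty_dom :: "('g \<Rightarrow> nat) \<Rightarrow> 'g ty \<Rightarrow> 'g trm set" where
  "ty_dom rank = (\<lambda>(b, \<gamma>). {d \<in> base_dom rank b. \<forall>(us, vs)\<in>\<gamma>. fill d us = fill d vs})"

definition ty_updates :: "('g \<Rightarrow> nat) \<Rightarrow> 'g ty \<Rightarrow> 'g ty \<Rightarrow> 'g trm list set" where
  "ty_updates rank \<sigma> \<tau> =
     {us \<in> updates rank (fst \<sigma>) (fst \<tau>). \<forall>d\<in>ty_dom rank \<sigma>. fill d us \<in> ty_dom rank \<tau>}"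


section \<open>Transformations and transducers\<close>

text \<open>A space is a set of control states together with their types. Partial functions between
  configuration spaces are maps that are \<open>None\<close> outside of the source space, so that for fixed
  source and target their equality is equality of maps.\<close>

type_synonym ('q, 'g) space = "'q set \<times> ('q \<Rightarrow> 'g ty)"

definition configs :: "('g \<Rightarrow> nat) \<Rightarrow> ('q, 'g) space \<Rightarrow> ('q \<times> 'g trm) set" where
  "configs rank X = {(q, d). q \<in> fst X \<and> d \<in> ty_dom rank (snd X q)}"

definition map_seq :: "('x \<rightharpoonup> 'y) \<Rightarrow> ('y \<rightharpoonup> 'z) \<Rightarrow> 'x \<rightharpoonup> 'z" (infixl \<open>;;\<close> 55) where
  "f ;; g = g \<circ>\<^sub>m f"

text \<open>\<open>F\<close> combines the state component and the update component of a transformation into one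
  partial function, since the two have the same domain of definition.\<close>

definition specifies ::
  "('g \<Rightarrow> nat) \<Rightarrow> ('p, 'g) space \<Rightarrow> ('q, 'g) space \<Rightarrow> ('p \<rightharpoonup> 'q \<times> 'g trm list) \<Rightarrow>
    ('p \<times> 'g trm \<rightharpoonup> 'q \<times> 'g trm) \<Rightarrow> bool" where
  "specifies rank X Y F f \<longleftrightarrow>
     dom F \<subseteq> fst X \<and>
     (\<forall>p q us. F p = Some (q, us) \<longrightarrow> q \<in> fst Y \<and> us \<in> ty_updates rank (snd X p) (snd Y q)) \<and>
     f = (\<lambda>(p, d). if (p, d) \<in> configs rank X
                   then map_option (\<lambda>(q, us). (q, fill d us)) (F p) else None)"

definition transformation ::
  "('g \<Rightarrow> nat) \<Rightarrow> ('p, 'g) space \<Rightarrow> ('q, 'g) space \<Rightarrow> ('p \<times> 'g trm \<rightharpoonup> 'q \<times> 'g trm) \<Rightarrow> bool" where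
  "transformation rank X Y f \<longleftrightarrow> (\<exists>F. specifies rank X Y F f)"

definition start_space :: "(unit, 'g) space" where
  "start_space = ({()}, \<lambda>_. (Init, {}))"

definition end_space :: "(unit, 'g) space" where
  "end_space = ({()}, \<lambda>_. (Arity 0, {}))"

record ('q, 'a, 'g) transducer =
  states :: "'q set"
  state_ty :: "'q \<Rightarrow> 'g ty"
  delta_init :: "unit \<times> 'g trm \<rightharpoonup> 'q \<times> 'g trm"
  delta :: "'a \<Rightarrow> 'q \<times> 'g trm \<rightharpoonup> 'q \<times> 'g trm"
  delta_final :: "'q \<times> 'g trm \<rightharpoonup> unit \<times> 'g trm"

definition space :: "('q, 'a, 'g) transducer \<Rightarrow> ('q, 'g) space" where
  "space A = (states A, state_ty A)"

definition is_transducer :: "('g \<Rightarrow> nat) \<Rightarrow> ('q, 'a, 'g) transducer \<Rightarrow> bool" where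
  "is_transducer rank A \<longleftrightarrow>
     (\<forall>q\<in>states A. is_ty rank (state_ty A q)) \<and>
     transformation rank start_space (space A) (delta_init A) \<and>
     (\<forall>a. transformation rank (space A) (space A) (delta A a)) \<and>
     transformation rank (space A) end_space (delta_final A)"

primrec steps :: "('q, 'a, 'g) transducer \<Rightarrow> 'a list \<Rightarrow> 'q \<times> 'g trm \<rightharpoonup> 'q \<times> 'g trm" where
  "steps A [] = Some"
| "steps A (a # w) = delta A a ;; steps A w"

definition run :: "('q, 'a, 'g) transducer \<Rightarrow> 'a list \<Rightarrow> ('q \<times> 'g trm) option" where
  "run A w = (delta_init A ;; steps A w) ((), Hole)"

definition transduction :: "('q, 'a, 'g) transducer \<Rightarrow> 'a list \<rightharpoonup> 'g trm" where
  "transduction A w = map_option snd ((delta_init A ;; steps A w ;; delta_final A) ((), Hole))"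

definition transducers_for ::
  "('g \<Rightarrow> nat) \<Rightarrow> ('a list \<rightharpoonup> 'g trm) \<Rightarrow> ('q, 'a, 'g) transducer set" where
  "transducers_for rank \<phi> = {A. is_transducer rank A \<and> transduction A = \<phi>}"


section \<open>Morphisms and algebraic minimality\<close>

definition morphism ::
  "('g \<Rightarrow> nat) \<Rightarrow> ('p, 'a, 'g) transducer \<Rightarrow> ('p \<times> 'g trm \<rightharpoonup> 'q \<times> 'g trm) \<Rightarrow>
    ('q, 'a, 'g) transducer \<Rightarrow> bool" where
  "morphism rank A h B \<longleftrightarrow>
     transformation rank (space A) (space B) h \<and> dom h = configs rank (space A) \<and>
     delta_init B = delta_init A ;; h \<and>
     (\<forall>a. h ;; delta B a = delta A a ;; h) \<and>
     h ;; delta_final B = delta_final A"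

text \<open>In the following, \<open>K\<close> is the class of objects of a category whose arrows are all the
  morphisms between them.\<close>

definition epi ::
  "('g \<Rightarrow> nat) \<Rightarrow> ('q, 'a, 'g) transducer set \<Rightarrow> ('q, 'a, 'g) transducer \<Rightarrow>
    ('q \<times> 'g trm \<rightharpoonup> 'q \<times> 'g trm) \<Rightarrow> ('q, 'a, 'g) transducer \<Rightarrow> bool" where
  "epi rank K A f B \<longleftrightarrow> morphism rank A f B \<and>
     (\<forall>C\<in>K. \<forall>h h'. morphism rank B h C \<and> morphism rank B h' C \<and> f ;; h = f ;; h' \<longrightarrow> h = h')"

definition strong_mono ::
  "('g \<Rightarrow> nat) \<Rightarrow> ('q, 'a, 'g) transducer set \<Rightarrow> ('q, 'a, 'g) transducer \<Rightarrow>
    ('q \<times> 'g trm \<rightharpoonup> 'q \<times> 'g trm) \<Rightarrow> ('q, 'a, 'g) transducer \<Rightarrow> bool" where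
  "strong_mono rank K C g D \<longleftrightarrow> morphism rank C g D \<and>
     (\<forall>A\<in>K. \<forall>B\<in>K. \<forall>f h h'.
        epi rank K A f B \<and> morphism rank A h C \<and> morphism rank B h' D \<and> f ;; h' = h ;; g \<longrightarrow>
        (\<exists>!d. morphism rank B d C \<and> h = f ;; d \<and> h' = d ;; g))"

definition quotient_of ::
  "('g \<Rightarrow> nat) \<Rightarrow> ('q, 'a, 'g) transducer set \<Rightarrow> ('q, 'a, 'g) transducer \<Rightarrow>
    ('q, 'a, 'g) transducer \<Rightarrow> bool" where
  "quotient_of rank K A B \<longleftrightarrow> (\<exists>f. epi rank K B f A)"

definition subobject_of ::
  "('g \<Rightarrow> nat) \<Rightarrow> ('q, 'a, 'g) transducer set \<Rightarrow> ('q, 'a, 'g) transducer \<Rightarrow>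
    ('q, 'a, 'g) transducer \<Rightarrow> bool" where
  "subobject_of rank K A B \<longleftrightarrow> (\<exists>g. strong_mono rank K A g B)"

definition subquotient_of ::
  "('g \<Rightarrow> nat) \<Rightarrow> ('q, 'a, 'g) transducer set \<Rightarrow> ('q, 'a, 'g) transducer \<Rightarrow>
    ('q, 'a, 'g) transducer \<Rightarrow> bool" where
  "subquotient_of rank K A B \<longleftrightarrow> (\<exists>C\<in>K. subobject_of rank K C B \<and> quotient_of rank K A C)"

definition algebraically_minimal ::
  "('g \<Rightarrow> nat) \<Rightarrow> ('q, 'a, 'g) transducer set \<Rightarrow> ('q, 'a, 'g) transducer \<Rightarrow> bool" where
  "algebraically_minimal rank K M \<longleftrightarrow> M \<in> K \<and> (\<forall>B\<in>K. subquotient_of rank K M B)"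


section \<open>Live transducers\<close>

text \<open>Morphisms are total, so the set of words on which the run is defined is the same for any
  two transducers connected by a morphism (\<open>morphism_run\<close>). If some word has no extension in the
  domain of \<open>\<phi>\<close>, then \<open>\<phi>\<close> has realizers whose run on that word is defined and realizers whose run
  on it is not, and no realizer is a subquotient of both; \<open>no_minimal_realizer\<close> is the simplest
  instance. Minimality is therefore considered among the live realizers, those without
  reachable configurations that admit no output. Unreachable configurations are not restricted.
  If every word has an extension in the domain of \<open>\<phi>\<close>, in particular if \<open>\<phi>\<close> is total, then all
  realizers are live (\<open>live_transducers_for_eq\<close>). In general the live realizers are a union of
  connected components of the category of all realizers, hence the notions of epi and strong mono
  between them are the same in both categories.\<close>

definition live_transducers_for ::
  "('g \<Rightarrow> nat) \<Rightarrow> ('a list \<rightharpoonup> 'g trm) \<Rightarrow> ('q, 'a, 'g) transducer set" where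
  "live_transducers_for rank \<phi> =
     {A \<in> transducers_for rank \<phi>. \<forall>w. run A w \<noteq> None \<longrightarrow> (\<exists>v. \<phi> (w @ v) \<noteq> None)}"

lemma live_transducers_for_eq:
  assumes "\<And>w. \<exists>v. \<phi> (w @ v) \<noteq> None"
  shows "live_transducers_for rank \<phi> = transducers_for rank \<phi>"
  using assms by (auto simp: live_transducers_for_def)

lemma map_seq_apply: "(f ;; g) x = Option.bind (f x) g"
  by (simp add: map_seq_def map_comp_def split: option.split)

lemma map_seq_assoc: "(f ;; g) ;; h = f ;; (g ;; h)"
  by (rule ext) (simp add: map_seq_apply[abs_def])

lemma transformation_in_configs:
  assumes "transformation rank X Y f" and "f x = Some y"
  shows "y \<in> configs rank Y"
  using assms
  by (cases x)
    (fastforce simp: transformation_def specifies_def configs_def ty_updates_def split: if_splits)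

lemma run_in_configs:
  assumes "is_transducer rank A" and "run A w = Some c"
  shows "c \<in> configs rank (space A)"
proof -
  have "steps A w x = Some y \<Longrightarrow> x \<in> configs rank (space A) \<Longrightarrow> y \<in> configs rank (space A)" for x y
  proof (induction w arbitrary: x)
    case (Cons a w)
    then obtain z where "delta A a x = Some z" "steps A w z = Some y"
      by (auto simp: map_seq_apply bind_eq_Some_conv)
    with Cons.IH assms(1) show ?case
      by (meson is_transducer_def transformation_in_configs)
  qed simp
  moreover obtain x where "delta_init A ((), Hole) = Some x" "steps A w x = Some c"
    using assms(2) by (auto simp: run_def map_seq_apply bind_eq_Some_conv)
  ultimately show ?thesis
    using assms(1) by (meson is_transducer_def transformation_in_configs)
qed

lemma morphism_run:
  assumes "is_transducer rank A" and "morphism rank A h B"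
  shows "run B w = None \<longleftrightarrow> run A w = None"
proof -
  have comm: "h ;; steps B w = steps A w ;; h"
  proof (induction w)
    case (Cons a w)
    have "h ;; steps B (a # w) = (h ;; delta B a) ;; steps B w"
      by (simp add: map_seq_assoc)
    also have "\<dots> = (delta A a ;; h) ;; steps B w"
      using assms(2) by (simp add: morphism_def)
    also have "\<dots> = steps A (a # w) ;; h"
      by (simp add: Cons.IH map_seq_assoc)
    finally show ?case .
  qed (rule ext, simp add: map_seq_apply)
  have "delta_init B = delta_init A ;; h"
    using assms(2) by (simp add: morphism_def)
  then have "run B w = ((delta_init A ;; steps A w) ;; h) ((), Hole)"
    unfolding run_def by (simp only: map_seq_assoc comm)
  then have "run B w = Option.bind (run A w) h"
    unfolding run_def by (simp only: map_seq_apply[of _ h])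
  moreover have "h c \<noteq> None" if "run A w = Some c" for c
    using run_in_configs[OF assms(1) that] assms(2) unfolding morphism_def by blast
  ultimately show ?thesis by (cases "run A w") auto
qed

lemma no_minimal_realizer:
  fixes rank :: "'g \<Rightarrow> nat" and M :: "('q, 'a, 'g) transducer"
  shows "\<not> algebraically_minimal rank (transducers_for rank Map.empty) M"
proof
  let ?K = "transducers_for rank Map.empty :: ('q, 'a, 'g) transducer set"
  assume M: "algebraically_minimal rank ?K M"
  define A :: "('q, 'a, 'g) transducer" where
    "A = \<lparr>states = {}, state_ty = (\<lambda>_. (Init, {})), delta_init = Map.empty,
          delta = (\<lambda>_. Map.empty), delta_final = Map.empty\<rparr>"
  define B :: "('q, 'a, 'g) transducer" where
    "B = \<lparr>states = {undefined}, state_ty = (\<lambda>_. (Init, {})),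
          delta_init = [((), Hole) \<mapsto> (undefined, Hole)],
          delta = (\<lambda>_. Map.empty), delta_final = Map.empty\<rparr>"
  have empty: "transformation rank X Y Map.empty"
    for X :: "('x, 'g) space" and Y :: "('y, 'g) space"
    unfolding transformation_def specifies_def by (rule exI[of _ Map.empty]) auto
  have "transformation rank start_space (space B) (delta_init B)"
    unfolding transformation_def specifies_def
    by (rule exI[of _ "\<lambda>_. Some (undefined, [Hole])"])
      (auto simp: B_def start_space_def space_def configs_def ty_dom_def ty_updates_def fun_eq_iff)
  then have "is_transducer rank B" "is_transducer rank A"
    by (simp_all add: is_transducer_def empty A_def B_def is_ty_def)
  moreover have "transduction A = Map.empty" "transduction B = Map.empty"
    by (auto simp: transduction_def map_seq_apply A_def B_def fun_eq_iff bind_eq_None_conv)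
  ultimately have "A \<in> ?K" "B \<in> ?K"
    by (simp_all add: transducers_for_def)
  have "run M [] = None \<longleftrightarrow> run C [] = None" if C: "C \<in> ?K" for C
  proof -
    from M C have "subquotient_of rank ?K M C"
      unfolding algebraically_minimal_def by blast
    then obtain S f g where S: "S \<in> ?K" "strong_mono rank ?K S g C" "epi rank ?K S f M"
      unfolding subquotient_of_def subobject_of_def quotient_of_def by blast
    have "is_transducer rank S" "morphism rank S g C" "morphism rank S f M"
      using S unfolding transducers_for_def strong_mono_def epi_def by blast+
    then show ?thesis
      using morphism_run by metis
  qed
  from this[OF \<open>A \<in> ?K\<close>] this[OF \<open>B \<in> ?K\<close>] show False
    by (simp add: A_def B_def run_def map_seq_apply)
qed


section \<open>Finite presentations\<close>

text \<open>A presentation over the states \<open>0, \<dots>, n - 1\<close> consists of the initial transition and, for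
  each state, of its base type, a finite constraint, a transition table and an optional final
  update. The states of the presented transducer are named by \<open>\<nu>\<close>. Its constraints need not be
  finite; they are only required to have the same domains as the listed ones, which is
  possible for every constraint (\<open>finite_transducer_presentable\<close>).\<close>

type_synonym 'g target = "nat \<times> 'g trm list"

type_synonym ('a, 'g) state_desc =
  "base \<times> ('g trm list \<times> 'g trm list) list \<times> ('a \<times> 'g target) list \<times> 'g trm list option"

type_synonym ('a, 'g) presentation = "'g target option \<times> ('a, 'g) state_desc list"

definition presents ::
  "('g \<Rightarrow> nat) \<Rightarrow> ('a, 'g) presentation \<Rightarrow> ('q, 'a, 'g) transducer \<Rightarrow> bool" where
  "presents rank = (\<lambda>(start, descs) A. is_transducer rank A \<and>
     (\<exists>(\<nu> :: nat \<Rightarrow> 'q) I F E. inj \<nu> \<and> states A = \<nu> ` {..<length descs} \<and>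
        specifies rank start_space (space A) I (delta_init A) \<and>
        (\<forall>a. specifies rank (space A) (space A) (F a) (delta A a)) \<and>
        specifies rank (space A) end_space E (delta_final A) \<and>
        I () = map_option (\<lambda>(j, us). (\<nu> j, us)) start \<and>
        (\<forall>k<length descs. case descs ! k of (b, cs, tr, fin) \<Rightarrow>
           is_ty rank (b, set cs) \<and>
           fst (state_ty A (\<nu> k)) = b \<and> ty_dom rank (state_ty A (\<nu> k)) = ty_dom rank (b, set cs) \<and>
           (\<forall>a. F a (\<nu> k) = map_option (\<lambda>(j, us). (\<nu> j, us)) (map_of tr a)) \<and>
           E (\<nu> k) = map_option (Pair ()) fin)))"

lemma fill_inject:
  shows "length us = holes t \<Longrightarrow> length vs = holes t \<Longrightarrow> fill t us = fill t vs \<Longrightarrow> us = vs"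
    and "length us = sum_list (map holes ts) \<Longrightarrow> length vs = sum_list (map holes ts) \<Longrightarrow>
      fills ts us = fills ts vs \<Longrightarrow> us = vs"
proof (induction t us and ts us arbitrary: vs and vs rule: fill_fills.induct)
  case (1 us)
  then show ?case
    by (cases us; cases vs) auto
next
  case (4 t ts us)
  have "take (holes t) us = take (holes t) vs" "drop (holes t) us = drop (holes t) vs"
    using 4 by auto
  then show ?case
    by (metis append_take_drop_id)
qed auto

lemma updates_length: "us \<in> updates rank b c \<Longrightarrow> length us = width b"
  by (cases b; cases c) auto

lemma holes_base_dom: "d \<in> base_dom rank b \<Longrightarrow> holes d = width b"
  by (cases b) (auto simp: linear_terms_def)

lemma finite_constraint:
  assumes "is_ty rank (b, \<gamma>)"
  shows "\<exists>cs. is_ty rank (b, set cs) \<and> ty_dom rank (b, \<gamma>) = ty_dom rank (b, set cs)"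
proof (cases "\<exists>(us, vs)\<in>\<gamma>. us \<noteq> vs")
  case True
  then obtain us vs where c: "(us, vs) \<in> \<gamma>" "us \<noteq> vs" by blast
  then have "length us = width b" "length vs = width b"
    using assms by (auto simp: is_ty_def dest: updates_length)
  then have "fill d us \<noteq> fill d vs" if "d \<in> base_dom rank b" for d
    using c(2) fill_inject(1)[of us d vs] holes_base_dom[OF that] by auto
  then have "ty_dom rank (b, \<gamma>) = {}" "ty_dom rank (b, set [(us, vs)]) = {}"
    using c(1) by (auto simp: ty_dom_def)
  moreover have "is_ty rank (b, set [(us, vs)])"
    using assms c(1) by (auto simp: is_ty_def)
  ultimately show ?thesis by metis
next
  case False
  then have "ty_dom rank (b, \<gamma>) = ty_dom rank (b, set [])"
    by (auto simp: ty_dom_def)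
  moreover have "is_ty rank (b, set [])"
    by (simp add: is_ty_def)
  ultimately show ?thesis by metis
qed

lemma finite_transducer_presentable:
  fixes A :: "('q, 'a, 'g) transducer"
  assumes "infinite (UNIV :: 'q set)" and "finite (UNIV :: 'a set)"
    and "is_transducer rank A" and "finite (states A)"
  shows "\<exists>P. presents rank P A"
proof -
  obtain I F E where
    I: "specifies rank start_space (space A) I (delta_init A)" and
    F: "\<And>a. specifies rank (space A) (space A) (F a) (delta A a)" and
    E: "specifies rank (space A) end_space E (delta_final A)"
    using assms(3) unfolding is_transducer_def transformation_def by metis
  obtain qs where qs: "set qs = states A" "distinct qs"
    using assms(4) finite_distinct_list by blast
  have "infinite (UNIV - states A)"
    using assms(1,4) by simp
  then obtain e :: "nat \<Rightarrow> 'q" where e: "inj e" "range e \<subseteq> UNIV - states A"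
    using infinite_countable_subset by blast
  define \<nu> where "\<nu> k = (if k < length qs then qs ! k else e k)" for k
  have mem: "\<nu> k \<in> states A \<longleftrightarrow> k < length qs" for k
    using e(2) qs(1) by (auto simp: \<nu>_def)
  have "inj \<nu>"
  proof (rule injI)
    fix k l assume eq: "\<nu> k = \<nu> l"
    show "k = l"
    proof (cases "k < length qs")
      case True
      then have "l < length qs" using eq mem[of k] mem[of l] by metis
      with True eq qs(2) show ?thesis by (simp add: \<nu>_def nth_eq_iff_index_eq)
    next
      case False
      then have "\<not> l < length qs" using eq mem[of k] mem[of l] by metis
      with False eq e(1) show ?thesis by (simp add: \<nu>_def inj_eq)
    qed
  qed
  have "states A = (\<lambda>k. qs ! k) ` {..<length qs}"
    unfolding qs(1)[symmetric] by (auto simp: set_conv_nth)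
  also have "\<dots> = \<nu> ` {..<length qs}"
    by (rule image_cong) (auto simp: \<nu>_def)
  finally have states: "states A = \<nu> ` {..<length qs}" .
  obtain as :: "'a list" where as: "set as = UNIV" "distinct as"
    using assms(2) finite_distinct_list by blast
  define ix where "ix = (\<lambda>(q, us :: 'g trm list). (inv \<nu> q, us))"
  have ix: "map_option (\<lambda>(j, us). (\<nu> j, us)) (map_option ix x) = x"
    if "\<And>q us. x = Some (q, us) \<Longrightarrow> q \<in> states A" for x :: "('q \<times> 'g trm list) option"
  proof (cases x)
    case (Some y)
    then have "fst y \<in> range \<nu>"
      using that[of "fst y" "snd y"] unfolding states by auto
    then have "\<nu> (inv \<nu> (fst y)) = fst y"
      by (rule f_inv_into_f)
    with Some show ?thesis
      by (cases y) (simp add: ix_def)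
  qed simp
  define cs where "cs q = (SOME cs. is_ty rank (fst (state_ty A q), set cs) \<and>
      ty_dom rank (state_ty A q) = ty_dom rank (fst (state_ty A q), set cs))" for q
  have cs: "is_ty rank (fst (state_ty A q), set (cs q)) \<and>
      ty_dom rank (state_ty A q) = ty_dom rank (fst (state_ty A q), set (cs q))"
    if "q \<in> states A" for q
  proof -
    have "is_ty rank (fst (state_ty A q), snd (state_ty A q))"
      using assms(3) that by (simp add: is_transducer_def)
    from someI_ex[OF finite_constraint[OF this]] show ?thesis
      by (simp add: cs_def)
  qed
  define tr where
    "tr q = map (\<lambda>a. (a, ix (the (F a q)))) (filter (\<lambda>a. F a q \<noteq> None) as)" for q
  have tr: "map_of (tr q) a = map_option ix (F a q)" for a q
  proof (cases "F a q")
    case None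
    then show ?thesis by (auto simp: tr_def map_of_eq_None_iff)
  next
    case (Some y)
    have "distinct (map fst (tr q))"
      using as(2) by (simp add: tr_def comp_def)
    moreover have "(a, ix y) \<in> set (tr q)"
      using Some as(1) by (force simp: tr_def)
    ultimately show ?thesis using Some by simp
  qed
  let ?back = "\<lambda>(j, us). (\<nu> j, us)"
  define descs where
    "descs = map (\<lambda>q. (fst (state_ty A q), cs q, tr q, map_option snd (E q))) qs"
  have start: "I () = map_option ?back (map_option ix (I ()))"
    using I by (intro ix[symmetric]) (auto simp: specifies_def space_def)
  have step: "F a q = map_option ?back (map_of (tr q) a)" for a q
    using F[of a] unfolding tr by (intro ix[symmetric]) (auto simp: specifies_def space_def)
  have final: "E q = map_option (Pair ()) (map_option snd (E q))" for q
    by (cases "E q") auto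
  have desc: "case descs ! k of (b, cs, tr, fin) \<Rightarrow>
      is_ty rank (b, set cs) \<and>
      fst (state_ty A (\<nu> k)) = b \<and> ty_dom rank (state_ty A (\<nu> k)) = ty_dom rank (b, set cs) \<and>
      (\<forall>a. F a (\<nu> k) = map_option ?back (map_of tr a)) \<and>
      E (\<nu> k) = map_option (Pair ()) fin" if "k < length descs" for k
  proof -
    have k: "k < length qs"
      using that by (simp add: descs_def)
    then have *: "descs ! k = (fst (state_ty A (\<nu> k)), cs (\<nu> k), tr (\<nu> k), map_option snd (E (\<nu> k)))"
      by (simp add: descs_def \<nu>_def)
    show ?thesis
      unfolding * prod.case using cs[of "\<nu> k"] mem[of k] k step[of _ "\<nu> k"] final[of "\<nu> k"]
      by blast
  qed
  have states': "states A = \<nu> ` {..<length descs}"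
    using states by (simp add: descs_def)
  have "presents rank (map_option ix (I ()), descs) A"
    unfolding presents_def prod.case
    by (rule conjI[OF assms(3)], rule exI[of _ \<nu>], rule exI[of _ I], rule exI[of _ F],
        rule exI[of _ E], intro conjI allI impI)
      (rule \<open>inj \<nu>\<close> states' I F E start desc, assumption?)+
  then show ?thesis ..
qed

text \<open>Codes of presentations, depending on codes for the letters and for the symbols of the
  ranked alphabet.\<close>

fun trm_code :: "('g \<Rightarrow> nat) \<Rightarrow> 'g trm \<Rightarrow> nat" where
  "trm_code eg Hole = 0"
| "trm_code eg (Node g ts) = Suc (prod_encode (eg g, list_encode (map (trm_code eg) ts)))"

definition upd_code :: "('g \<Rightarrow> nat) \<Rightarrow> 'g trm list \<Rightarrow> nat" where
  "upd_code eg us = list_encode (map (trm_code eg) us)"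

definition option_code :: "('x \<Rightarrow> nat) \<Rightarrow> 'x option \<Rightarrow> nat" where
  "option_code e x = (case x of None \<Rightarrow> 0 | Some y \<Rightarrow> Suc (e y))"

definition pair_code :: "('x \<Rightarrow> nat) \<Rightarrow> ('y \<Rightarrow> nat) \<Rightarrow> 'x \<times> 'y \<Rightarrow> nat" where
  "pair_code e e' = (\<lambda>(x, y). prod_encode (e x, e' y))"

definition base_code :: "base \<Rightarrow> nat" where
  "base_code b = (case b of Init \<Rightarrow> 0 | Arity n \<Rightarrow> Suc n)"

definition target_code :: "('g \<Rightarrow> nat) \<Rightarrow> 'g target \<Rightarrow> nat" where
  "target_code eg = pair_code id (upd_code eg)"

definition state_desc_code :: "('a \<Rightarrow> nat) \<Rightarrow> ('g \<Rightarrow> nat) \<Rightarrow> ('a, 'g) state_desc \<Rightarrow> nat" where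
  "state_desc_code ea eg =
     pair_code base_code
       (pair_code (\<lambda>cs. list_encode (map (pair_code (upd_code eg) (upd_code eg)) cs))
         (pair_code (\<lambda>tr. list_encode (map (pair_code ea (target_code eg)) tr))
           (option_code (upd_code eg))))"

definition presentation_code :: "('a \<Rightarrow> nat) \<Rightarrow> ('g \<Rightarrow> nat) \<Rightarrow> ('a, 'g) presentation \<Rightarrow> nat" where
  "presentation_code ea eg =
     pair_code (option_code (target_code eg))
       (\<lambda>descs. list_encode (map (state_desc_code ea eg) descs))"


section \<open>Partial recursive functions\<close>

text \<open>Primitive recursion is on the first argument, and minimization searches for the first
  argument; \<open>eval f xs = None\<close> means that \<open>f\<close> diverges on \<open>xs\<close>.\<close>

datatype recf = Zero | Succ | Proj nat | Comp recf "recf list" | PrimRec recf recf | Mu recf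

fun eval :: "recf \<Rightarrow> nat list \<Rightarrow> nat option" where
  "eval Zero xs = Some 0"
| "eval Succ xs = (case xs of [] \<Rightarrow> None | x # _ \<Rightarrow> Some (Suc x))"
| "eval (Proj i) xs = (if i < length xs then Some (xs ! i) else None)"
| "eval (Comp f gs) xs =
     (let ys = map (\<lambda>g. eval g xs) gs in if None \<in> set ys then None else eval f (map the ys))"
| "eval (PrimRec f g) xs = (case xs of [] \<Rightarrow> None | n # ys \<Rightarrow>
     rec_nat (eval f ys) (\<lambda>m r. Option.bind r (\<lambda>v. eval g (m # v # ys))) n)"
| "eval (Mu f) xs =
     (if \<exists>n. eval f (n # xs) = Some 0 \<and> (\<forall>m<n. \<exists>v. eval f (m # xs) = Some (Suc v))
      then Some (LEAST n. eval f (n # xs) = Some 0) else None)"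

end

theory Submission
  imports Defs
begin

text \<open>A linear term with \<open>n\<close> placeholders is an arrow from \<open>1\<close> to \<open>n\<close> in a category whose arrows
  are forests, and updates act by composition. Composition is cancellative on the left, and every
  family of ground terms has a greatest common prefix, which every common prefix divides. For each
  live word \<open>w\<close>, split off the greatest common prefix of the family \<open>v \<mapsto> \<phi>(wv)\<close>. The residual
  families are the states of the minimal transducer. Conversely, call a transducer reduced if its
  states are reachable and productive, have pairwise distinct output families, and no component
  of such a family has a constant root. By the divisibility property, the reachable part of any
  live realizer maps uniquely onto a reduced realizer, and this map is an epi. The reachable part
  is a strong subobject because epis hit all inhabited states.

  For effectiveness, it is decidable whether given finite data certify that one presentation is
  the reduction of another one: a table of the map above, a list of dead states, and test words
  that witness reducedness. Such data always exist, so an unbounded search finds them.\<close>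

section \<open>Common prefixes of linear terms\<close>

text \<open>Left cancellation does more than make factorizations unique. A forest is determined by
  its effect on a single term of the right arity, so equations between updates can be checked on one
  run. For the same reason a constraint either holds on its whole base type or empties it, and it
  never restricts a reachable state. It can leave behind states without configurations: an arrow
  does not determine its control component there, and epis are only shown to hit inhabited states.
  The category fixes the state type, which is merely assumed infinite. This makes room for two
  copies of any set of states, but not for a name of every conceivable residual family. Names exist
  because live words that lead a realizer to the same state have the same residual family. A direct
  minimization would have to compute greatest common prefixes of infinite families. The search for
  certificates only compares finitely many forests, and the existence theorem yields its
  termination. It runs on numbers, while letters and symbols merely have injective codes, so
  certificates are transported along renamings in both directions.\<close>

lemma length_fills [simp]: "length (fills ts us) = length ts"
  by (induction ts arbitrary: us) auto

text \<open>\<open>fill\<close> reads only as many arguments as there are placeholders, so cutting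
  off a surplus is harmless. This reconciles the \<open>take\<close> in the recursion of
  \<open>fills\<close> with tuples that are split elsewhere.\<close>

lemma fill_take: "holes t \<le> n \<Longrightarrow> fill t (take n us) = fill t us"
  and fills_take: "sum_list (map holes ts) \<le> n \<Longrightarrow> fills ts (take n us) = fills ts us"
proof (induction t us and ts us arbitrary: n and n rule: fill_fills.induct)
  case (1 us)
  then show ?case by (cases us; cases n) auto
next
  case (4 t ts us)
  then have "fills ts (take (n - holes t) (drop (holes t) us)) = fills ts (drop (holes t) us)"
    by simp
  with 4 show ?case by (simp add: min_absorb1 drop_take)
qed auto

lemma take_fills: "take n (fills ts us) = fills (take n ts) us"
proof (induction ts arbitrary: n us)
  case (Cons t ts)
  then show ?case by (cases n) auto
qed simp

lemma drop_fills: "drop n (fills ts us) = fills (drop n ts) (drop (sum_list (map holes (take n ts))) us)"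
proof (induction ts arbitrary: n us)
  case (Cons t ts)
  then show ?case by (cases n) (auto simp: add.commute)
qed simp

lemma holes_fill: "length us = holes t \<Longrightarrow> holes (fill t us) = sum_list (map holes us)"
  and holes_fills: "length us = sum_list (map holes ts) \<Longrightarrow>
    sum_list (map holes (fills ts us)) = sum_list (map holes us)"
proof (induction t us and ts us rule: fill_fills.induct)
  case (1 us)
  then show ?case by (cases us) auto
next
  case (4 t ts us)
  then have "sum_list (map holes (fills (t # ts) us)) =
      sum_list (map holes (take (holes t) us @ drop (holes t) us))"
    unfolding map_append sum_list_append by simp
  then show ?case by simp
qed auto

lemma ranked_fill: "length us = holes t \<Longrightarrow>
    ranked rank (fill t us) \<longleftrightarrow> ranked rank t \<and> (\<forall>u\<in>set us. ranked rank u)"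
  and ranked_fills: "length us = sum_list (map holes ts) \<Longrightarrow>
    (\<forall>t\<in>set (fills ts us). ranked rank t) \<longleftrightarrow> (\<forall>t\<in>set ts. ranked rank t) \<and> (\<forall>u\<in>set us. ranked rank u)"
proof (induction t us and ts us rule: fill_fills.induct)
  case (1 us)
  then show ?case by (cases us) auto
next
  case (4 t ts us)
  have "set us = set (take (holes t) us) \<union> set (drop (holes t) us)"
    by (metis append_take_drop_id set_append)
  with 4 show ?case by auto
qed auto

text \<open>Associativity of composition. Both sides split \<open>vs\<close> at the same place
  because \<open>holes_fill\<close> counts the placeholders that the first trees of
  \<open>us\<close> leave open.\<close>

lemma fill_fill: "length us = holes t \<Longrightarrow> fill (fill t us) vs = fill t (fills us vs)"
  and fills_fills: "length us = sum_list (map holes ts) \<Longrightarrow>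
    fills (fills ts us) vs = fills ts (fills us vs)"
proof (induction t us and ts us arbitrary: vs and vs rule: fill_fills.induct)
  case (1 us)
  then show ?case by (cases us) (auto simp: fill_take)
next
  case (4 t ts us)
  let ?us1 = "take (holes t) us" and ?us2 = "drop (holes t) us"
  have h: "holes (fill t ?us1) = sum_list (map holes ?us1)"
    using 4 by (simp add: holes_fill)
  have "fill (fill t ?us1) (take (sum_list (map holes ?us1)) vs) = fill t (fills ?us1 vs)"
    using 4 by (simp add: fills_take)
  then show ?case
    using 4 by (simp add: h take_fills drop_fills)
qed auto

text \<open>One of the two unit laws: a tuple of placeholders is an identity arrow. The other law is
  \<open>fill_Holes\<close>.\<close>

lemma fills_Holes: "length us = n \<Longrightarrow> fills (replicate n Hole) us = us"
proof (induction n arbitrary: us)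
  case (Suc n)
  then show ?case by (cases us) auto
qed simp

lemma fill_Holes: "fill t (replicate (holes t) Hole) = t"
proof (induction t)
  case (Node g ts)
  then have "fills ts (replicate (sum_list (map holes ts)) Hole) = ts"
    by (induction ts) (auto simp: min_def)
  then show ?case by simp
qed simp

section \<open>Families of forests without a common prefix\<close>

fun root_symbol :: "'g trm \<Rightarrow> 'g option" where
  "root_symbol Hole = None"
| "root_symbol (Node g ts) = Some g"

text \<open>No component of the family \<open>u\<close> has a constant root, that is, \<open>u\<close> has no common prefix other
  than the trivial one.\<close>

definition spread :: "nat \<Rightarrow> 'v set \<Rightarrow> ('v \<Rightarrow> 'g trm list) \<Rightarrow> bool" where
  "spread n V u \<longleftrightarrow> (\<forall>v\<in>V. length (u v) = n) \<and>
     (\<forall>i<n. \<exists>v\<in>V. \<exists>w\<in>V. root_symbol (u v ! i) \<noteq> root_symbol (u w ! i))"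

lemma spread_take:
  assumes "spread (m + n) V u"
  shows "spread m V (\<lambda>v. take m (u v))"
  unfolding spread_def
proof (intro conjI allI impI)
  fix i assume "i < m"
  then have "i < m + n" by simp
  then obtain v w where "v \<in> V" "w \<in> V" "root_symbol (u v ! i) \<noteq> root_symbol (u w ! i)"
    using assms unfolding spread_def by blast
  then show "\<exists>v\<in>V. \<exists>w\<in>V. root_symbol (take m (u v) ! i) \<noteq> root_symbol (take m (u w) ! i)"
    using \<open>i < m\<close> by auto
qed (use assms in \<open>auto simp: spread_def\<close>)

lemma spread_drop:
  assumes "spread (m + n) V u"
  shows "spread n V (\<lambda>v. drop m (u v))"
  unfolding spread_def
proof (intro conjI allI impI)
  fix i assume "i < n"
  then have "m + i < m + n" by simp
  then obtain v w where "v \<in> V" "w \<in> V" "root_symbol (u v ! (m + i)) \<noteq> root_symbol (u w ! (m + i))"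
    using assms unfolding spread_def by blast
  then show "\<exists>v\<in>V. \<exists>w\<in>V. root_symbol (drop m (u v) ! i) \<noteq> root_symbol (drop m (u w) ! i)"
    using assms by (auto simp: spread_def)
qed (use assms in \<open>auto simp: spread_def\<close>)

text \<open>Descend \<open>d\<close> and \<open>e\<close> in parallel. Where \<open>d\<close> has a
  placeholder, the subterm of \<open>e\<close> at that place is the component of \<open>f\<close>. A
  placeholder of \<open>e\<close> cannot meet a symbol \<open>g\<close> of \<open>d\<close>: the
  corresponding component of \<open>u'\<close> would have root \<open>g\<close> for all
  \<open>v\<close>.\<close>

lemma prefix_of_spread:
  assumes "V \<noteq> {}" and "\<And>v. v \<in> V \<Longrightarrow> length (u v) = holes d"
    and "spread (holes e) V u'" and "\<And>v. v \<in> V \<Longrightarrow> fill d (u v) = fill e (u' v)"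
  shows "\<exists>f. length f = holes d \<and> fill d f = e"
  using assms
proof (induction d arbitrary: e u u')
  case Hole
  show ?case by (rule exI[of _ "[e]"]) simp
next
  case (Node g ds)
  obtain v where v: "v \<in> V" using Node.prems(1) by blast
  show ?case
  proof (cases e)
    case Hole
    then obtain w w' where w: "w \<in> V" "w' \<in> V" "root_symbol (u' w ! 0) \<noteq> root_symbol (u' w' ! 0)"
      using Node.prems(3) unfolding spread_def by auto
    have "root_symbol (u' x ! 0) = Some g" if "x \<in> V" for x
    proof -
      have "length (u' x) = 1" using Node.prems(3) that Hole by (simp add: spread_def)
      then have "u' x ! 0 = fill e (u' x)" using Hole by (cases "u' x") auto
      then show ?thesis using Node.prems(4)[OF that] by (metis fill.simps(2) root_symbol.simps(2))
    qed
    with w show ?thesis by metis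
  next
    case e: (Node g' es)
    \<comment> \<open>The inner induction runs over the children of \<open>d\<close> and takes one
      tree from \<open>es\<close> at a time. Both families are cut accordingly, and a segment of a
      spread family is spread.\<close>
    have "\<exists>f. length f = sum_list (map holes ds) \<and> fills ds f = es"
      using Node.IH Node.prems(2)[unfolded holes.simps] Node.prems(3)[unfolded e holes.simps]
        Node.prems(4)[unfolded e fill.simps trm.inject, THEN conjunct2]
    proof (induction ds arbitrary: es u u')
      case Nil
      have "length (fills es (u' v)) = 0"
        using Nil(4)[OF v] by (metis fills.simps(1) list.size(3))
      then show ?case by auto
    next
      case (Cons d ds)
      have "length (fills es (u' v)) = Suc (length ds)"
        using Cons.prems(4)[OF v] by (metis length_fills length_Cons)
      then obtain e es' where es: "es = e # es'" by (cases es) auto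
      have uv: "fill d (take (holes d) (u v)) = fill e (take (holes e) (u' v))"
        "fills ds (drop (holes d) (u v)) = fills es' (drop (holes e) (u' v))"
        "length (u v) = holes d + sum_list (map holes ds)" if "v \<in> V" for v
        using Cons.prems(2,4)[OF that] es by simp_all
      have "\<exists>f. length f = holes d \<and> fill d f = e"
      proof (rule Cons.prems(1)[of d "\<lambda>v. take (holes d) (u v)" e "\<lambda>v. take (holes e) (u' v)"])
        show "spread (holes e) V (\<lambda>v. take (holes e) (u' v))"
          using Cons.prems(3) es by (auto intro: spread_take)
      qed (use Node.prems(1) uv in auto)
      moreover have "\<exists>f. length f = sum_list (map holes ds) \<and> fills ds f = es'"
      proof (rule Cons.IH[of "\<lambda>v. drop (holes d) (u v)" es' "\<lambda>v. drop (holes e) (u' v)"])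
        show "spread (sum_list (map holes es')) V (\<lambda>v. drop (holes e) (u' v))"
          using Cons.prems(3) es by (auto intro: spread_drop)
      qed ((rule Cons.prems(1); (assumption | simp)), simp_all add: uv Node.prems(1))
      ultimately obtain f f' where "length f = holes d" "fill d f = e"
        "length f' = sum_list (map holes ds)" "fills ds f' = es'" by blast
      then show ?case
        by (intro exI[of _ "f @ f'"]) (simp add: es)
    qed
    moreover have "g = g'"
      using Node.prems(4)[OF v] e by simp
    ultimately show ?thesis using e by simp
  qed
qed

text \<open>A component of \<open>f\<close> with a symbol at its root would impose this root on the
  same component of every \<open>u v\<close>.\<close>

lemma spread_prefix_trivial:
  assumes "V \<noteq> {}" and "length f = n" and "spread n V u"
    and "\<And>v. v \<in> V \<Longrightarrow> length (u' v) = sum_list (map holes f)"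
    and "\<And>v. v \<in> V \<Longrightarrow> u v = fills f (u' v)"
  shows "f = replicate n Hole"
proof -
  have root_fills: "root_symbol (fills f vs ! i) = Some g" if "i < length f" "f ! i = Node g ts" for i g ts vs
    using that
  proof (induction f arbitrary: i vs)
    case (Cons t f)
    then show ?case by (cases i) auto
  qed simp
  have "f ! i = Hole" if i: "i < n" for i
  proof (rule ccontr)
    assume "f ! i \<noteq> Hole"
    then obtain g ts where g: "f ! i = Node g ts" by (cases "f ! i") auto
    obtain v w where "v \<in> V" "w \<in> V" "root_symbol (u v ! i) \<noteq> root_symbol (u w ! i)"
      using assms(3) i unfolding spread_def by blast
    then show False using assms(2,5) root_fills[OF _ g] i by simp
  qed
  then show ?thesis by (intro nth_equalityI) (auto simp: assms(2))
qed

text \<open>Divisibility yields \<open>f\<close> with \<open>e = fill d f\<close>. Cancelling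
  \<open>d\<close> shows that \<open>f\<close> is a common prefix of \<open>u\<close>, which is
  spread, so \<open>f\<close> consists of placeholders.\<close>

lemma spread_unique:
  assumes "V \<noteq> {}" and "spread (holes d) V u" and "spread (holes e) V u'"
    and "\<And>v. v \<in> V \<Longrightarrow> fill d (u v) = fill e (u' v)"
  shows "d = e" and "\<And>v. v \<in> V \<Longrightarrow> u v = u' v"
proof -
  obtain f where f: "length f = holes d" "fill d f = e"
    using prefix_of_spread[OF assms(1) _ assms(3,4)] assms(2) unfolding spread_def by blast
  have len: "length (u' v) = sum_list (map holes f)" if "v \<in> V" for v
    using assms(3) that holes_fill[OF f(1)] unfolding spread_def f(2) by simp
  have "u v = fills f (u' v)" if "v \<in> V" for v
  proof (rule fill_inject(1))
    show "fill d (u v) = fill d (fills f (u' v))"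
      using assms(4)[OF that] f len[OF that] by (metis fill_fill)
  qed (use assms(2) that f(1) in \<open>auto simp: spread_def\<close>)
  then have "f = replicate (holes d) Hole"
    using spread_prefix_trivial[OF assms(1) f(1) assms(2)] len by blast
  with f show "d = e" using fill_Holes by metis
  then show "u v = u' v" if "v \<in> V" for v
    using fill_inject(1)[of "u v" d "u' v"] assms that unfolding spread_def by metis
qed

section \<open>Existence of greatest common prefixes and uniqueness of factorizations\<close>

lemma spread_append:
  assumes "spread m V u" and "spread n V u'"
  shows "spread (m + n) V (\<lambda>v. u v @ u' v)"
  unfolding spread_def
proof (intro conjI allI impI)
  fix i assume i: "i < m + n"
  show "\<exists>v\<in>V. \<exists>w\<in>V. root_symbol ((u v @ u' v) ! i) \<noteq> root_symbol ((u w @ u' w) ! i)"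
  proof (cases "i < m")
    case True
    then show ?thesis using assms by (auto simp: spread_def nth_append)
  next
    case False
    then have "i - m < n" using i by simp
    then show ?thesis using assms False by (auto simp: spread_def nth_append)
  qed
qed (use assms in \<open>auto simp: spread_def\<close>)

text \<open>Recursion along one member \<open>t v0\<close>. If the roots differ somewhere, the
  prefix is a single placeholder. If all roots equal \<open>g\<close>, being ranked gives all
  members the same number of children, and the prefixes of the families of children are combined
  below \<open>g\<close>.\<close>

lemma greatest_common_prefix:
  assumes "V \<noteq> {}" and "\<And>v. v \<in> V \<Longrightarrow> ranked rank (t v)" and "\<And>v. v \<in> V \<Longrightarrow> holes (t v) = 0"
  shows "\<exists>d u. spread (holes d) V u \<and> (\<forall>v\<in>V. t v = fill d (u v))"
proof -
  obtain v0 where v0: "v0 \<in> V" using assms(1) by blast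
  have "\<exists>d u. spread (holes d) V u \<and> (\<forall>v\<in>V. t v = fill d (u v))" if "t v0 = s" for s
    using that assms(2,3)
  proof (induction s arbitrary: t)
    case Hole
    with v0 show ?case by force
  next
    case (Node g ss)
    show ?case
    proof (cases "\<forall>v\<in>V. root_symbol (t v) = Some g")
      case False
      then obtain w where "w \<in> V" "root_symbol (t w) \<noteq> root_symbol (t v0)"
        using Node.prems(1) by auto
      then have "spread (holes Hole) V (\<lambda>v. [t v])"
        using v0 by (auto simp: spread_def)
      then show ?thesis by (intro exI[of _ Hole] exI[of _ "\<lambda>v. [t v]"]) simp
    next
      case True
      \<comment> \<open>The value at \<open>Hole\<close> is arbitrary, since here every member of
        the family has root \<open>g\<close>.\<close>
      define ts where "ts v = (case t v of Node g ts \<Rightarrow> ts | Hole \<Rightarrow> [])" for v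
      have t: "t v = Node g (ts v)" if "v \<in> V" for v
        using True that by (cases "t v") (auto simp: ts_def)
      have ss: "ts v0 = ss" using Node.prems(1) by (simp add: ts_def)
      have forest: "\<exists>ds u. spread (sum_list (map holes ds)) V u \<and> (\<forall>v\<in>V. ts v = fills ds (u v))"
        if "\<And>v. v \<in> V \<Longrightarrow> length (ts v) = length ss" "ts v0 = ss"
          "\<And>v s. v \<in> V \<Longrightarrow> s \<in> set (ts v) \<Longrightarrow> ranked rank s \<and> holes s = 0" for ts
        using Node.IH that
      proof (induction ss arbitrary: ts)
        case Nil
        then show ?case by (intro exI[of _ "[]"] exI[of _ "\<lambda>_. []"]) (auto simp: spread_def)
      next
        case (Cons s ss)
        have ts: "ts v = hd (ts v) # tl (ts v)" "length (tl (ts v)) = length ss"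
          "hd (ts v) \<in> set (ts v)" "set (tl (ts v)) \<subseteq> set (ts v)" if "v \<in> V" for v
          using Cons.prems(2)[OF that] by (cases "ts v"; auto)+
        have "\<exists>d u. spread (holes d) V u \<and> (\<forall>v\<in>V. hd (ts v) = fill d (u v))"
          by (rule Cons.prems(1)[of s]) (use Cons.prems(3,4) ts(3) v0 in auto)
        moreover have "\<exists>ds u. spread (sum_list (map holes ds)) V u \<and> (\<forall>v\<in>V. tl (ts v) = fills ds (u v))"
        proof (rule Cons.IH)
          show "ranked rank s \<and> holes s = 0" if "v \<in> V" "s \<in> set (tl (ts v))" for v s
            using Cons.prems(4)[OF that(1)] ts(4)[OF that(1)] that(2) by blast
        qed ((rule Cons.prems(1); (assumption | simp)), (use ts(2) Cons.prems(3) in simp_all))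
        ultimately obtain d u ds u' where
          "spread (holes d) V u" "\<forall>v\<in>V. hd (ts v) = fill d (u v)"
          "spread (sum_list (map holes ds)) V u'" "\<forall>v\<in>V. tl (ts v) = fills ds (u' v)"
          by blast
        moreover from this have "\<forall>v\<in>V. ts v = fills (d # ds) (u v @ u' v)"
          using ts(1) by (auto simp: spread_def)
        ultimately show ?case
          by (intro exI[of _ "d # ds"] exI[of _ "\<lambda>v. u v @ u' v"]) (simp add: spread_append)
      qed
      have "length (ts v) = length ss" if "v \<in> V" for v
        using Node.prems(2)[OF that] Node.prems(2)[OF v0] t[OF that] t[OF v0] ss by simp
      moreover have "ranked rank s \<and> holes s = 0" if "v \<in> V" "s \<in> set (ts v)" for v s
        using Node.prems(2,3)[OF that(1)] t[OF that(1)] that(2) by simp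
      ultimately obtain ds u where
        "spread (sum_list (map holes ds)) V u" "\<forall>v\<in>V. ts v = fills ds (u v)"
        using forest[of ts] ss by blast
      then show ?thesis
        using t by (intro exI[of _ "Node g ds"] exI[of _ u]) auto
    qed
  qed
  then show ?thesis by blast
qed

text \<open>Divisibility for partial families: \<open>eq\<close> forces \<open>s\<close> and
  \<open>r\<close> to have the same domain, and once \<open>e = fill d f\<close> is known,
  cancelling \<open>d\<close> expresses \<open>s\<close> through \<open>r\<close>.\<close>

lemma common_prefix_of_spread:
  fixes r s :: "'v \<Rightarrow> 'g trm list option"
  assumes "dom r \<noteq> {}" and "spread (holes e) (dom r) (\<lambda>v. the (r v))"
    and eq: "\<And>v. map_option (fill d) (s v) = map_option (fill e) (r v)"
    and len: "\<And>v us. s v = Some us \<Longrightarrow> length us = holes d"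
  shows "\<exists>f. length f = holes d \<and> fill d f = e \<and> (\<forall>v. s v = map_option (fills f) (r v))"
proof -
  have *: "\<exists>x. s v = Some x \<and> length x = holes d \<and> fill d x = fill e y" if "r v = Some y" for v y
    using eq[of v] that len[of v] by (cases "s v") auto
  have "\<exists>f. length f = holes d \<and> fill d f = e"
  proof (rule prefix_of_spread[OF assms(1) _ assms(2)])
    fix v assume "v \<in> dom r"
    then show "length (the (s v)) = holes d" "fill d (the (s v)) = fill e (the (r v))"
      using * by fastforce+
  qed
  then obtain f where f: "length f = holes d" "fill d f = e" by blast
  have "s v = map_option (fills f) (r v)" for v
  proof (cases "r v")
    case None
    then show ?thesis using eq[of v] by simp
  next
    case (Some y)
    then obtain x where x: "s v = Some x" "length x = holes d" "fill d x = fill d (fills f y)"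
      using * f fill_fill by metis
    then have "x = fills f y" using fill_inject(1)[of x d "fills f y"] f(1) by simp
    then show ?thesis using x Some by simp
  qed
  with f show ?thesis by blast
qed

text \<open>Placing the forests below \<open>d\<close> turns them into terms, to which
  \<open>spread_unique\<close> applies; cancelling \<open>d\<close> recovers the forests. The term
  is a parameter because an alphabet need not have terms with a prescribed number of placeholders.
  In the applications a run or a prefix supplies one.\<close>

lemma forest_factorization_unique:
  fixes r r' :: "'v \<Rightarrow> 'g trm list option" and d :: "'g trm"
  assumes "dom r \<noteq> {}" and "spread (sum_list (map holes f)) (dom r) (\<lambda>v. the (r v))"
    and "spread (sum_list (map holes f')) (dom r') (\<lambda>v. the (r' v))"
    and len: "length f = holes d" "length f' = holes d"
    and eq: "\<And>v. map_option (fills f) (r v) = map_option (fills f') (r' v)"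
  shows "f = f'" and "r = r'"
proof -
  have dom: "r v = None \<longleftrightarrow> r' v = None" for v
    using eq[of v] by (metis option.map_disc_iff)
  then have dom': "dom r' = dom r" by (auto simp: dom_def)
  have eq': "fill (fill d f) (the (r v)) = fill (fill d f') (the (r' v))" if "v \<in> dom r" for v
    using that eq[of v] dom[of v] by (auto simp: fill_fill len)
  have s: "spread (holes (fill d f)) (dom r) (\<lambda>v. the (r v))"
    "spread (holes (fill d f')) (dom r) (\<lambda>v. the (r' v))"
    using assms(2,3) by (simp_all add: holes_fill len dom')
  note unique = spread_unique[OF assms(1) s]
  have "fill d f = fill d f'" using unique(1) eq' by blast
  then show "f = f'" using fill_inject(1) len by blast
  show "r = r'"
  proof
    fix v
    show "r v = r' v"
    proof (cases "v \<in> dom r")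
      case True
      then have "the (r v) = the (r' v)" using unique(2) eq' by blast
      with True dom[of v] show ?thesis by auto
    next
      case False
      with dom[of v] show ?thesis by auto
    qed
  qed
qed

section \<open>Transducers with specified transitions\<close>

lemma updates_props:
  assumes "us \<in> updates rank b c"
  shows "length us = width b" "\<And>u. u \<in> set us \<Longrightarrow> ranked rank u" "sum_list (map holes us) = width c"
  using assms by (cases b; cases c; auto)+

lemma fill_base_dom:
  assumes "d \<in> base_dom rank b" and "us \<in> updates rank b c"
  shows "fill d us \<in> base_dom rank c"
proof (cases c)
  case Init
  then show ?thesis using assms by (cases b) auto
next
  case (Arity n)
  have "ranked rank d" using assms(1) by (cases b) (auto simp: linear_terms_def)
  then show ?thesis
    using Arity updates_props[OF assms(2)] holes_base_dom[OF assms(1)]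
    by (simp add: linear_terms_def ranked_fill holes_fill)
qed

lemma fills_updates:
  assumes "us \<in> updates rank b c" and "vs \<in> updates rank c (Arity n)"
  shows "fills us vs \<in> updates rank b (Arity n)"
  using updates_props[OF assms(1)] updates_props[OF assms(2)]
  by (simp add: holes_fills ranked_fills)

lemma specifies_apply:
  assumes "specifies rank X Y F f" and "(p, d) \<in> configs rank X"
  shows "f (p, d) = map_option (\<lambda>(q, us). (q, fill d us)) (F p)"
  using assms by (simp add: specifies_def)

lemma specifies_updates:
  assumes "specifies rank X Y F f" and "F p = Some (q, us)"
  shows "p \<in> fst X" "q \<in> fst Y" "us \<in> updates rank (fst (snd X p)) (fst (snd Y q))"
  using assms unfolding specifies_def ty_updates_def by blast+

lemma holes_configs: "(q, d) \<in> configs rank X \<Longrightarrow> holes d = width (fst (snd X q))"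
  by (cases "snd X q") (auto simp: configs_def ty_dom_def dest: holes_base_dom)

lemma run_Nil: "run A [] = delta_init A ((), Hole)"
  by (simp add: run_def map_seq_apply split: option.splits)

lemma steps_append: "steps A (v @ w) = steps A v ;; steps A w"
proof (induction v)
  case Nil
  show ?case by (rule ext) (simp add: map_seq_apply)
qed (simp add: map_seq_assoc)

lemma run_append: "run A (w @ v) = Option.bind (run A w) (steps A v)"
  by (simp add: run_def steps_append flip: map_seq_assoc) (simp add: map_seq_apply)

lemma run_snoc: "run A (w @ [a]) = Option.bind (run A w) (delta A a)"
  by (simp add: run_append map_seq_apply[abs_def])

lemma transduction_run:
  "transduction A (w @ v) = Option.bind (run A w) (\<lambda>c. map_option snd ((steps A v ;; delta_final A) c))"
proof -
  have "transduction A (w @ v) = map_option snd (Option.bind (run A (w @ v)) (delta_final A))"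
    by (simp add: transduction_def run_def map_seq_apply)
  then show ?thesis
    by (cases "run A w") (simp_all add: run_append map_seq_apply)
qed

text \<open>The forest by which the state \<open>q\<close> completes every configuration when reading \<open>v\<close>.\<close>

primrec outw :: "('a \<Rightarrow> 'q \<rightharpoonup> 'q \<times> 'g trm list) \<Rightarrow> ('q \<rightharpoonup> unit \<times> 'g trm list) \<Rightarrow>
    'a list \<Rightarrow> 'q \<rightharpoonup> 'g trm list" where
  "outw F E [] q = map_option snd (E q)"
| "outw F E (a # v) q = Option.bind (F a q) (\<lambda>(p, us). map_option (fills us) (outw F E v p))"

text \<open>The components \<open>I\<close>, \<open>F\<close>, \<open>E\<close> are parameters,
  since the partial functions of \<open>A\<close> do not determine them at states whose domain is
  empty.\<close>

locale specified =
  fixes rank :: "'g \<Rightarrow> nat" and A :: "('q, 'a, 'g) transducer" and I F E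
  assumes transducer: "is_transducer rank A"
    and spec_init: "specifies rank start_space (space A) I (delta_init A)"
    and spec_step: "\<And>a. specifies rank (space A) (space A) (F a) (delta A a)"
    and spec_final: "specifies rank (space A) end_space E (delta_final A)"
begin

abbreviation wd :: "'q \<Rightarrow> nat" where
  "wd q \<equiv> width (fst (state_ty A q))"

abbreviation out :: "'q \<Rightarrow> 'a list \<rightharpoonup> 'g trm list" where
  "out q \<equiv> (\<lambda>v. outw F E v q)"

lemma space_simps [simp]: "fst (space A) = states A" "snd (space A) = state_ty A"
  by (simp_all add: space_def)

lemma run_Nil_spec: "run A [] = map_option (\<lambda>(q, us). (q, hd us)) (I ())"
proof -
  have "((), Hole) \<in> configs rank start_space"
    by (simp add: configs_def start_space_def ty_dom_def)
  from specifies_apply[OF spec_init this] show ?thesis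
    by (simp add: run_Nil)
qed

lemma run_configs: "run A w = Some c \<Longrightarrow> c \<in> configs rank (space A)"
  using run_in_configs transducer .

lemma run_snoc_spec:
  assumes "run A w = Some (q, d)"
  shows "run A (w @ [a]) = map_option (\<lambda>(p, us). (p, fill d us)) (F a q)"
  using specifies_apply[OF spec_step run_configs[OF assms]] assms by (simp add: run_snoc)

lemma run_states: "run A w = Some (q, d) \<Longrightarrow> q \<in> states A"
  using run_configs by (fastforce simp: configs_def)

lemma run_holes: "run A w = Some (q, d) \<Longrightarrow> holes d = wd q"
  using holes_configs[OF run_configs] by auto

lemma run_ranked: "run A w = Some (q, d) \<Longrightarrow> ranked rank d"
  using run_configs[of w "(q, d)"]
  by (cases "state_ty A q"; cases "fst (state_ty A q)")
    (auto simp: configs_def ty_dom_def linear_terms_def)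

lemma step_spec:
  assumes "F a q = Some (p, us)"
  shows "q \<in> states A" "p \<in> states A" "us \<in> updates rank (fst (state_ty A q)) (fst (state_ty A p))"
  using specifies_updates[OF spec_step assms] by simp_all

lemma final_spec:
  assumes "E q = Some (x, us)"
  shows "q \<in> states A" "us \<in> updates rank (fst (state_ty A q)) (Arity 0)"
  using specifies_updates[OF spec_final assms] by (simp_all add: end_space_def)

lemma out_updates: "out q v = Some us \<Longrightarrow> us \<in> updates rank (fst (state_ty A q)) (Arity 0)"
proof (induction v arbitrary: q us)
  case Nil
  then show ?case using final_spec by auto
next
  case (Cons a v)
  then obtain p us' vs where *: "F a q = Some (p, us')" "out p v = Some vs" "us = fills us' vs"
    by (auto simp: bind_eq_Some_conv)
  show ?case unfolding *(3) using fills_updates[OF step_spec(3)[OF *(1)] Cons.IH[OF *(2)]] .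
qed

lemma out_length: "out q v = Some us \<Longrightarrow> length us = wd q"
  using updates_props(1)[OF out_updates] .

text \<open>Associativity collects the updates along \<open>v\<close> into a single forest, which
  does not depend on the term \<open>d\<close>.\<close>

lemma steps_final:
  assumes "(q, d) \<in> configs rank (space A)"
  shows "(steps A v ;; delta_final A) (q, d) = map_option (\<lambda>us. ((), fill d us)) (out q v)"
  using assms
proof (induction v arbitrary: q d)
  case Nil
  then show ?case
    using specifies_apply[OF spec_final Nil]
    by (cases "E q") (auto simp: map_seq_apply)
next
  case (Cons a v)
  show ?case
  proof (cases "F a q")
    case None
    then show ?thesis using specifies_apply[OF spec_step Cons.prems] by (simp add: map_seq_apply)
  next
    case (Some y)
    then obtain p us where y: "F a q = Some (p, us)" by (cases y) auto
    have step: "delta A a (q, d) = Some (p, fill d us)"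
      using specifies_apply[OF spec_step Cons.prems] y by simp
    then have "(p, fill d us) \<in> configs rank (space A)"
      using transducer transformation_in_configs unfolding is_transducer_def by metis
    from Cons.IH[OF this] step have "(steps A (a # v) ;; delta_final A) (q, d) =
        map_option (\<lambda>vs. ((), fill (fill d us) vs)) (out p v)"
      by (simp add: map_seq_assoc) (simp add: map_seq_apply)
    moreover have "fill (fill d us) vs = fill d (fills us vs)" for vs
      using holes_configs[OF Cons.prems] updates_props(1)[OF step_spec(3)[OF y]] by (simp add: fill_fill)
    ultimately show ?thesis by (simp add: y option.map_comp comp_def)
  qed
qed

text \<open>The equation through which transducers are compared: the left side belongs to the
  transduction alone, the right side factors it through the configuration reached on
  \<open>w\<close>.\<close>

lemma transduction_out:
  assumes "run A w = Some (q, d)"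
  shows "transduction A (w @ v) = map_option (fill d) (out q v)"
  using steps_final[OF run_configs[OF assms]] assms
  by (simp add: transduction_run option.map_comp comp_def)

lemma run_prefix_defined: "transduction A (w @ v) \<noteq> None \<Longrightarrow> run A w \<noteq> None"
  using transduction_run[of A w v] by (cases "run A w") simp_all

definition useful :: "'q \<Rightarrow> bool" where
  "useful q \<longleftrightarrow> (\<exists>w d v. run A w = Some (q, d) \<and> out q v \<noteq> None)"

end

lemma obtain_specified:
  assumes "is_transducer rank A"
  obtains I F E where "specified rank A I F E"
proof -
  have "\<forall>a. \<exists>F. specifies rank (space A) (space A) F (delta A a)"
    using assms unfolding is_transducer_def transformation_def by blast
  then obtain F where "\<forall>a. specifies rank (space A) (space A) (F a) (delta A a)" by metis
  with assms that show ?thesis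
    unfolding is_transducer_def transformation_def specified_def by blast
qed

text \<open>\<open>unconstrained\<close> excludes constraints as well as the initial type. Into a
  type \<open>(Arity n, {})\<close> every ranked forest of the right shape is an update, so the
  forests that divisibility provides are legal.\<close>

locale reduced = specified +
  assumes reachable: "q \<in> states A \<Longrightarrow> \<exists>w d. run A w = Some (q, d)"
    and unconstrained: "q \<in> states A \<Longrightarrow> \<exists>n. state_ty A q = (Arity n, {})"
    and productive: "q \<in> states A \<Longrightarrow> \<exists>v. out q v \<noteq> None"
    and spread_out: "q \<in> states A \<Longrightarrow> spread (wd q) (dom (out q)) (\<lambda>v. the (out q v))"
    and distinguished: "q \<in> states A \<Longrightarrow> p \<in> states A \<Longrightarrow> out q = out p \<Longrightarrow> q = p"

section \<open>The map from a realizer to a reduced realizer\<close>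

locale reduction = B: specified rank B I' F' E' + M: reduced rank M I F E
  for rank :: "'g \<Rightarrow> nat" and B :: "('p, 'a, 'g) transducer" and I' F' E'
    and M :: "('q, 'a, 'g) transducer" and I F E +
  assumes same_transduction: "transduction B = transduction M"
begin

text \<open>As the outputs of a state of \<open>M\<close> are spread, \<open>u\<close> is the
  greatest common prefix of the outputs of \<open>q\<close>, and \<open>m\<close> is the state of
  the remaining family.\<close>

definition sim :: "'p \<Rightarrow> 'q \<times> 'g trm list \<Rightarrow> bool" where
  "sim q = (\<lambda>(m, u). m \<in> states M \<and>
     u \<in> updates rank (fst (state_ty B q)) (fst (state_ty M m)) \<and>
     (\<forall>v. B.out q v = map_option (fills u) (M.out m v)))"

text \<open>The output family of a useful state is nonempty, so its factorization is unique. This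
  fixes \<open>u\<close> and the residual family, and states of \<open>M\<close> are determined by
  their output families.\<close>

lemma sim_unique:
  assumes "B.useful q" and "sim q (m, u)" and "sim q (m', u')"
  shows "m = m' \<and> u = u'"
proof -
  obtain w d v where d: "run B w = Some (q, d)" "B.out q v \<noteq> None"
    using assms(1) unfolding B.useful_def by blast
  have s: "m \<in> states M" "m' \<in> states M"
    "u \<in> updates rank (fst (state_ty B q)) (fst (state_ty M m))"
    "u' \<in> updates rank (fst (state_ty B q)) (fst (state_ty M m'))"
    "\<And>v. B.out q v = map_option (fills u) (M.out m v)"
    "\<And>v. B.out q v = map_option (fills u') (M.out m' v)"
    using assms(2,3) unfolding sim_def by auto
  have len: "length u = holes d" "length u' = holes d"
    using updates_props(1)[OF s(3)] updates_props(1)[OF s(4)] B.run_holes[OF d(1)] by auto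
  have "M.out m v \<noteq> None" using d(2) s(5)[of v] by auto
  then have ne: "dom (M.out m) \<noteq> {}" by (metis domIff empty_iff)
  have "u = u'" "M.out m = M.out m'"
    using forest_factorization_unique[OF ne _ _ len] M.spread_out s
      updates_props(3)[OF s(3)] updates_props(3)[OF s(4)] by metis+
  then show ?thesis using M.distinguished s(1,2) by blast
qed

text \<open>The configurations of \<open>B\<close> and \<open>M\<close> on \<open>w\<close> factor
  the same family of outputs. That of \<open>M\<close> leaves a spread remainder, so the term of
  \<open>B\<close> divides the term of \<open>M\<close>; the quotient is \<open>u\<close>.\<close>

lemma sim_run:
  assumes "run B w = Some (q, d)" and "B.out q v \<noteq> None"
  shows "\<exists>m u. sim q (m, u) \<and> run M w = Some (m, fill d u)"
proof -
  have "transduction M (w @ v) \<noteq> None"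
    using B.transduction_out[OF assms(1)] assms(2) by (simp flip: same_transduction)
  then obtain m e where me: "run M w = Some (m, e)"
    using M.run_prefix_defined by fastforce
  have m: "m \<in> states M" using M.run_states[OF me] .
  have eq: "map_option (fill d) (B.out q x) = map_option (fill e) (M.out m x)" for x
    using B.transduction_out[OF assms(1)] M.transduction_out[OF me] same_transduction by metis
  have "M.out m v \<noteq> None" using assms(2) eq[of v] by (cases "M.out m v") auto
  then have ne: "dom (M.out m) \<noteq> {}" by (metis domIff empty_iff)
  obtain u where u: "length u = holes d" "fill d u = e"
    "\<forall>v. B.out q v = map_option (fills u) (M.out m v)"
    using common_prefix_of_spread[OF ne _ eq] M.spread_out[OF m] M.run_holes[OF me]
      B.out_length[of _ q] B.run_holes[OF assms(1)] by metis
  obtain n where n: "state_ty M m = (Arity n, {})" using M.unconstrained[OF m] by blast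
  have "sim q (m, u)"
    unfolding sim_def prod.case
  proof (intro conjI allI)
    have "ranked rank (fill d u)" "holes (fill d u) = n"
      using M.run_ranked[OF me] M.run_holes[OF me] n u(2) by auto
    then show "u \<in> updates rank (fst (state_ty B q)) (fst (state_ty M m))"
      using u(1) n B.run_holes[OF assms(1)] by (simp add: ranked_fill holes_fill)
    show "B.out q v = map_option (fills u) (M.out m v)" for v
      using u(3) by blast
  qed (rule m)
  then show ?thesis using me u(2) by blast
qed

definition proj :: "'p \<Rightarrow> 'q \<times> 'g trm list" where
  "proj q = (THE x. sim q x)"

text \<open>Each word that reaches \<open>q\<close> provides a match by \<open>sim_run\<close>;
  uniqueness makes the match independent of the word.\<close>

lemma proj_run:
  assumes "B.useful q"
  shows "sim q (proj q)"
    and "run B w = Some (q, d) \<Longrightarrow> run M w = Some (fst (proj q), fill d (snd (proj q)))"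
proof -
  obtain w' d' v where v: "run B w' = Some (q, d')" "B.out q v \<noteq> None"
    using assms unfolding B.useful_def by blast
  have *: "proj q = (m, u)" if "sim q (m, u)" for m u
    unfolding proj_def
  proof (rule the_equality[where P = "sim q", OF that])
    fix x assume "sim q x"
    then show "x = (m, u)"
      using sim_unique[OF assms that, of "fst x" "snd x"] by (cases x) simp
  qed
  then show "sim q (proj q)" using sim_run[OF v] by metis
  show "run M w = Some (fst (proj q), fill d (snd (proj q)))" if "run B w = Some (q, d)"
    using sim_run[OF that v(2)] * by force
qed

text \<open>The square is verified on one run that reaches \<open>q\<close>, whose term is then
  cancelled. A move of \<open>B\<close> without counterpart in \<open>M\<close> cannot lead to a
  useful state, since \<open>proj_run\<close> would provide the counterpart.\<close>

lemma proj_step: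
  assumes "B.useful q" and "proj q = (m, u)"
  shows "F a m = None \<Longrightarrow> F' a q = Some (p, us) \<Longrightarrow> \<not> B.useful p"
    and "F a m = Some (m', vs) \<Longrightarrow>
      \<exists>p us u'. F' a q = Some (p, us) \<and> B.useful p \<and> proj p = (m', u') \<and> fills us u' = fills u vs"
proof -
  obtain w d v where w: "run B w = Some (q, d)" "B.out q v \<noteq> None"
    using assms(1) unfolding B.useful_def by blast
  have M: "run M w = Some (m, fill d u)"
    using proj_run(2)[OF assms(1) w(1)] assms(2) by simp
  have u: "u \<in> updates rank (fst (state_ty B q)) (fst (state_ty M m))"
    using proj_run(1)[OF assms(1)] assms(2) by (simp add: sim_def)
  note hd = B.run_holes[OF w(1)]
  note lu = updates_props(1)[OF u]
  show "\<not> B.useful p" if "F a m = None" "F' a q = Some (p, us)"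
  proof
    assume p: "B.useful p"
    have "run B (w @ [a]) = Some (p, fill d us)"
      using B.run_snoc_spec[OF w(1)] that(2) by simp
    from proj_run(2)[OF p this] M.run_snoc_spec[OF M] that(1) show False by simp
  qed
  show "\<exists>p us u'. F' a q = Some (p, us) \<and> B.useful p \<and> proj p = (m', u') \<and> fills us u' = fills u vs"
    if step: "F a m = Some (m', vs)"
  proof -
    have M': "run M (w @ [a]) = Some (m', fill (fill d u) vs)"
      using M.run_snoc_spec[OF M] step by simp
    \<comment> \<open>Some word continues the run of \<open>M\<close> to an output. As the
      transductions agree, \<open>B\<close> must have a transition as well, and its target is
      useful.\<close>
    obtain v' where v': "M.out m' v' \<noteq> None"
      using M.productive M.step_spec(2)[OF step] by blast
    then have "transduction B ((w @ [a]) @ v') \<noteq> None"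
      using M.transduction_out[OF M', of v'] by (simp add: same_transduction)
    then obtain p e where p: "run B (w @ [a]) = Some (p, e)"
      using B.run_prefix_defined by fastforce
    then obtain us where us: "F' a q = Some (p, us)" "e = fill d us"
      using B.run_snoc_spec[OF w(1), of a] by auto
    have "B.out p v' \<noteq> None"
      using \<open>transduction B ((w @ [a]) @ v') \<noteq> None\<close> B.transduction_out[OF p, of v'] by auto
    with p have useful: "B.useful p" unfolding B.useful_def by blast
    obtain m'' u' where u': "proj p = (m'', u')" by fastforce
    from proj_run(2)[OF useful p] u' M'
    have eq: "m'' = m'" "fill (fill d us) u' = fill (fill d u) vs" by (simp_all add: us(2))
    have lus: "length us = holes d" using updates_props(1)[OF B.step_spec(3)[OF us(1)]] hd by simp
    have "fill d (fills us u') = fill d (fills u vs)"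
      using eq(2) lus lu hd by (simp add: fill_fill)
    then have "fills us u' = fills u vs"
      using fill_inject(1)[of "fills us u'" d "fills u vs"] lus lu hd by simp
    with us(1) useful u' eq(1) show ?thesis by blast
  qed
qed

lemma proj_final:
  assumes "B.useful q" and "proj q = (m, u)"
  shows "map_option snd (E' q) = map_option (fills u) (map_option snd (E m))"
proof -
  have "B.out q [] = map_option (fills u) (M.out m [])"
    using proj_run(1)[OF assms(1)] unfolding sim_def assms(2) by blast
  then show ?thesis by simp
qed

lemma proj_init:
  shows "I () = Some (m, vs) \<Longrightarrow>
      \<exists>q us u. I' () = Some (q, us) \<and> B.useful q \<and> proj q = (m, u) \<and> fills us u = vs"
    and "I () = None \<Longrightarrow> I' () = Some (q, us) \<Longrightarrow> \<not> B.useful q"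
proof -
  \<comment> \<open>Updates out of the initial type are tuples of length one, so passing to
    \<open>hd\<close> in the first configuration loses nothing.\<close>
  have lI: "\<exists>x. us = [x]" if "I () = Some (m, us)" for m us
    using updates_props(1)[OF specifies_updates(3)[OF M.spec_init that]]
    by (auto simp: start_space_def length_Suc_conv)
  have lI': "\<exists>x. us = [x]" if "I' () = Some (q, us)" for q us
    using updates_props(1)[OF specifies_updates(3)[OF B.spec_init that]]
    by (auto simp: start_space_def length_Suc_conv)
  show "\<exists>q us u. I' () = Some (q, us) \<and> B.useful q \<and> proj q = (m, u) \<and> fills us u = vs"
    if m: "I () = Some (m, vs)"
  proof -
    have M: "run M [] = Some (m, hd vs)" using M.run_Nil_spec m by simp
    obtain v where v: "M.out m v \<noteq> None" using M.productive M.run_states[OF M] by blast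
    then have t: "transduction B ([] @ v) \<noteq> None"
      using M.transduction_out[OF M, of v] by (simp add: same_transduction)
    then obtain q d where q: "run B [] = Some (q, d)" using B.run_prefix_defined by fastforce
    then obtain us where us: "I' () = Some (q, us)" "d = hd us" using B.run_Nil_spec by auto
    have "B.out q v \<noteq> None" using t B.transduction_out[OF q, of v] by auto
    then have useful: "B.useful q" using q unfolding B.useful_def by blast
    obtain m' u where u: "proj q = (m', u)" by fastforce
    have "m' = m" "fill d u = hd vs" using proj_run(2)[OF useful q] M u by auto
    moreover have len: "length u = holes d"
      using proj_run(1)[OF useful] B.run_holes[OF q] updates_props(1) unfolding u sim_def by auto
    ultimately show ?thesis
      using lI[OF m] lI'[OF us(1)] us useful u by (auto simp: fills.simps)
  qed
  show "\<not> B.useful q" if "I () = None" "I' () = Some (q, us)"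
    using proj_run(2)[of q "[]"] B.run_Nil_spec M.run_Nil_spec that by auto
qed

end

section \<open>Reduced transducers are minimal\<close>

lemma morphism_apply:
  assumes "morphism rank A h B"
  obtains H where "\<And>q d. (q, d) \<in> configs rank (space A) \<Longrightarrow>
      \<exists>p us. H q = Some (p, us) \<and> h (q, d) = Some (p, fill d us) \<and>
        us \<in> updates rank (fst (state_ty A q)) (fst (state_ty B p))"
    and "\<And>c. c \<notin> configs rank (space A) \<Longrightarrow> h c = None"
    and "specifies rank (space A) (space B) H h"
proof -
  obtain H where H: "specifies rank (space A) (space B) H h"
    using assms unfolding morphism_def transformation_def by blast
  have dom: "dom h = configs rank (space A)" using assms unfolding morphism_def by blast
  show ?thesis
  proof (rule that[of H])
    fix q d assume qd: "(q, d) \<in> configs rank (space A)"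
    then obtain p us where "H q = Some (p, us)"
      using specifies_apply[OF H qd] dom by (cases "H q") auto
    with specifies_apply[OF H qd] specifies_updates(3)[OF H]
    show "\<exists>p us. H q = Some (p, us) \<and> h (q, d) = Some (p, fill d us) \<and>
        us \<in> updates rank (fst (state_ty A q)) (fst (state_ty B p))"
      by (force simp: space_def)
  qed (use dom H in blast)+
qed

lemma morphism_commutes:
  assumes "morphism rank A h B"
  shows "h ;; steps B w = steps A w ;; h"
proof (induction w)
  case (Cons a w)
  have "h ;; steps B (a # w) = (h ;; delta B a) ;; steps B w"
    by (simp add: map_seq_assoc)
  also have "\<dots> = (delta A a ;; h) ;; steps B w"
    using assms by (simp add: morphism_def)
  also have "\<dots> = steps A (a # w) ;; h"
    by (simp add: Cons.IH map_seq_assoc)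
  finally show ?case .
qed (rule ext, simp add: map_seq_apply)

lemma morphism_transduction:
  assumes "morphism rank A h B"
  shows "transduction B = transduction A"
proof
  fix w
  have "delta_init B ;; steps B w ;; delta_final B = delta_init A ;; (h ;; steps B w) ;; delta_final B"
    using assms by (simp add: morphism_def map_seq_assoc)
  also have "\<dots> = delta_init A ;; steps A w ;; (h ;; delta_final B)"
    by (simp add: morphism_commutes[OF assms] map_seq_assoc)
  finally show "transduction B w = transduction A w"
    using assms by (simp add: transduction_def morphism_def)
qed

text \<open>Arrows preserve the transduction and the domain of runs, so liveness passes along them
  in both directions. This keeps the auxiliary transducers of the proof inside the category.\<close>

lemma morphism_live:
  assumes "morphism rank A h B" and "is_transducer rank A" and "is_transducer rank B"
  shows "A \<in> live_transducers_for rank \<phi> \<longleftrightarrow> B \<in> live_transducers_for rank \<phi>"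
  using assms morphism_run[OF assms(2,1)] morphism_transduction[OF assms(1)]
  by (simp add: live_transducers_for_def transducers_for_def del: not_None_eq)

definition identity :: "base \<Rightarrow> 'g trm list" where
  "identity b = replicate (width b) Hole"

lemma identity_updates: "identity b \<in> updates rank b b"
  by (cases b) (auto simp: identity_def sum_list_replicate)

lemma fill_identity: "holes d = width b \<Longrightarrow> fill d (identity b) = d"
  using fill_Holes by (metis identity_def)

lemma identity_ty_updates:
  assumes "fst \<sigma> = b" and "ty_dom rank \<sigma> \<subseteq> ty_dom rank \<tau>" and "fst \<tau> = b"
  shows "identity b \<in> ty_updates rank \<sigma> \<tau>"
proof -
  have "fill d (identity b) = d" if "d \<in> ty_dom rank \<sigma>" for d
    using that assms(1) holes_base_dom by (intro fill_identity) (force simp: ty_dom_def)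
  then show ?thesis using assms identity_updates by (auto simp: ty_updates_def)
qed

definition realize ::
  "('g \<Rightarrow> nat) \<Rightarrow> ('x, 'g) space \<Rightarrow> ('x \<rightharpoonup> 'y \<times> 'g trm list) \<Rightarrow> 'x \<times> 'g trm \<rightharpoonup> 'y \<times> 'g trm" where
  "realize rank X F = (\<lambda>(p, d). if (p, d) \<in> configs rank X
     then map_option (\<lambda>(q, us). (q, fill d us)) (F p) else None)"

lemma specifies_realize_ty:
  assumes "\<And>p q us. F p = Some (q, us) \<Longrightarrow>
    p \<in> fst X \<and> q \<in> fst Y \<and> us \<in> ty_updates rank (snd X p) (snd Y q)"
  shows "specifies rank X Y F (realize rank X F)"
  using assms unfolding specifies_def realize_def by fastforce

lemma specifies_realize:
  assumes "\<And>p q us. F p = Some (q, us) \<Longrightarrow> p \<in> fst X \<and> q \<in> fst Y \<and>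
    us \<in> updates rank (fst (snd X p)) (fst (snd Y q)) \<and> snd (snd Y q) = {}"
  shows "specifies rank X Y F (realize rank X F)"
proof (rule specifies_realize_ty)
  fix p q us assume "F p = Some (q, us)"
  from assms[OF this] show "p \<in> fst X \<and> q \<in> fst Y \<and> us \<in> ty_updates rank (snd X p) (snd Y q)"
    using fill_base_dom[of _ rank "fst (snd X p)" us "fst (snd Y q)"]
    by (cases "snd Y q") (auto simp: ty_updates_def ty_dom_def)
qed

lemma fills_identity_left: "length us = width b \<Longrightarrow> fills (identity b) us = us"
  by (simp add: identity_def fills_Holes)

lemma fills_identity_right:
  assumes "sum_list (map holes us) = width b"
  shows "fills us (identity b) = us"
  using fill_Holes[of "Node undefined us"] assms by (simp add: identity_def)

text \<open>By associativity, each way around a square applies one composite forest to every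
  configuration. Equality of these composites is sufficient and does not mention domains.\<close>

lemma morphism_of_forests:
  fixes rank :: "'g \<Rightarrow> nat" and A :: "('p, 'a, 'g) transducer" and B :: "('q, 'a, 'g) transducer"
  assumes "specified rank A I F E" and "specified rank B I' F' E'"
    and h: "\<And>q. q \<in> states A \<Longrightarrow> fst (h q) \<in> states B \<and>
      snd (h q) \<in> ty_updates rank (state_ty A q) (state_ty B (fst (h q)))"
    and init: "I' () = map_option (\<lambda>(q, us). (fst (h q), fills us (snd (h q)))) (I ())"
    and step: "\<And>a q. q \<in> states A \<Longrightarrow>
      map_option (\<lambda>(p, us). (p, fills (snd (h q)) us)) (F' a (fst (h q))) =
      map_option (\<lambda>(p, us). (fst (h p), fills us (snd (h p)))) (F a q)"
    and final: "\<And>q. q \<in> states A \<Longrightarrow>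
      E q = map_option (\<lambda>(x, us). (x, fills (snd (h q)) us)) (E' (fst (h q)))"
  shows "morphism rank A
    (realize rank (space A) (\<lambda>q. if q \<in> states A then Some (h q) else None)) B"
    (is "morphism _ _ (realize _ _ ?H) _")
proof -
  interpret A: specified rank A I F E by (rule assms(1))
  interpret B: specified rank B I' F' E' by (rule assms(2))
  let ?h = "realize rank (space A) ?H"
  have spec: "specifies rank (space A) (space B) ?H ?h"
  proof (rule specifies_realize_ty)
    fix p q us assume "?H p = Some (q, us)"
    with h[of p] show "p \<in> fst (space A) \<and> q \<in> fst (space B) \<and>
        us \<in> ty_updates rank (snd (space A) p) (snd (space B) q)"
      by (auto split: if_splits)
  qed
  have st: "q \<in> states A" if "(q, d) \<in> configs rank (space A)" for q d
    using that by (simp add: configs_def)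
  have app: "?h (q, d) = Some (fst (h q), fill d (snd (h q)))" if "(q, d) \<in> configs rank (space A)" for q d
    using that st[OF that] by (simp add: realize_def case_prod_unfold)
  have conf: "(fst (h q), fill d (snd (h q))) \<in> configs rank (space B)" if "(q, d) \<in> configs rank (space A)" for q d
    using transformation_in_configs[where f = ?h and Y = "space B", OF _ app[OF that]] spec
    unfolding transformation_def by blast
  have len: "length (snd (h q)) = holes d" if "(q, d) \<in> configs rank (space A)" for q d
    using h[OF st[OF that]] updates_props(1)[of "snd (h q)"] holes_configs[OF that]
    by (auto simp: ty_updates_def)
  \<comment> \<open>The two ways around a square: \<open>out\<close> computes \<open>f\<close>
    followed by the arrow, \<open>inn\<close> the arrow followed by \<open>f\<close>.\<close>
  have out: "(f ;; ?h) (x, d) = map_option (\<lambda>(p, us). (p, fill d us))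
      (map_option (\<lambda>(p, us). (fst (h p), fills us (snd (h p)))) (G x))"
    if f: "specifies rank X (space A) G f" and xd: "(x, d) \<in> configs rank X"
    for f G and X :: "('x, 'g) space" and x d
  proof (cases "G x")
    case None
    then show ?thesis using specifies_apply[OF f xd] by (simp add: map_seq_apply)
  next
    case (Some y)
    obtain p us where y: "G x = Some (p, us)" using Some by (cases y) simp
    have fx: "f (x, d) = Some (p, fill d us)" using specifies_apply[OF f xd] y by simp
    have "(p, fill d us) \<in> configs rank (space A)"
      using f fx transformation_in_configs unfolding transformation_def by metis
    moreover have "length us = holes d"
      using updates_props(1)[OF specifies_updates(3)[OF f y]] holes_configs[OF xd] by simp
    ultimately show ?thesis by (simp add: map_seq_apply fx y app fill_fill)
  qed
  have inn: "(?h ;; f) (q, d) = map_option (\<lambda>(p, us). (p, fill d us))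
      (map_option (\<lambda>(p, us). (p, fills (snd (h q)) us)) (G (fst (h q))))"
    if f: "specifies rank (space B) Y G f" and qd: "(q, d) \<in> configs rank (space A)"
    for f G and Y :: "('x, 'g) space" and q d
    using specifies_apply[OF f conf[OF qd]]
    by (simp add: map_seq_apply app[OF qd] option.map_comp comp_def case_prod_unfold fill_fill len[OF qd])
  have none: "f (x, d) = None" if "specifies rank X Y G f" "(x, d) \<notin> configs rank X"
    for f G x d and X :: "('x, 'g) space" and Y :: "('y, 'g) space"
    using that by (simp add: specifies_def)
  show ?thesis
    unfolding morphism_def
  proof (intro conjI allI ext)
    show "transformation rank (space A) (space B) ?h"
      using spec unfolding transformation_def by blast
    have "?h (q, d) = None" if "(q, d) \<notin> configs rank (space A)" for q d
      using none[OF spec that] .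
    then show "dom ?h = configs rank (space A)" using app by fastforce
  next
    fix z show "delta_init B z = (delta_init A ;; ?h) z"
    proof (cases "z \<in> configs rank start_space")
      case True
      then show ?thesis
        using specifies_apply[OF B.spec_init] out[OF A.spec_init] init by (cases z) simp
    qed (cases z, simp add: map_seq_apply none[OF A.spec_init] none[OF B.spec_init])
  next
    fix a z show "(?h ;; delta B a) z = (delta A a ;; ?h) z"
    proof (cases "z \<in> configs rank (space A)")
      case True
      then show ?thesis
        using inn[OF B.spec_step] out[OF A.spec_step] step st by (cases z) simp
    qed (cases z, simp add: map_seq_apply none[OF A.spec_step] none[OF spec])
  next
    fix z show "(?h ;; delta_final B) z = delta_final A z"
    proof (cases "z \<in> configs rank (space A)")
      case True
      then show ?thesis
        using inn[OF B.spec_final] specifies_apply[OF A.spec_final] final st by (cases z) simp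
    qed (cases z, simp add: map_seq_apply none[OF A.spec_final] none[OF spec])
  qed
qed

section \<open>Epis and inhabited states\<close>

text \<open>All objects of the category have the state type \<open>'q\<close>, so the disjoint union
  of two copies of \<open>A\<close> is coded back into this type by \<open>\<iota>\<close>. The flag
  tells the copies apart.\<close>

definition double ::
  "('g \<Rightarrow> nat) \<Rightarrow> ('q \<times> bool \<Rightarrow> 'q) \<Rightarrow> ('q, 'a, 'g) transducer \<Rightarrow>
    (unit \<rightharpoonup> 'q \<times> 'g trm list) \<Rightarrow> ('a \<Rightarrow> 'q \<rightharpoonup> 'q \<times> 'g trm list) \<Rightarrow> ('q \<rightharpoonup> unit \<times> 'g trm list) \<Rightarrow>
    ('q, 'a, 'g) transducer" where
  "double rank \<iota> A I F E = (let X = (\<iota> ` (states A \<times> UNIV), \<lambda>c. state_ty A (fst (inv \<iota> c))) in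
     \<lparr>states = fst X, state_ty = snd X, delta_init = realize rank start_space I,
      delta = (\<lambda>a. realize rank X (F a)), delta_final = realize rank X E\<rparr>)"

context specified
begin

text \<open>Two copies of \<open>A\<close>; from the second one, transitions into \<open>S\<close> lead to the first one.\<close>

definition double_step :: "('q \<times> bool \<Rightarrow> 'q) \<Rightarrow> 'q set \<Rightarrow> 'a \<Rightarrow> 'q \<rightharpoonup> 'q \<times> 'g trm list" where
  "double_step \<iota> S a c = (if c \<in> \<iota> ` (states A \<times> UNIV) then map_option
     (\<lambda>(p, us). (\<iota> (p, snd (inv \<iota> c) \<and> p \<notin> S), us)) (F a (fst (inv \<iota> c))) else None)"

definition double_init :: "('q \<times> bool \<Rightarrow> 'q) \<Rightarrow> unit \<rightharpoonup> 'q \<times> 'g trm list" where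
  "double_init \<iota> x = map_option (\<lambda>(p, us). (\<iota> (p, False), us)) (I x)"

definition double_final :: "('q \<times> bool \<Rightarrow> 'q) \<Rightarrow> 'q \<rightharpoonup> unit \<times> 'g trm list" where
  "double_final \<iota> c = (if c \<in> \<iota> ` (states A \<times> UNIV) then E (fst (inv \<iota> c)) else None)"

abbreviation "doubled \<iota> S \<equiv> double rank \<iota> A (double_init \<iota>) (double_step \<iota> S) (double_final \<iota>)"

lemma specified_double:
  assumes "inj \<iota>"
  shows "specified rank (doubled \<iota> S) (double_init \<iota>) (double_step \<iota> S) (double_final \<iota>)"
proof -
  define X where "X = (\<iota> ` (states A \<times> (UNIV :: bool set)), \<lambda>c. state_ty A (fst (inv \<iota> c)))"
  have sp: "space (doubled \<iota> S) = X" by (simp add: space_def double_def Let_def X_def)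
  have inv: "inv \<iota> (\<iota> x) = x" for x using assms by simp
  have init: "specifies rank start_space X (double_init \<iota>) (realize rank start_space (double_init \<iota>))"
    by (rule specifies_realize_ty)
      (use spec_init in \<open>auto simp: specifies_def double_init_def X_def inv\<close>)
  have step: "specifies rank X X (double_step \<iota> S a) (realize rank X (double_step \<iota> S a))" for a
    by (rule specifies_realize_ty)
      (use spec_step[of a] in \<open>auto simp: specifies_def double_step_def X_def inv split: if_splits\<close>)
  have final: "specifies rank X end_space (double_final \<iota>) (realize rank X (double_final \<iota>))"
    by (rule specifies_realize_ty)
      (use spec_final in \<open>auto simp: specifies_def double_final_def X_def inv end_space_def split: if_splits\<close>)
  have "is_ty rank (snd X c)" if "c \<in> fst X" for c
    using that transducer by (auto simp: X_def inv is_transducer_def)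
  with init step final show ?thesis
    unfolding specified_def is_transducer_def transformation_def sp
    by (auto simp: double_def Let_def simp flip: X_def)
qed

text \<open>For false \<open>T\<close> this is the embedding into the first copy. For true
  \<open>T\<close> the states outside \<open>S\<close> go to the second copy; the premises then say
  that \<open>S\<close> contains the initial state and is closed under transitions, so no transition
  has to pass from the first copy to the second.\<close>

lemma double_morphism:
  assumes "inj \<iota>" and init: "\<And>p us. I () = Some (p, us) \<Longrightarrow> T \<Longrightarrow> p \<in> S"
    and step: "\<And>a q p us. F a q = Some (p, us) \<Longrightarrow> q \<in> S \<Longrightarrow> T \<Longrightarrow> p \<in> S"
  shows "morphism rank A (realize rank (space A) (\<lambda>q. if q \<in> states A
    then Some (\<iota> (q, T \<and> q \<notin> S), identity (fst (state_ty A q))) else None)) (doubled \<iota> S)"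
    (is "morphism _ _ (realize _ _ (\<lambda>q. if _ then Some (?p q, ?u q) else _)) ?D")
proof -
  have inv: "inv \<iota> (\<iota> x) = x" for x using assms(1) by simp
  have right: "fills us (identity (fst (state_ty A p))) = us" if "F a q = Some (p, us)" for a q p us
    using fills_identity_right updates_props(3)[OF step_spec(3)[OF that]] .
  have left: "fills (identity (fst (state_ty A q))) us = us" if "F a q = Some (p, us)" for a q p us
    using fills_identity_left updates_props(1)[OF step_spec(3)[OF that]] .
  show ?thesis
  proof (rule morphism_of_forests[OF specified_axioms specified_double[OF assms(1)],
      where h = "\<lambda>q. (?p q, ?u q)"])
    show "fst (?p q, ?u q) \<in> states ?D \<and> snd (?p q, ?u q) \<in>
        ty_updates rank (state_ty A q) (state_ty ?D (fst (?p q, ?u q)))" if "q \<in> states A" for q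
      using that by (simp add: double_def Let_def inv identity_ty_updates)
    show "double_init \<iota> () = map_option (\<lambda>(q, us). (fst (?p q, ?u q), fills us (snd (?p q, ?u q)))) (I ())"
    proof (cases "I ()")
      case (Some y)
      obtain p us where y: "I () = Some (p, us)" using Some by (cases y) simp
      have "fills us (?u p) = us"
        using fills_identity_right updates_props(3)[OF specifies_updates(3)[OF spec_init y]] by simp
      moreover have "(T \<and> p \<notin> S) = False" using init[OF y] by blast
      ultimately show ?thesis by (simp only: double_init_def y option.map prod.case fst_conv snd_conv)
    qed (simp add: double_init_def)
    show "map_option (\<lambda>(p, us). (p, fills (snd (?p q, ?u q)) us)) (double_step \<iota> S a (fst (?p q, ?u q))) =
        map_option (\<lambda>(p, us). (fst (?p p, ?u p), fills us (snd (?p p, ?u p)))) (F a q)"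
      if q: "q \<in> states A" for a q
    proof (cases "F a q")
      case None
      then show ?thesis by (simp add: double_step_def inv q)
    next
      case (Some y)
      obtain p us where y: "F a q = Some (p, us)" using Some by (cases y) simp
      have "((T \<and> q \<notin> S) \<and> p \<notin> S) = (T \<and> p \<notin> S)" using step[OF y] by blast
      then show ?thesis by (simp add: double_step_def inv q y left[OF y] right[OF y])
    qed
    show "E q = map_option (\<lambda>(x, us). (x, fills (snd (?p q, ?u q)) us)) (double_final \<iota> (fst (?p q, ?u q)))"
      if q: "q \<in> states A" for q
    proof (cases "E q")
      case (Some y)
      obtain x us where y: "E q = Some (x, us)" using Some by (cases y) simp
      show ?thesis
        using fills_identity_left[OF updates_props(1)[OF final_spec(2)[OF y]]]
        by (simp add: double_final_def inv q y)
    qed (simp add: double_final_def inv q)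
  qed
qed

end

text \<open>An infinite set is equinumerous with the sum of two copies of itself.\<close>

lemma infinite_double:
  assumes "infinite (UNIV :: 'q set)"
  shows "\<exists>\<iota> :: 'q \<times> bool \<Rightarrow> 'q. inj \<iota>"
proof -
  obtain f :: "'q + 'q \<Rightarrow> 'q" where "bij_betw f (UNIV <+> UNIV) UNIV"
    using card_of_Plus_infinite[OF assms card_of_mono1[OF subset_refl]] card_of_ordIso by blast
  then have f: "inj f" by (simp add: bij_betw_def)
  have "inj (\<lambda>(q, b). f (if b then Inl q else Inr q))"
    using f by (auto simp: inj_def split: if_splits)
  then show ?thesis by blast
qed

text \<open>The states that an arrow misses can be doubled, which yields two different arrows that agree
  on its image.\<close>

lemma epi_surj:
  fixes X Y :: "('q, 'a, 'g) transducer"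
  assumes "infinite (UNIV :: 'q set)" and "epi rank (live_transducers_for rank \<phi>) X e Y"
    and "Y \<in> live_transducers_for rank \<phi>" and "(y, z) \<in> configs rank (space Y)"
  shows "\<exists>x z'. e x = Some (y, z')"
proof (rule ccontr)
  assume y: "\<nexists>x z'. e x = Some (y, z')"
  obtain \<iota> :: "'q \<times> bool \<Rightarrow> 'q" where \<iota>: "inj \<iota>" using infinite_double[OF assms(1)] by blast
  \<comment> \<open>The control states hit by \<open>e\<close>. Since \<open>e\<close> commutes with
    the transitions, \<open>S\<close> contains the initial state and is closed under transitions, as
    \<open>double_morphism\<close> demands.\<close>
  define S where "S = {y. \<exists>x z'. e x = Some (y, z')}"
  have Y: "is_transducer rank Y"
    using assms(3) by (simp add: live_transducers_for_def transducers_for_def)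
  obtain I F E where "specified rank Y I F E" using obtain_specified[OF Y] .
  then interpret specified rank Y I F E .
  have e: "morphism rank X e Y" using assms(2) by (simp add: epi_def)
  then have init: "delta_init Y = delta_init X ;; e" and step: "e ;; delta Y a = delta X a ;; e" for a
    by (simp_all add: morphism_def)
  have S_init: "q \<in> S" if q: "I () = Some (q, us)" for q us
  proof -
    have "delta_init Y ((), Hole) = Some (q, hd us)" using q run_Nil_spec by (simp add: run_Nil)
    then show ?thesis by (auto simp: init map_seq_apply bind_eq_Some_conv S_def)
  qed
  have S_step: "p \<in> S" if F: "F a q = Some (p, us)" and "q \<in> S" for a q p us
  proof -
    obtain x z' where x: "e x = Some (q, z')" using \<open>q \<in> S\<close> by (auto simp: S_def)
    have c: "(q, z') \<in> configs rank (space Y)"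
      using e x transformation_in_configs unfolding morphism_def by metis
    have "(e ;; delta Y a) x = Some (p, fill z' us)"
      using x specifies_apply[OF spec_step c] F by (simp add: map_seq_apply)
    then show "p \<in> S" by (auto simp: step map_seq_apply bind_eq_Some_conv S_def)
  qed
  define h where "h T = realize rank (space Y) (\<lambda>q. if q \<in> states Y
    then Some (\<iota> (q, T \<and> q \<notin> S), identity (fst (state_ty Y q))) else None)" for T
  have h: "h T (q, d) = Some (\<iota> (q, T \<and> q \<notin> S), d)" if "(q, d) \<in> configs rank (space Y)" for T q d
  proof -
    have "q \<in> states Y" using that by (simp add: configs_def)
    then show ?thesis
      using that fill_identity[of d "fst (state_ty Y q)"] holes_configs[OF that]
      by (simp add: h_def realize_def)
  qed
  have m: "morphism rank Y (h T) (doubled \<iota> S)" for T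
    unfolding h_def by (rule double_morphism[OF \<iota>]) (use S_init S_step in blast)+
  have "is_transducer rank (doubled \<iota> S)"
    using specified_double[OF \<iota>] by (simp add: specified_def)
  then have "doubled \<iota> S \<in> live_transducers_for rank \<phi>"
    using morphism_live[OF m Y] assms(3) by blast
  moreover have "e ;; h True = e ;; h False"
  proof
    fix x
    show "(e ;; h True) x = (e ;; h False) x"
    proof (cases "e x")
      case (Some c)
      then have "fst c \<in> S" unfolding S_def by (cases c) (simp, metis surj_pair)
      moreover have "c \<in> configs rank (space Y)"
        using e Some transformation_in_configs unfolding morphism_def by metis
      ultimately show ?thesis using Some by (cases c) (simp add: map_seq_apply h)
    qed (simp add: map_seq_apply)
  qed
  ultimately have "h True = h False"
    using assms(2) m unfolding epi_def by blast
  \<comment> \<open>The arrows can differ as partial functions only at a configuration, so it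
    matters that \<open>y\<close> is inhabited.\<close>
  then have "h True (y, z) = h False (y, z)" by (rule fun_cong)
  then have "\<iota> (y, y \<notin> S) = \<iota> (y, False)"
    using assms(4) by (simp add: h)
  then have "y \<in> S" using \<iota> by (auto simp: inj_def)
  with y show False by (simp add: S_def)
qed

section \<open>The reachable part as a strong subobject\<close>

context specified
begin

definition reachable_space :: "('q, 'g) space" where
  "reachable_space = ({q. \<exists>w d. run A w = Some (q, d)}, state_ty A)"

definition reach_step :: "'a \<Rightarrow> 'q \<rightharpoonup> 'q \<times> 'g trm list" where
  "reach_step a q = (if q \<in> fst reachable_space then F a q else None)"

definition reach_final :: "'q \<rightharpoonup> unit \<times> 'g trm list" where
  "reach_final q = (if q \<in> fst reachable_space then E q else None)"

definition reachable_part :: "('q, 'a, 'g) transducer" where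
  "reachable_part = \<lparr>states = fst reachable_space, state_ty = state_ty A, delta_init = delta_init A,
     delta = (\<lambda>a. realize rank reachable_space (reach_step a)),
     delta_final = realize rank reachable_space reach_final\<rparr>"

lemma space_reachable_part: "space reachable_part = reachable_space"
  by (simp add: space_def reachable_part_def reachable_space_def)

lemma states_reachable_part: "states reachable_part = fst reachable_space"
  by (simp add: reachable_part_def)

lemma reachable_spaceI: "run A w = Some (q, d) \<Longrightarrow> q \<in> fst reachable_space"
  by (auto simp: reachable_space_def)

lemma reachable_states: "q \<in> fst reachable_space \<Longrightarrow> q \<in> states A"
  using run_states by (auto simp: reachable_space_def)

lemma configs_reachable_part: "(q, d) \<in> configs rank reachable_space \<longleftrightarrow>
    q \<in> fst reachable_space \<and> (q, d) \<in> configs rank (space A)"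
  using reachable_states by (auto simp: configs_def reachable_space_def)

lemma reachable_step:
  assumes "q \<in> fst reachable_space" and "F a q = Some (p, us)"
  shows "p \<in> fst reachable_space"
proof -
  obtain w d where "run A w = Some (q, d)" using assms(1) by (auto simp: reachable_space_def)
  from run_snoc_spec[OF this, of a] assms(2) show ?thesis
    using reachable_spaceI by simp
qed

lemma reachable_init: "I () = Some (p, us) \<Longrightarrow> p \<in> fst reachable_space"
  using run_Nil_spec by (intro reachable_spaceI[of "[]"]) simp

lemma specified_reachable_part: "specified rank reachable_part I reach_step reach_final"
proof -
  let ?X = reachable_space
  have init: "specifies rank start_space ?X I (delta_init A)"
    using spec_init reachable_init unfolding specifies_def by (simp add: reachable_space_def)
  have step: "specifies rank ?X ?X (reach_step a) (realize rank ?X (reach_step a))" for a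
  proof (rule specifies_realize_ty)
    fix p q us assume "reach_step a p = Some (q, us)"
    then have "p \<in> fst ?X" "F a p = Some (q, us)" by (auto simp: reach_step_def split: if_splits)
    then show "p \<in> fst ?X \<and> q \<in> fst ?X \<and> us \<in> ty_updates rank (snd ?X p) (snd ?X q)"
      using reachable_step spec_step[of a] by (simp add: specifies_def reachable_space_def)
  qed
  have final: "specifies rank ?X end_space reach_final (realize rank ?X reach_final)"
    by (rule specifies_realize_ty)
      (use spec_final in \<open>auto simp: specifies_def reach_final_def reachable_space_def end_space_def split: if_splits\<close>)
  have "is_ty rank (state_ty A q)" if "q \<in> fst ?X" for q
    using reachable_states[OF that] transducer by (simp add: is_transducer_def)
  with init step final show ?thesis
    unfolding specified_def is_transducer_def transformation_def space_reachable_part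
    by (auto simp: reachable_part_def)
qed

lemma delta_reachable_part:
  assumes "c \<in> configs rank reachable_space"
  shows "delta reachable_part a c = delta A a c" "delta_final reachable_part c = delta_final A c"
  using assms specifies_apply[OF spec_step] specifies_apply[OF spec_final]
  by (cases c; simp add: reachable_part_def realize_def reach_step_def reach_final_def configs_reachable_part)+

definition inclusion :: "'q \<times> 'g trm \<rightharpoonup> 'q \<times> 'g trm" where
  "inclusion = realize rank (space reachable_part) (\<lambda>q. if q \<in> states reachable_part
     then Some (q, identity (fst (state_ty A q))) else None)"

lemma inclusion_apply: "inclusion c = (if c \<in> configs rank reachable_space then Some c else None)"
  by (cases c) (auto simp: inclusion_def realize_def space_reachable_part configs_reachable_part
    fill_identity holes_configs states_reachable_part)

lemma inclusion_morphism: "morphism rank reachable_part inclusion A"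
  unfolding inclusion_def
proof (rule morphism_of_forests[OF specified_reachable_part specified_axioms,
    where h = "\<lambda>q. (q, identity (fst (state_ty A q)))", simplified fst_conv snd_conv])
  show "q \<in> states A \<and> identity (fst (state_ty A q)) \<in> ty_updates rank (state_ty reachable_part q) (state_ty A q)"
    if "q \<in> states reachable_part" for q
    using that reachable_states by (simp add: reachable_part_def identity_ty_updates)
  show "I () = map_option (\<lambda>(q, us). (q, fills us (identity (fst (state_ty A q))))) (I ())"
    using updates_props(3)[OF specifies_updates(3)[OF spec_init]]
    by (cases "I ()") (auto simp: fills_identity_right)
  show "map_option (\<lambda>(p, us). (p, fills (identity (fst (state_ty A q))) us)) (F a q) =
      map_option (\<lambda>(p, us). (p, fills us (identity (fst (state_ty A p))))) (reach_step a q)"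
    if "q \<in> states reachable_part" for a q
    using that updates_props(1,3)[OF step_spec(3)[of a q]]
    by (cases "F a q") (auto simp: reach_step_def reachable_part_def fills_identity_left fills_identity_right)
  show "reach_final q = map_option (\<lambda>(x, us). (x, fills (identity (fst (state_ty A q))) us)) (E q)"
    if "q \<in> states reachable_part" for q
    using that updates_props(1)[OF final_spec(2)[of q]]
    by (cases "E q") (auto simp: reach_final_def reachable_part_def fills_identity_left)
qed

text \<open>The diagonal is \<open>h'\<close> itself with a smaller target: \<open>e\<close> hits
  every inhabited state of \<open>Y\<close>, and \<open>e ;; h'\<close> lands in the reachable part,
  so all of \<open>h'\<close> does.\<close>

lemma inclusion_strong_mono:
  assumes "infinite (UNIV :: 'q set)" and "A \<in> live_transducers_for rank \<phi>"
  shows "strong_mono rank (live_transducers_for rank \<phi>) reachable_part inclusion A"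
  unfolding strong_mono_def
proof (intro conjI ballI allI impI inclusion_morphism, elim conjE)
  fix X Y :: "('q, 'a, 'g) transducer" and e h h'
  assume Y: "Y \<in> live_transducers_for rank \<phi>"
    and e: "epi rank (live_transducers_for rank \<phi>) X e Y"
    and h: "morphism rank X h reachable_part" and h': "morphism rank Y h' A"
    and comm: "e ;; h' = h ;; inclusion"
  let ?R = "reachable_part"
  \<comment> \<open>Composition with \<open>inclusion\<close> does not change the underlying partial
    function. This also makes the diagonal unique.\<close>
  have into: "k ;; inclusion = k" if "morphism rank Z k ?R" for Z :: "('q, 'a, 'g) transducer" and k
  proof
    fix z show "(k ;; inclusion) z = k z"
      using that transformation_in_configs[of rank "space Z" "space ?R" k z]
      by (cases "k z") (simp_all add: map_seq_apply inclusion_apply morphism_def space_reachable_part)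
  qed
  obtain H where H: "\<And>q d. (q, d) \<in> configs rank (space Y) \<Longrightarrow>
      \<exists>p us. H q = Some (p, us) \<and> h' (q, d) = Some (p, fill d us) \<and>
        us \<in> updates rank (fst (state_ty Y q)) (fst (state_ty A p))"
    and H_None: "\<And>c. c \<notin> configs rank (space Y) \<Longrightarrow> h' c = None"
    and H_spec: "specifies rank (space Y) (space A) H h'"
    using morphism_apply[OF h'] by metis
  \<comment> \<open>The control state of \<open>h' (y, z)\<close> depends on \<open>y\<close> only,
    so it can be read off at a configuration of \<open>y\<close> that \<open>e\<close> hits.\<close>
  have image: "c \<in> configs rank (space ?R)" if c: "h' (y, z) = Some c" for y z c
  proof -
    have yz: "(y, z) \<in> configs rank (space Y)" using c H_None by fastforce
    then obtain x z' where x: "e x = Some (y, z')" using epi_surj[OF assms(1) e Y] by blast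
    then have "(y, z') \<in> configs rank (space Y)"
      using e transformation_in_configs unfolding epi_def morphism_def by metis
    then obtain p us where p: "H y = Some (p, us)" "h' (y, z') = Some (p, fill z' us)"
      using H by blast
    then have "(h ;; inclusion) x = Some (p, fill z' us)"
      using x by (simp flip: comm) (simp add: map_seq_apply)
    then have "p \<in> fst reachable_space"
      by (auto simp: map_seq_apply inclusion_apply bind_eq_Some_conv configs_reachable_part split: if_splits)
    moreover have "fst c = p" using H[OF yz] c p(1) by auto
    moreover have "c \<in> configs rank (space A)"
      using h' c transformation_in_configs unfolding morphism_def by metis
    ultimately show ?thesis by (cases c) (simp add: space_reachable_part configs_reachable_part)
  qed
  have "morphism rank Y h' ?R"
    unfolding morphism_def
  proof (intro conjI allI)
    \<comment> \<open>\<open>H\<close> is cut down to inhabited states: at the others nothing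
      prevents its target from lying outside the reachable part.\<close>
    let ?H = "\<lambda>q. if \<exists>d. (q, d) \<in> configs rank (space Y) then H q else None"
    have "specifies rank (space Y) (space ?R) ?H h'"
      unfolding specifies_def
    proof (intro conjI allI impI ext)
      show "dom ?H \<subseteq> fst (space Y)" by (auto simp: configs_def split: if_splits)
      fix p q us assume "?H p = Some (q, us)"
      then obtain d where d: "H p = Some (q, us)" "(p, d) \<in> configs rank (space Y)"
        by (auto split: if_splits)
      then have "h' (p, d) = Some (q, fill d us)" using H by fastforce
      then show "q \<in> fst (space ?R)" using image by (fastforce simp: configs_def)
      show "us \<in> ty_updates rank (snd (space Y) p) (snd (space ?R) q)"
        using H_spec d(1) by (simp add: specifies_def space_def reachable_part_def)
    next
      fix z show "h' z = (case z of (p, d) \<Rightarrow> if (p, d) \<in> configs rank (space Y)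
          then map_option (\<lambda>(q, us). (q, fill d us)) (?H p) else None)"
        using H_spec by (cases z) (auto simp: specifies_def)
    qed
    then show "transformation rank (space Y) (space ?R) h'"
      unfolding transformation_def by blast
    show "dom h' = configs rank (space Y)" "delta_init ?R = delta_init Y ;; h'"
      using h' by (simp_all add: morphism_def reachable_part_def)
    have restr: "h' ;; f' = h' ;; f" if "\<And>c. c \<in> configs rank reachable_space \<Longrightarrow> f' c = f c"
      for f f' :: "'q \<times> 'g trm \<Rightarrow> 'z option"
    proof
      fix z show "(h' ;; f') z = (h' ;; f) z"
        using image[of "fst z" "snd z"] that
        by (cases "h' z") (simp_all add: map_seq_apply space_reachable_part)
    qed
    have "h' ;; delta ?R a = h' ;; delta A a" for a
      by (rule restr) (rule delta_reachable_part)
    then show "h' ;; delta ?R a = delta Y a ;; h'" for a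
      using h' by (simp add: morphism_def)
    have "h' ;; delta_final ?R = h' ;; delta_final A"
      by (rule restr) (rule delta_reachable_part)
    then show "h' ;; delta_final ?R = delta_final Y"
      using h' by (simp add: morphism_def)
  qed
  then show "\<exists>!d. morphism rank Y d ?R \<and> h = e ;; d \<and> h' = d ;; inclusion"
    using into[OF h] comm into by (intro ex1I[of _ h']) auto
qed

end

section \<open>The quotient map of a reachable live realizer\<close>

locale live_reduction = reduction rank B I' F' E' M I F E
  for rank :: "'g \<Rightarrow> nat" and B :: "('q, 'a, 'g) transducer" and I' F' E'
    and M :: "('q, 'a, 'g) transducer" and I F E +
  assumes B_live: "run B w \<noteq> None \<Longrightarrow> \<exists>v. transduction B (w @ v) \<noteq> None"
    and B_reachable: "q \<in> states B \<Longrightarrow> \<exists>w d. run B w = Some (q, d)"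
begin

lemma useful: "q \<in> states B \<Longrightarrow> B.useful q"
proof -
  assume "q \<in> states B"
  then obtain w d where w: "run B w = Some (q, d)" using B_reachable by blast
  then obtain v where "transduction B (w @ v) \<noteq> None" using B_live by fastforce
  then have "B.out q v \<noteq> None" using B.transduction_out[OF w] by auto
  with w show ?thesis unfolding B.useful_def by blast
qed

definition quot :: "'q \<times> 'g trm \<rightharpoonup> 'q \<times> 'g trm" where
  "quot = realize rank (space B) (\<lambda>q. if q \<in> states B then Some (proj q) else None)"

lemma quot_apply: "(q, d) \<in> configs rank (space B) \<Longrightarrow> quot (q, d) = Some (fst (proj q), fill d (snd (proj q)))"
proof -
  assume "(q, d) \<in> configs rank (space B)"
  moreover from this have "q \<in> states B" by (simp add: configs_def)
  ultimately show ?thesis by (simp add: quot_def realize_def case_prod_unfold)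
qed

text \<open>The squares are the equations for \<open>proj\<close>. Since every state of
  \<open>B\<close> is useful here, a transition missing in \<open>M\<close> is missing in
  \<open>B\<close> too.\<close>

lemma quot_morphism: "morphism rank B quot M"
  unfolding quot_def
proof (rule morphism_of_forests[OF B.specified_axioms M.specified_axioms])
  show "fst (proj q) \<in> states M \<and>
      snd (proj q) \<in> ty_updates rank (state_ty B q) (state_ty M (fst (proj q)))" if "q \<in> states B" for q
  proof -
    obtain m u where mu: "proj q = (m, u)" by fastforce
    have m: "m \<in> states M" "u \<in> updates rank (fst (state_ty B q)) (fst (state_ty M m))"
      using proj_run(1)[OF useful[OF that]] by (auto simp: sim_def mu)
    then obtain n where n: "state_ty M m = (Arity n, {})" using M.unconstrained by blast
    then show ?thesis
      using m fill_base_dom[of _ rank "fst (state_ty B q)" u "Arity n"]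
      by (auto simp: mu ty_updates_def ty_dom_def)
  qed
  show "I () = map_option (\<lambda>(q, us). (fst (proj q), fills us (snd (proj q)))) (I' ())"
  proof (cases "I ()")
    case None
    have "I' () = None"
    proof (rule ccontr)
      assume "I' () \<noteq> None"
      then obtain q us where q: "I' () = Some (q, us)" by auto
      with proj_init(2)[OF None q] useful specifies_updates(2)[OF B.spec_init q] show False by simp
    qed
    with None show ?thesis by simp
  next
    case (Some x)
    then show ?thesis using proj_init(1) by (cases x) fastforce
  qed
  show "map_option (\<lambda>(p, us). (p, fills (snd (proj q)) us)) (F a (fst (proj q))) =
      map_option (\<lambda>(p, us). (fst (proj p), fills us (snd (proj p)))) (F' a q)" if q: "q \<in> states B" for a q
  proof -
    obtain m u where mu: "proj q = (m, u)" by fastforce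
    show ?thesis
    proof (cases "F a m")
      case None
      have "F' a q = None"
      proof (rule ccontr)
        assume "F' a q \<noteq> None"
        then obtain p us where p: "F' a q = Some (p, us)" by auto
        from proj_step(1)[OF useful[OF q] mu None p] useful[OF B.step_spec(2)[OF p]]
        show False by simp
      qed
      with None mu show ?thesis by simp
    next
      case (Some x)
      then show ?thesis using proj_step(2)[OF useful[OF q] mu] mu by (cases x) fastforce
    qed
  qed
  show "E' q = map_option (\<lambda>(x, us). (x, fills (snd (proj q)) us)) (E (fst (proj q)))" if q: "q \<in> states B" for q
    using proj_final[OF useful[OF q], of "fst (proj q)" "snd (proj q)"]
    by (cases "E' q"; cases "E (fst (proj q))") auto
qed

text \<open>Every state of \<open>M\<close> is reached by a run that is the image of a run of
  \<open>B\<close>, and there the two arrows agree. One configuration determines the target state of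
  an arrow and, by left cancellation, its forest.\<close>

lemma quot_epi: "epi rank K B quot M"
  unfolding epi_def
proof (intro conjI ballI allI impI quot_morphism, elim conjE)
  fix C and k k' :: "'q \<times> 'g trm \<rightharpoonup> 'q \<times> 'g trm"
  assume k: "morphism rank M k C" and k': "morphism rank M k' C" and eq: "quot ;; k = quot ;; k'"
  show "k = k'"
  proof
    fix z
    obtain K where K: "\<And>q d. (q, d) \<in> configs rank (space M) \<Longrightarrow>
        \<exists>p us. K q = Some (p, us) \<and> k (q, d) = Some (p, fill d us) \<and>
          us \<in> updates rank (fst (state_ty M q)) (fst (state_ty C p))"
      and K_None: "\<And>c. c \<notin> configs rank (space M) \<Longrightarrow> k c = None"
      using morphism_apply[OF k] by metis
    obtain K' where K': "\<And>q d. (q, d) \<in> configs rank (space M) \<Longrightarrow>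
        \<exists>p us. K' q = Some (p, us) \<and> k' (q, d) = Some (p, fill d us) \<and>
          us \<in> updates rank (fst (state_ty M q)) (fst (state_ty C p))"
      and K'_None: "\<And>c. c \<notin> configs rank (space M) \<Longrightarrow> k' c = None"
      using morphism_apply[OF k'] by metis
    show "k z = k' z"
    proof (cases "z \<in> configs rank (space M)")
      case True
      obtain m e where z: "z = (m, e)" by fastforce
      have m: "m \<in> states M" using True by (simp add: z configs_def)
      obtain w e0 where w: "run M w = Some (m, e0)" using M.reachable[OF m] by blast
      obtain v where v: "M.out m v \<noteq> None" using M.productive[OF m] by blast
      have "transduction B (w @ v) \<noteq> None"
        using M.transduction_out[OF w, of v] v by (simp add: same_transduction)
      then obtain q d where q: "run B w = Some (q, d)" using B.run_prefix_defined by fastforce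
      have "quot (q, d) = Some (m, e0)"
        using proj_run(2)[OF useful[OF B.run_states[OF q]] q] w B.run_configs[OF q]
        by (simp add: quot_apply)
      then have eq0: "k (m, e0) = k' (m, e0)"
        using fun_cong[OF eq, of "(q, d)"] by (simp add: map_seq_apply)
      obtain p us where p: "K m = Some (p, us)" "k (m, e0) = Some (p, fill e0 us)"
        "us \<in> updates rank (fst (state_ty M m)) (fst (state_ty C p))"
        using K[OF M.run_configs[OF w]] by blast
      obtain p' us' where p': "K' m = Some (p', us')" "k' (m, e0) = Some (p', fill e0 us')"
        "us' \<in> updates rank (fst (state_ty M m)) (fst (state_ty C p'))"
        using K'[OF M.run_configs[OF w]] by blast
      have "p = p'" "us = us'"
        using eq0 p(2) p'(2) updates_props(1)[OF p(3)] updates_props(1)[OF p'(3)]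
          M.run_holes[OF w] fill_inject(1)[of us e0 us'] by simp_all
      then show ?thesis
        using K[OF True[unfolded z]] K'[OF True[unfolded z]] p(1) p'(1) by (auto simp: z)
    qed (simp add: K_None K'_None)
  qed
qed

end

theorem reduced_minimal:
  fixes M :: "('q, 'a, 'g) transducer"
  assumes "infinite (UNIV :: 'q set)" and "reduced rank M I F E"
  shows "algebraically_minimal rank (live_transducers_for rank (transduction M)) M"
  unfolding algebraically_minimal_def
proof (intro conjI ballI)
  interpret M: reduced rank M I F E by (rule assms(2))
  let ?K = "live_transducers_for rank (transduction M) :: ('q, 'a, 'g) transducer set"
  \<comment> \<open>Productivity of all states makes a reduced transducer live.\<close>
  have "\<exists>v. transduction M (w @ v) \<noteq> None" if w: "run M w \<noteq> None" for w
  proof -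
    obtain m e where me: "run M w = Some (m, e)" using w by auto
    obtain v where "M.out m v \<noteq> None" using M.productive[OF M.run_states[OF me]] by blast
    then have "transduction M (w @ v) \<noteq> None" using M.transduction_out[OF me, of v] by simp
    then show ?thesis by blast
  qed
  then show "M \<in> ?K"
    using M.transducer unfolding live_transducers_for_def transducers_for_def by blast
  fix B assume B: "B \<in> ?K"
  then have "is_transducer rank B" "transduction B = transduction M"
    by (simp_all add: live_transducers_for_def transducers_for_def)
  then obtain I' F' E' where "specified rank B I' F' E'" using obtain_specified by blast
  then interpret B: specified rank B I' F' E' .
  let ?R = B.reachable_part
  interpret R: specified rank ?R I' B.reach_step B.reach_final
    by (rule B.specified_reachable_part)
  have R: "?R \<in> ?K"
    using B morphism_live[OF B.inclusion_morphism R.transducer B.transducer] by blast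
  \<comment> \<open>A run visits reachable states only, where the restricted transitions agree with
    the original ones.\<close>
  have run: "run ?R w = run B w" for w
  proof (induction w rule: rev_induct)
    case Nil
    show ?case by (simp add: run_Nil B.reachable_part_def)
  next
    case (snoc a w)
    show ?case
    proof (cases "run B w")
      case None
      then show ?thesis using snoc by (simp add: run_snoc)
    next
      case (Some c)
      then have "c \<in> configs rank B.reachable_space"
        using B.run_configs B.reachable_spaceI by (cases c) (auto simp: B.configs_reachable_part)
      then show ?thesis using snoc Some by (simp add: run_snoc B.delta_reachable_part)
    qed
  qed
  interpret live_reduction rank ?R I' B.reach_step B.reach_final M I F E
  proof unfold_locales
    show "transduction ?R = transduction M"
      using R by (simp add: live_transducers_for_def transducers_for_def)
    show "\<exists>v. transduction ?R (w @ v) \<noteq> None" if "run ?R w \<noteq> None" for w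
      using R that by (simp add: live_transducers_for_def transducers_for_def)
    show "\<exists>w d. run ?R w = Some (q, d)" if "q \<in> states ?R" for q
      using that by (simp add: run B.states_reachable_part B.reachable_space_def)
  qed
  show "subquotient_of rank ?K M B"
    unfolding subquotient_of_def subobject_of_def quotient_of_def
    using R B.inclusion_strong_mono[OF assms(1) B] quot_epi by blast
qed

section \<open>Existence of reduced transducers\<close>

context specified
begin

lemma transduction_ground:
  assumes "transduction A w = Some t"
  shows "ranked rank t" "holes t = 0"
proof -
  have "transduction A (w @ []) \<noteq> None" using assms by simp
  then obtain q d where q: "run A w = Some (q, d)" using run_prefix_defined by fastforce
  then obtain us where us: "out q [] = Some us" "t = fill d us"
    using transduction_out[OF q, of "[]"] assms by (cases "E q") auto
  have "d \<in> base_dom rank (fst (state_ty A q))"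
    using run_configs[OF q] by (auto simp: configs_def ty_dom_def split: prod.splits)
  then have "t \<in> base_dom rank (Arity 0)"
    unfolding us(2) using out_updates[OF us(1)] by (rule fill_base_dom)
  then show "ranked rank t" "holes t = 0" by (auto simp: linear_terms_def)
qed

definition live :: "'a list \<Rightarrow> bool" where
  "live w \<longleftrightarrow> (\<exists>v. transduction A (w @ v) \<noteq> None)"

text \<open>By \<open>prefix_of_spread\<close>, a spread \<open>r\<close> makes \<open>d\<close> the
  greatest common prefix of the outputs on extensions of a live \<open>w\<close>.\<close>

definition factors :: "'a list \<Rightarrow> 'g trm \<Rightarrow> ('a list \<rightharpoonup> 'g trm list) \<Rightarrow> bool" where
  "factors w d r \<longleftrightarrow> spread (holes d) (dom r) (\<lambda>v. the (r v)) \<and>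
     (\<forall>v. transduction A (w @ v) = map_option (fill d) (r v))"

lemma factors_exists:
  assumes "live w"
  shows "\<exists>d r. factors w d r"
proof -
  let ?D = "{v. transduction A (w @ v) \<noteq> None}"
  have "ranked rank (the (transduction A (w @ v)))" "holes (the (transduction A (w @ v))) = 0"
    if "v \<in> ?D" for v
    using that transduction_ground by auto
  then obtain d u where du: "spread (holes d) ?D u" "\<forall>v\<in>?D. the (transduction A (w @ v)) = fill d (u v)"
    using greatest_common_prefix[of ?D rank "\<lambda>v. the (transduction A (w @ v))"] assms
    unfolding live_def by blast
  let ?r = "\<lambda>v. if v \<in> ?D then Some (u v) else None"
  have "dom ?r = ?D" by (auto simp: dom_def)
  moreover from this have "spread (holes d) (dom ?r) (\<lambda>v. the (?r v))"
    using du(1) unfolding spread_def by simp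
  moreover have "transduction A (w @ v) = map_option (fill d) (?r v)" for v
    using du(2) by auto
  ultimately show ?thesis unfolding factors_def by blast
qed

definition pref :: "'a list \<Rightarrow> 'g trm" where
  "pref w = (SOME d. \<exists>r. factors w d r)"

definition resid :: "'a list \<Rightarrow> 'a list \<rightharpoonup> 'g trm list" where
  "resid w = (SOME r. factors w (pref w) r)"

lemma factors_resid: "live w \<Longrightarrow> factors w (pref w) (resid w)"
proof -
  assume "live w"
  then have "\<exists>r. factors w (pref w) r"
    unfolding pref_def by (rule someI_ex[OF factors_exists])
  then show ?thesis unfolding resid_def by (rule someI_ex)
qed

lemma spread_resid: "live w \<Longrightarrow> spread (holes (pref w)) (dom (resid w)) (\<lambda>v. the (resid w v))"
  using factors_resid by (simp add: factors_def)

lemma transduction_resid: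
  "live w \<Longrightarrow> transduction A (w @ v) = map_option (fill (pref w)) (resid w v)"
  using factors_resid by (simp add: factors_def)

lemma dom_resid: "live w \<Longrightarrow> dom (resid w) \<noteq> {}"
proof -
  assume w: "live w"
  then obtain v where "transduction A (w @ v) \<noteq> None" by (auto simp: live_def)
  then have "v \<in> dom (resid w)" using transduction_resid[OF w, of v] by auto
  then show ?thesis by blast
qed

lemma resid_length: "live w \<Longrightarrow> resid w v = Some us \<Longrightarrow> length us = holes (pref w)"
  using spread_resid[of w] unfolding spread_def by (metis domI option.sel)

lemma live_snoc: "live w \<Longrightarrow> live (w @ [a]) \<longleftrightarrow> (\<exists>v. resid w (a # v) \<noteq> None)"
  using transduction_resid[of w "a # v" for v] by (simp add: live_def)

lemma live_prefix: "live (w @ v) \<Longrightarrow> live w"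
  unfolding live_def by auto

text \<open>Outputs are ranked ground terms. Being ranked passes to both factors of a composition,
  being ground to the second.\<close>

lemma pref_ranked: "live w \<Longrightarrow> ranked rank (pref w)"
  and resid_ranked: "live w \<Longrightarrow> resid w v = Some us \<Longrightarrow> u \<in> set us \<Longrightarrow> ranked rank u"
  and resid_holes: "live w \<Longrightarrow> resid w v = Some us \<Longrightarrow> sum_list (map holes us) = 0"
proof -
  have *: "ranked rank (pref w) \<and> (\<forall>u\<in>set us. ranked rank u) \<and> sum_list (map holes us) = 0"
    if "live w" "resid w v = Some us" for v us
  proof -
    have "transduction A (w @ v) = Some (fill (pref w) us)"
      using transduction_resid[OF that(1), of v] that(2) by simp
    from transduction_ground[OF this] show ?thesis
      using resid_length[OF that] by (simp add: ranked_fill holes_fill)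
  qed
  show "live w \<Longrightarrow> ranked rank (pref w)" using * dom_resid by blast
  show "live w \<Longrightarrow> resid w v = Some us \<Longrightarrow> u \<in> set us \<Longrightarrow> ranked rank u" using * by blast
  show "live w \<Longrightarrow> resid w v = Some us \<Longrightarrow> sum_list (map holes us) = 0" using * by blast
qed

text \<open>The number of placeholders can be read off any member of the residual family. So the
  type of a state is well defined although its words may have different prefixes.\<close>

lemma pref_arity: "live w \<Longrightarrow> live w' \<Longrightarrow> resid w = resid w' \<Longrightarrow> holes (pref w) = holes (pref w')"
  using dom_resid resid_length by (metis domD ex_in_conv)

text \<open>\<open>pref w\<close> is a prefix of all outputs on extensions of
  \<open>w @ [a]\<close>, hence divides their greatest common prefix. The quotient \<open>vs\<close>
  becomes the update on the letter \<open>a\<close>.\<close>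

lemma resid_step:
  assumes "live (w @ [a])"
  shows "\<exists>vs. length vs = holes (pref w) \<and> fill (pref w) vs = pref (w @ [a]) \<and>
    (\<forall>v. resid w (a # v) = map_option (fills vs) (resid (w @ [a]) v))"
proof (rule common_prefix_of_spread)
  have w: "live w" using assms by (rule live_prefix)
  show "map_option (fill (pref w)) (resid w (a # v)) =
      map_option (fill (pref (w @ [a]))) (resid (w @ [a]) v)" for v
    using transduction_resid[OF w, of "a # v"] transduction_resid[OF assms, of v] by simp
  show "length us = holes (pref w)" if "resid w (a # v) = Some us" for v us
    using resid_length[OF w that] .
qed (use assms dom_resid spread_resid in blast)+

text \<open>The term reached by \<open>A\<close> is a common prefix of the outputs, hence divides
  \<open>pref w\<close>; the quotient is \<open>f\<close>.\<close>

lemma resid_of_state: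
  assumes "run A w = Some (q, d)" and "live w"
  shows "\<exists>f. length f = wd q \<and> sum_list (map holes f) = holes (pref w) \<and>
    (\<forall>v. out q v = map_option (fills f) (resid w v))"
proof -
  have "\<exists>f. length f = holes d \<and> fill d f = pref w \<and>
    (\<forall>v. out q v = map_option (fills f) (resid w v))"
  proof (rule common_prefix_of_spread)
    show "map_option (fill d) (out q v) = map_option (fill (pref w)) (resid w v)" for v
      using transduction_resid[OF assms(2)] transduction_out[OF assms(1)] by metis
    show "length us = holes d" if "out q v = Some us" for v us
      using out_length[OF that] run_holes[OF assms(1)] by simp
  qed (use assms dom_resid spread_resid in blast)+
  then show ?thesis using run_holes[OF assms(1)] by (metis holes_fill)
qed

text \<open>The output family of \<open>q\<close> factors through both residual families, and such
  factorizations are unique. So there are at most as many residual families as states of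
  \<open>A\<close>, which leaves room for the names.\<close>

lemma resid_state_unique:
  assumes "run A w = Some (q, d)" and "run A w' = Some (q, d')" and "live w" and "live w'"
  shows "resid w = resid w'"
proof -
  obtain f f' where
    "length f = wd q" "sum_list (map holes f) = holes (pref w)"
    "\<And>v. out q v = map_option (fills f) (resid w v)"
    "length f' = wd q" "sum_list (map holes f') = holes (pref w')"
    "\<And>v. out q v = map_option (fills f') (resid w' v)"
    using resid_of_state[OF assms(1,3)] resid_of_state[OF assms(2,4)] by blast
  then show ?thesis
    using forest_factorization_unique(2)[of "resid w" f f' "resid w'" d] run_holes[OF assms(1)]
      dom_resid spread_resid assms(3,4) by metis
qed

text \<open>The states of the minimal transducer are residual families; they are named by states of \<open>A\<close>
  since the state type need not have room for a name for every word.\<close>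

definition name :: "'a list \<Rightarrow> 'q" where
  "name w = (SOME q. \<exists>w' d. live w' \<and> resid w' = resid w \<and> run A w' = Some (q, d))"

lemma name_run: "live w \<Longrightarrow> \<exists>w' d. live w' \<and> resid w' = resid w \<and> run A w' = Some (name w, d)"
proof -
  assume w: "live w"
  then obtain q d where "run A w = Some (q, d)"
    using run_prefix_defined unfolding live_def by fastforce
  with w have "\<exists>q w' d. live w' \<and> resid w' = resid w \<and> run A w' = Some (q, d)" by blast
  from someI_ex[OF this] show ?thesis by (simp add: name_def)
qed

lemma name_eq_iff:
  assumes "live w" and "live w'"
  shows "name w = name w' \<longleftrightarrow> resid w = resid w'"
proof
  assume eq: "name w = name w'"
  from name_run[OF assms(1)] name_run[OF assms(2)] show "resid w = resid w'"
    unfolding eq using resid_state_unique by metis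
qed (simp add: name_def)

definition min_states :: "'q set" where
  "min_states = name ` {w. live w}"

definition rep :: "'q \<Rightarrow> 'a list" where
  "rep q = (SOME w. live w \<and> name w = q)"

lemma rep: "q \<in> min_states \<Longrightarrow> live (rep q)" "q \<in> min_states \<Longrightarrow> name (rep q) = q"
  using someI_ex[of "\<lambda>w. live w \<and> name w = q"] by (auto simp: min_states_def rep_def)

lemma name_min_states: "live w \<Longrightarrow> name w \<in> min_states"
  by (simp add: min_states_def)

lemma resid_rep_name: "live w \<Longrightarrow> resid (rep (name w)) = resid w"
  using name_eq_iff rep name_min_states by metis

definition min_forest :: "'a \<Rightarrow> 'q \<Rightarrow> 'g trm list" where
  "min_forest a q = (SOME vs. length vs = holes (pref (rep q)) \<and>
     fill (pref (rep q)) vs = pref (rep q @ [a]) \<and>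
     (\<forall>v. resid (rep q) (a # v) = map_option (fills vs) (resid (rep q @ [a]) v)))"

lemma min_forest:
  assumes "live (rep q @ [a])"
  shows "length (min_forest a q) = holes (pref (rep q))"
    "fill (pref (rep q)) (min_forest a q) = pref (rep q @ [a])"
    "resid (rep q) (a # v) = map_option (fills (min_forest a q)) (resid (rep q @ [a]) v)"
  using someI_ex[OF resid_step[OF assms]] unfolding min_forest_def by blast+

definition min_init :: "unit \<rightharpoonup> 'q \<times> 'g trm list" where
  "min_init x = (if live [] then Some (name [], [pref []]) else None)"

definition min_step :: "'a \<Rightarrow> 'q \<rightharpoonup> 'q \<times> 'g trm list" where
  "min_step a q = (if q \<in> min_states \<and> live (rep q @ [a])
     then Some (name (rep q @ [a]), min_forest a q) else None)"

definition min_final :: "'q \<rightharpoonup> unit \<times> 'g trm list" where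
  "min_final q = (if q \<in> min_states then map_option (Pair ()) (resid (rep q) []) else None)"

definition min_space :: "('q, 'g) space" where
  "min_space = (min_states, \<lambda>q. (Arity (holes (pref (rep q))), {}))"

definition minimal :: "('q, 'a, 'g) transducer" where
  "minimal = \<lparr>states = min_states, state_ty = snd min_space, delta_init = realize rank start_space min_init,
     delta = (\<lambda>a. realize rank min_space (min_step a)), delta_final = realize rank min_space min_final\<rparr>"

lemma specified_minimal: "specified rank minimal min_init min_step min_final"
proof -
  have sp: "space minimal = min_space" by (simp add: space_def minimal_def min_space_def)
  have init: "specifies rank start_space min_space min_init (realize rank start_space min_init)"
  proof (rule specifies_realize)
    fix p q us assume "min_init p = Some (q, us)"
    then have p: "live []" "q = name []" "us = [pref []]"
      by (auto simp: min_init_def split: if_splits)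
    have "holes (pref (rep (name []))) = holes (pref [])"
      using pref_arity rep(1)[OF name_min_states] resid_rep_name p(1) by blast
    then show "p \<in> fst start_space \<and> q \<in> fst min_space \<and>
        us \<in> updates rank (fst (snd start_space p)) (fst (snd min_space q)) \<and> snd (snd min_space q) = {}"
      using p name_min_states pref_ranked by (simp add: start_space_def min_space_def)
  qed
  have step: "specifies rank min_space min_space (min_step a) (realize rank min_space (min_step a))" for a
  proof (rule specifies_realize)
    fix p q us assume "min_step a p = Some (q, us)"
    then have p: "p \<in> min_states" "live (rep p @ [a])" "q = name (rep p @ [a])" "us = min_forest a p"
      by (auto simp: min_step_def split: if_splits)
    note f = min_forest[OF p(2), folded p(4)]
    have q: "q \<in> min_states" using p(2,3) name_min_states by simp
    have "ranked rank (fill (pref (rep p)) us)" using pref_ranked[OF p(2)] f(2) by simp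
    then have "\<forall>u\<in>set us. ranked rank u" using f(1) by (simp add: ranked_fill)
    moreover have "sum_list (map holes us) = holes (pref (rep q))"
      using f holes_fill pref_arity[OF rep(1)[OF q] p(2)] resid_rep_name[OF p(2)] p(3) by metis
    ultimately show "p \<in> fst min_space \<and> q \<in> fst min_space \<and>
        us \<in> updates rank (fst (snd min_space p)) (fst (snd min_space q)) \<and> snd (snd min_space q) = {}"
      using p(1) q f(1) by (simp add: min_space_def)
  qed
  have final: "specifies rank min_space end_space min_final (realize rank min_space min_final)"
  proof (rule specifies_realize)
    fix p q us assume "min_final p = Some (q, us)"
    then have p: "p \<in> min_states" "resid (rep p) [] = Some us"
      by (auto simp: min_final_def split: if_splits)
    from rep(1)[OF p(1)] p(2) have "us \<in> updates rank (Arity (holes (pref (rep p)))) (Arity 0)"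
      using resid_length resid_ranked resid_holes by fastforce
    with p(1) show "p \<in> fst min_space \<and> q \<in> fst end_space \<and>
        us \<in> updates rank (fst (snd min_space p)) (fst (snd end_space q)) \<and> snd (snd end_space q) = {}"
      by (simp add: min_space_def end_space_def)
  qed
  have "is_transducer rank minimal"
    unfolding is_transducer_def transformation_def sp
    using init step final by (auto simp: minimal_def min_space_def is_ty_def)
  with init step final show ?thesis
    by unfold_locales (simp_all add: sp, simp_all add: minimal_def)
qed

text \<open>Transitions are defined through the word \<open>rep\<close>. Another word with the same
  residual family leads to a factorization of the same family on the words \<open>a # v\<close>, so
  uniqueness yields the same forest and the same residual family after \<open>a\<close>.\<close>

lemma min_step_name:
  assumes "live w"
  shows "min_step a (name w) = None \<longleftrightarrow> \<not> live (w @ [a])"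
    and "min_step a (name w) = Some (q, vs) \<Longrightarrow> q = name (w @ [a]) \<and> fill (pref w) vs = pref (w @ [a])"
proof -
  let ?w = "rep (name w)"
  have w: "live ?w" "resid ?w = resid w"
    using assms rep name_min_states resid_rep_name by auto
  have live: "live (?w @ [a]) \<longleftrightarrow> live (w @ [a])"
    using live_snoc[OF assms] live_snoc[OF w(1)] w(2) by simp
  show "min_step a (name w) = None \<longleftrightarrow> \<not> live (w @ [a])"
    using live name_min_states[OF assms] by (simp add: min_step_def)
  assume "min_step a (name w) = Some (q, vs)"
  then have *: "live (?w @ [a])" "q = name (?w @ [a])" "vs = min_forest a (name w)"
    by (auto simp: min_step_def split: if_splits)
  note f = min_forest[OF *(1), folded *(3)]
  have wa: "live (w @ [a])" using live *(1) by simp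
  obtain vs' where f': "length vs' = holes (pref w)" "fill (pref w) vs' = pref (w @ [a])"
    "\<And>v. resid w (a # v) = map_option (fills vs') (resid (w @ [a]) v)"
    using resid_step[OF wa] by blast
  have len: "length vs = holes (pref w)" using f(1) pref_arity[OF w(1) assms w(2)] by simp
  have sums: "sum_list (map holes vs) = holes (pref (?w @ [a]))"
    "sum_list (map holes vs') = holes (pref (w @ [a]))"
    using f(1,2) f'(1,2) holes_fill by metis+
  have "map_option (fills vs) (resid (?w @ [a]) v) = map_option (fills vs') (resid (w @ [a]) v)" for v
    using f(3)[of v] f'(3)[of v] w(2) by simp
  from forest_factorization_unique[OF dom_resid[OF *(1)] _ _ len f'(1) this]
  have "vs = vs'" "resid (?w @ [a]) = resid (w @ [a])"
    using spread_resid *(1) wa unfolding sums by blast+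
  then show "q = name (w @ [a]) \<and> fill (pref w) vs = pref (w @ [a])"
    using name_eq_iff[OF *(1) wa] *(2) f'(2) by simp
qed

interpretation M: specified rank minimal min_init min_step min_final
  by (rule specified_minimal)

lemma run_minimal: "run minimal w = (if live w then Some (name w, pref w) else None)"
proof (induction w rule: rev_induct)
  case Nil
  show ?case by (simp add: M.run_Nil_spec min_init_def)
next
  case (snoc a w)
  show ?case
  proof (cases "live w")
    case True
    with snoc have "run minimal w = Some (name w, pref w)" by simp
    from M.run_snoc_spec[OF this, of a] show ?thesis
      using min_step_name[OF True, of a] by (cases "min_step a (name w)") auto
  next
    case False
    then have "\<not> live (w @ [a])" using live_prefix by blast
    with False snoc show ?thesis by (simp add: run_snoc)
  qed
qed

text \<open>The last equation of \<open>min_forest\<close> is the recursion of \<open>outw\<close>.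
  If \<open>a\<close> leads to a word that is not live, both sides are undefined.\<close>

lemma out_minimal: "q \<in> min_states \<Longrightarrow> M.out q v = resid (rep q) v"
proof (induction v arbitrary: q)
  case Nil
  then show ?case by (cases "resid (rep q) []") (simp_all add: min_final_def)
next
  case (Cons a v)
  show ?case
  proof (cases "live (rep q @ [a])")
    case True
    then show ?thesis
      using Cons.IH[OF name_min_states[OF True]] Cons.prems min_forest(3)[OF True]
      by (simp add: min_step_def resid_rep_name)
  next
    case False
    then have "resid (rep q) (a # v) = None"
      using live_snoc[OF rep(1)[OF Cons.prems]] by blast
    with False show ?thesis by (simp add: min_step_def)
  qed
qed

text \<open>As the states output their residual families, the conditions on outputs become
  properties of these: nonempty, spread, and distinct for distinct names.\<close>

lemma reduced_minimal_transducer: "reduced rank minimal min_init min_step min_final"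
proof unfold_locales
  fix q assume "q \<in> states minimal"
  then have q: "q \<in> min_states" by (simp add: minimal_def)
  note r = rep[OF q]
  have ty: "state_ty minimal q = (Arity (holes (pref (rep q))), {})"
    by (simp add: minimal_def min_space_def)
  show "\<exists>w d. run minimal w = Some (q, d)" using r run_minimal by metis
  show "\<exists>n. state_ty minimal q = (Arity n, {})" by (simp add: ty)
  have out: "M.out q = resid (rep q)" using out_minimal[OF q] by auto
  show "\<exists>v. M.out q v \<noteq> None" using out dom_resid[OF r(1)] by (metis domIff ex_in_conv)
  show "spread (M.wd q) (dom (M.out q)) (\<lambda>v. the (M.out q v))"
    unfolding out[THEN fun_cong] out ty using spread_resid[OF r(1)] by simp
  fix p assume "p \<in> states minimal" and eq: "M.out q = M.out p"
  then have p: "p \<in> min_states" by (simp add: minimal_def)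
  have "M.out p = resid (rep p)" using out_minimal[OF p] by auto
  with eq out show "q = p" using name_eq_iff r rep[OF p] by metis
qed

lemma transduction_minimal: "transduction minimal = transduction A"
proof
  fix w
  show "transduction minimal w = transduction A w"
  proof (cases "live []")
    case True
    then have "run minimal [] = Some (name [], pref [])" by (simp add: run_minimal)
    from M.transduction_out[OF this, of w] show ?thesis
      using out_minimal[OF name_min_states[OF True]] transduction_resid[OF True, of w]
      by (simp add: resid_rep_name[OF True])
  next
    case False
    then have "run minimal [] = None" by (simp add: run_minimal)
    then have "transduction minimal ([] @ w) = None" using M.run_prefix_defined by blast
    then show ?thesis using False by (auto simp: live_def)
  qed
qed

text \<open>Makes the minimal transducer finite whenever \<open>A\<close> is, so that it has a
  presentation.\<close>

lemma min_states_subset: "min_states \<subseteq> states A"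
proof
  fix q assume "q \<in> min_states"
  then obtain x where "live x" "q = name x" by (auto simp: min_states_def)
  then obtain w d where "run A w = Some (q, d)" using name_run by blast
  then show "q \<in> states A" by (rule run_states)
qed

end

theorem reduced_exists:
  fixes A :: "('q, 'a, 'g) transducer"
  assumes "is_transducer rank A"
  shows "\<exists>(M :: ('q, 'a, 'g) transducer) I F E. reduced rank M I F E \<and>
    transduction M = transduction A \<and> states M \<subseteq> states A"
proof -
  obtain I F E where "specified rank A I F E" using obtain_specified[OF assms] .
  then interpret specified rank A I F E .
  show ?thesis
    using reduced_minimal_transducer transduction_minimal min_states_subset
    by (metis minimal_def transducer.select_convs(1))
qed

section \<open>Certificates for reduction\<close>

text \<open>Preorder traversal. The number of children is recorded so that ranks can be checked
  token by token and the forest can be rebuilt with a stack.\<close>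

fun flat :: "'g trm \<Rightarrow> ('g \<times> nat) option list" where
  "flat Hole = [None]"
| "flat (Node g ts) = Some (g, length ts) # concat (map flat ts)"

definition toks :: "'g trm list \<Rightarrow> ('g \<times> nat) option list" where
  "toks ts = concat (map flat ts)"

text \<open>The list \<open>rk\<close> stands for the graph of the rank function: a finite object
  that a computation can use and that is carried along when symbols are renamed.\<close>

definition ranked_by :: "('g \<times> nat) list \<Rightarrow> 'g trm list \<Rightarrow> bool" where
  "ranked_by rk ts \<longleftrightarrow> (\<forall>x\<in>set (toks ts). case x of None \<Rightarrow> True | Some y \<Rightarrow> y \<in> set rk)"

text \<open>For a tuple of the wrong length, \<open>fills\<close> may read \<open>hd []\<close>, which is not invariant under
  renamings of symbols.\<close>

definition graft :: "'g trm list \<Rightarrow> 'g trm list \<Rightarrow> 'g trm list option" where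
  "graft ts us = (if length us = sum_list (map holes ts) then Some (fills ts us) else None)"

text \<open>The default contains neither letters nor symbols, so it is invariant under renaming,
  which cannot be expected of \<open>snd P ! k\<close> outside the range.\<close>

definition pdesc :: "('a, 'g) presentation \<Rightarrow> nat \<Rightarrow> ('a, 'g) state_desc" where
  "pdesc P k = (if k < length (snd P) then snd P ! k else (Init, [], [], None))"

definition pbase :: "('a, 'g) presentation \<Rightarrow> nat \<Rightarrow> base" where
  "pbase P k = fst (pdesc P k)"

definition ptable :: "('a, 'g) presentation \<Rightarrow> nat \<Rightarrow> ('a \<times> 'g target) list" where
  "ptable P k = fst (snd (snd (pdesc P k)))"

definition ptrans :: "('a, 'g) presentation \<Rightarrow> nat \<Rightarrow> 'a \<rightharpoonup> 'g target" where
  "ptrans P k a = map_of (ptable P k) a"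

definition pfin :: "('a, 'g) presentation \<Rightarrow> nat \<Rightarrow> 'g trm list option" where
  "pfin P k = snd (snd (snd (pdesc P k)))"

definition pextend :: "'g trm list \<Rightarrow> 'g target option \<Rightarrow> 'g target option" where
  "pextend u x = (case x of None \<Rightarrow> None | Some y \<Rightarrow> map_option (Pair (fst y)) (graft u (snd y)))"

definition pstep :: "('a, 'g) presentation \<Rightarrow> 'a \<Rightarrow> 'g target option \<Rightarrow> 'g target option" where
  "pstep P a x = (case x of None \<Rightarrow> None | Some y \<Rightarrow> pextend (snd y) (ptrans P (fst y) a))"

definition psteps :: "('a, 'g) presentation \<Rightarrow> 'a list \<Rightarrow> 'g target option \<Rightarrow> 'g target option" where
  "psteps P w x = fold (\<lambda>a x. pstep P a x) w x"

definition pend :: "('a, 'g) presentation \<Rightarrow> 'g target option \<Rightarrow> 'g trm list option" where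
  "pend P x = (case x of None \<Rightarrow> None | Some y \<Rightarrow>
     (case pfin P (fst y) of None \<Rightarrow> None | Some us \<Rightarrow> graft (snd y) us))"

text \<open>A fold forward from the identity forest, whereas \<open>outw\<close> recurses towards
  the end of the word; associativity identifies the two in \<open>pout_out\<close>.\<close>

definition pout :: "('a, 'g) presentation \<Rightarrow> 'a list \<Rightarrow> nat \<Rightarrow> 'g trm list option" where
  "pout P v k = pend P (psteps P v (Some (k, identity (pbase P k))))"

text \<open>Agrees with membership in \<open>updates\<close> if \<open>c\<close> is some
  \<open>Arity n\<close>. For \<open>c = Init\<close> it is weaker, which is why well-formed
  presentations avoid the initial type.\<close>

definition upd_ok :: "('g \<times> nat) list \<Rightarrow> 'g trm list \<Rightarrow> base \<Rightarrow> base \<Rightarrow> bool" where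
  "upd_ok rk us b c \<longleftrightarrow> length us = width b \<and> ranked_by rk us \<and> sum_list (map holes us) = width c"

definition target_ok :: "('g \<times> nat) list \<Rightarrow> ('a, 'g) presentation \<Rightarrow> base \<Rightarrow> 'g target \<Rightarrow> bool" where
  "target_ok rk P b y \<longleftrightarrow> fst y < length (snd P) \<and> upd_ok rk (snd y) b (pbase P (fst y))"

text \<open>Bounding letters by \<open>al\<close> and symbols by \<open>rk\<close> also ensures that
  a certificate found over the numbers can be renamed back to the original alphabets.\<close>

definition wf_pres :: "'a list \<Rightarrow> ('g \<times> nat) list \<Rightarrow> ('a, 'g) presentation \<Rightarrow> bool" where
  "wf_pres al rk P \<longleftrightarrow>
     (\<forall>k<length (snd P). pbase P k \<noteq> Init \<and> fst (snd (pdesc P k)) = [] \<and>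
        (case pfin P k of None \<Rightarrow> True | Some us \<Rightarrow> upd_ok rk us (pbase P k) (Arity 0)) \<and>
        (\<forall>e\<in>set (ptable P k). fst e \<in> set al \<and> target_ok rk P (pbase P k) (snd e))) \<and>
     (case fst P of None \<Rightarrow> True | Some y \<Rightarrow> target_ok rk P Init y)"

text \<open>A transition \<open>x\<close> of the original and a transition \<open>y\<close> of its reduction agree: the table \<open>f\<close>
  sends the useful states to states of the reduction, and \<open>D\<close> lists dead states.\<close>

definition link :: "(nat \<times> 'g target) list \<Rightarrow> nat list \<Rightarrow> 'g target option \<Rightarrow> 'g target option \<Rightarrow> bool" where
  "link f D x y \<longleftrightarrow> (case x of None \<Rightarrow> y = None | Some z \<Rightarrow>
     fst z \<in> set D \<and> y = None \<or>
     y \<noteq> None \<and> y = pextend (snd z) (map_of f (fst z)))"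

text \<open>The links are the commuting squares for the map \<open>f\<close>. The conditions on
  \<open>D\<close> ensure that no word leads from a state in \<open>D\<close> to an output.\<close>

definition sim_ok :: "'a list \<Rightarrow> ('g \<times> nat) list \<Rightarrow> ('a, 'g) presentation \<Rightarrow> ('a, 'g) presentation \<Rightarrow>
    (nat \<times> 'g target) list \<Rightarrow> nat list \<Rightarrow> bool" where
  "sim_ok al rk P Q f D \<longleftrightarrow> link f D (fst P) (fst Q) \<and>
     (\<forall>e\<in>set f. fst e < length (snd P) \<and> target_ok rk Q (pbase P (fst e)) (snd e) \<and>
        pfin P (fst e) = pend Q (Some (snd e)) \<and>
        (\<forall>a\<in>set al. link f D (ptrans P (fst e) a) (pstep Q a (Some (snd e))))) \<and>
     (\<forall>k\<in>set D. k < length (snd P) \<and> pfin P k = None \<and>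
        (\<forall>a\<in>set al. case ptrans P k a of None \<Rightarrow> True | Some y \<Rightarrow> fst y \<in> set D))"

text \<open>The outer option separates a missing output from the root of a placeholder, which is
  \<open>None\<close> inside.\<close>

definition nth_root :: "'g trm list option \<Rightarrow> nat \<Rightarrow> 'g option option" where
  "nth_root z i = (case z of None \<Rightarrow> None | Some us \<Rightarrow>
     if i < length us then Some (root_symbol (us ! i)) else None)"

definition tests_ok :: "('a, 'g) presentation \<Rightarrow> 'a list list \<Rightarrow> bool" where
  "tests_ok Q V \<longleftrightarrow> (\<forall>j<length (snd Q).
     (\<exists>w\<in>set V. map_option fst (psteps Q w (fst Q)) = Some j) \<and>
     (\<exists>v\<in>set V. pout Q v j \<noteq> None) \<and>
     (\<forall>i<width (pbase Q j). \<exists>v\<in>set V. \<exists>w\<in>set V.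
        nth_root (pout Q v j) i \<noteq> None \<and> nth_root (pout Q w j) i \<noteq> None \<and>
        nth_root (pout Q v j) i \<noteq> nth_root (pout Q w j) i) \<and>
     (\<forall>j'<length (snd Q). j \<noteq> j' \<longrightarrow> (\<exists>v\<in>set V. pout Q v j \<noteq> pout Q v j')))"

lemma ranked_by_Nil: "ranked_by rk []"
  and ranked_by_Cons: "ranked_by rk (t # ts) \<longleftrightarrow> ranked_by rk [t] \<and> ranked_by rk ts"
  by (auto simp: ranked_by_def toks_def)

lemma ranked_by_iff:
  assumes "set rk = range (\<lambda>g. (g, rank g))"
  shows "ranked_by rk ts \<longleftrightarrow> (\<forall>t\<in>set ts. ranked rank t)"
proof -
  have *: "(g, k) \<in> set rk \<longleftrightarrow> k = rank g" for g k using assms by auto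
  have "ranked_by rk [t] \<longleftrightarrow> ranked rank t" for t
  proof (induction t)
    case Hole
    then show ?case by (simp add: ranked_by_def toks_def)
  next
    case (Node g ts)
    have "ranked_by rk ts \<longleftrightarrow> (\<forall>t\<in>set ts. ranked rank t)"
      using Node
    proof (induction ts)
      case (Cons t ts)
      then show ?case using ranked_by_Cons[of rk t ts] by simp
    qed (simp add: ranked_by_Nil)
    moreover have "ranked_by rk [Node g ts] \<longleftrightarrow> (g, length ts) \<in> set rk \<and> ranked_by rk ts"
      by (simp add: ranked_by_def toks_def)
    ultimately show ?case by (simp add: *)
  qed
  then show ?thesis
  proof (induction ts)
    case (Cons t ts)
    then show ?case using ranked_by_Cons[of rk t ts] by simp
  qed (simp add: ranked_by_Nil)
qed

lemma upd_ok_iff: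
  assumes "set rk = range (\<lambda>g. (g, rank g))"
  shows "upd_ok rk us b (Arity n) \<longleftrightarrow> us \<in> updates rank b (Arity n)"
    and "us \<in> updates rank b c \<Longrightarrow> upd_ok rk us b c"
  using updates_props[of us rank b c] by (auto simp: upd_ok_def ranked_by_iff[OF assms])

lemma psteps_Nil [simp]: "psteps P [] x = x"
  and psteps_Cons: "psteps P (a # w) x = psteps P w (pstep P a x)"
  and psteps_snoc: "psteps P (w @ [a]) x = pstep P a (psteps P w x)"
  by (simp_all add: psteps_def)

lemma psteps_None [simp]: "psteps P w None = None"
  by (induction w) (simp_all add: psteps_Cons pstep_def)

section \<open>Presentations and the transducers they present\<close>

locale presented = specified rank A I F E
  for rank :: "'g \<Rightarrow> nat" and A :: "('q, 'a, 'g) transducer" and I F E +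
  fixes P :: "('a, 'g) presentation" and \<nu> :: "nat \<Rightarrow> 'q"
  assumes inj_\<nu>: "inj \<nu>" and states_\<nu>: "states A = \<nu> ` {..<length (snd P)}"
    and init_P: "I () = map_option (map_prod \<nu> id) (fst P)"
    and step_P: "k < length (snd P) \<Longrightarrow> F a (\<nu> k) = map_option (map_prod \<nu> id) (ptrans P k a)"
    and final_P: "k < length (snd P) \<Longrightarrow> E (\<nu> k) = map_option (Pair ()) (pfin P k)"
    and base_P: "k < length (snd P) \<Longrightarrow> fst (state_ty A (\<nu> k)) = pbase P k"
begin

lemma states_iff: "\<nu> k \<in> states A \<longleftrightarrow> k < length (snd P)"
  using inj_\<nu> by (auto simp: states_\<nu> inj_def)

lemma ptrans_updates:
  assumes "k < length (snd P)" and "ptrans P k a = Some (l, us)"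
  shows "l < length (snd P)" "us \<in> updates rank (pbase P k) (pbase P l)"
proof -
  have "F a (\<nu> k) = Some (\<nu> l, us)" using assms by (simp add: step_P)
  note * = step_spec[OF this]
  show l: "l < length (snd P)" using *(2) by (simp add: states_iff)
  show "us \<in> updates rank (pbase P k) (pbase P l)" using *(3) base_P assms(1) l by simp
qed

lemma pfin_updates:
  assumes "k < length (snd P)" and "pfin P k = Some us"
  shows "us \<in> updates rank (pbase P k) (Arity 0)"
proof -
  have "E (\<nu> k) = Some ((), us)" using assms by (simp add: final_P)
  from final_spec(2)[OF this] show ?thesis using base_P assms(1) by simp
qed

lemma init_updates:
  assumes "fst P = Some (j, us)"
  shows "j < length (snd P)" "us \<in> updates rank Init (pbase P j)"
proof -
  have "I () = Some (\<nu> j, us)" using assms by (simp add: init_P)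
  note * = specifies_updates[OF spec_init this]
  show j: "j < length (snd P)" using *(2) by (simp add: states_iff)
  show "us \<in> updates rank Init (pbase P j)" using *(3) base_P j by (simp add: start_space_def)
qed

lemma pstep_apply:
  assumes "k < length (snd P)" and "sum_list (map holes u) = width (pbase P k)"
  shows "pstep P a (Some (k, u)) = map_option (\<lambda>(l, us). (l, fills u us)) (ptrans P k a)"
proof (cases "ptrans P k a")
  case (Some y)
  obtain l us where y: "y = (l, us)" by fastforce
  have "length us = width (pbase P k)"
    using updates_props(1)[OF ptrans_updates(2)[OF assms(1) Some[unfolded y]]] .
  with Some assms(2) show ?thesis by (simp add: pstep_def pextend_def graft_def y)
qed (simp add: pstep_def pextend_def)

lemma pend_apply:
  assumes "k < length (snd P)" and "sum_list (map holes u) = width (pbase P k)"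
  shows "pend P (Some (k, u)) = map_option (fills u) (pfin P k)"
  using updates_props(1)[OF pfin_updates[OF assms(1)]] assms(2)
  by (cases "pfin P k") (simp_all add: pend_def graft_def)

text \<open>The forest \<open>u\<close> stays a left factor throughout: each transition composes its
  update on the right, and \<open>fills_fills\<close> regroups the product.\<close>

lemma pout_forest:
  assumes "k < length (snd P)" and "sum_list (map holes u) = width (pbase P k)"
  shows "pend P (psteps P v (Some (k, u))) = map_option (fills u) (out (\<nu> k) v)"
  using assms
proof (induction v arbitrary: k u)
  case Nil
  then show ?case by (simp add: pend_apply final_P option.map_comp comp_def)
next
  case (Cons a v)
  show ?case
  proof (cases "ptrans P k a")
    case None
    then show ?thesis
      using Cons.prems by (simp add: psteps_Cons pstep_apply step_P pend_def)
  next
    case (Some y)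
    obtain l us where y: "ptrans P k a = Some (l, us)" using Some by (cases y) simp
    note us = ptrans_updates[OF Cons.prems(1) y]
    note len = updates_props(1)[OF us(2)]
    have "sum_list (map holes (fills u us)) = width (pbase P l)"
      using updates_props(3)[OF us(2)] len Cons.prems(2) by (simp add: holes_fills)
    from Cons.IH[OF us(1) this] show ?thesis
      using Cons.prems len
      by (simp add: psteps_Cons pstep_apply step_P y option.map_comp comp_def fills_fills)
  qed
qed

lemma pout_out:
  assumes "k < length (snd P)"
  shows "pout P v k = out (\<nu> k) v"
proof -
  have "pout P v k = map_option (fills (identity (pbase P k))) (out (\<nu> k) v)"
    unfolding pout_def
    by (rule pout_forest) (simp_all add: assms identity_def sum_list_replicate)
  moreover have "fills (identity (pbase P k)) us = us" if "out (\<nu> k) v = Some us" for us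
    using out_length[OF that] base_P[OF assms] by (simp add: identity_def fills_Holes)
  ultimately show ?thesis by (cases "out (\<nu> k) v") simp_all
qed

text \<open>The invariant that keeps every \<open>graft\<close> along a run defined. The length one
  stems from the initial type.\<close>

lemma psteps_init:
  "psteps P w (fst P) = Some (k, us) \<Longrightarrow>
    k < length (snd P) \<and> length us = 1 \<and> sum_list (map holes us) = width (pbase P k)"
proof (induction w arbitrary: k us rule: rev_induct)
  case Nil
  then show ?case
    using init_updates[of k us] updates_props[of us rank Init "pbase P k"] by simp
next
  case (snoc a w)
  then obtain l vs where y: "psteps P w (fst P) = Some (l, vs)"
    by (cases "psteps P w (fst P)") (auto simp: psteps_snoc pstep_def)
  note inv = snoc.IH[OF y]
  obtain ws where ws: "ptrans P l a = Some (k, ws)" "us = fills vs ws"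
    using snoc.prems inv by (auto simp: psteps_snoc y pstep_apply)
  have len: "length ws = sum_list (map holes vs)"
    using updates_props(1)[OF ptrans_updates(2)[OF _ ws(1)]] inv by simp
  then show ?case
    using inv ws ptrans_updates[OF _ ws(1)] updates_props(3)[OF ptrans_updates(2)[OF _ ws(1)]]
    by (simp add: holes_fills)
qed

lemma run_psteps: "run A w = map_option (\<lambda>(k, us). (\<nu> k, hd us)) (psteps P w (fst P))"
proof (induction w rule: rev_induct)
  case Nil
  show ?case by (simp add: run_Nil_spec init_P option.map_comp comp_def case_prod_unfold)
next
  case (snoc a w)
  show ?case
  proof (cases "psteps P w (fst P)")
    case None
    then show ?thesis using snoc.IH by (simp add: run_snoc psteps_snoc pstep_def)
  next
    case (Some y)
    obtain k us where y: "psteps P w (fst P) = Some (k, us)" using Some by (cases y) simp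
    note inv = psteps_init[OF y]
    then obtain d where us: "us = [d]" by (auto simp: length_Suc_conv)
    have run: "run A w = Some (\<nu> k, d)" using snoc.IH by (simp add: y us)
    have "fill d (take (holes d) vs) = fill d vs" for vs
      by (simp add: fill_take)
    then show ?thesis
      unfolding run_snoc_spec[OF run] psteps_snoc y
      using inv by (cases "ptrans P k a") (auto simp: pstep_apply step_P us)
  qed
qed

end

lemma presents_presented:
  assumes "presents rank P A"
  obtains I F E \<nu> where "presented rank A I F E P \<nu>"
proof -
  obtain \<nu> I F E where *: "is_transducer rank A" "inj \<nu>" "states A = \<nu> ` {..<length (snd P)}"
    "specifies rank start_space (space A) I (delta_init A)"
    "\<forall>a. specifies rank (space A) (space A) (F a) (delta A a)"
    "specifies rank (space A) end_space E (delta_final A)"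
    "I () = map_option (\<lambda>(j, us). (\<nu> j, us)) (fst P)"
    "\<forall>k<length (snd P). case snd P ! k of (b, cs, tr, fin) \<Rightarrow>
       fst (state_ty A (\<nu> k)) = b \<and>
       (\<forall>a. F a (\<nu> k) = map_option (\<lambda>(j, us). (\<nu> j, us)) (map_of tr a)) \<and>
       E (\<nu> k) = map_option (Pair ()) fin"
    using assms unfolding presents_def by (cases P) (fastforce split: prod.splits)
  have eq: "(\<lambda>p. (\<nu> (fst p), snd p)) = map_prod \<nu> id" by auto
  have "presented rank A I F E P \<nu>"
    using *(1-6) *(7,8)[unfolded case_prod_unfold eq]
    by unfold_locales (simp_all add: ptrans_def ptable_def pfin_def pbase_def pdesc_def)
  then show ?thesis by (rule that)
qed

text \<open>An injection of the numbers into the infinite type \<open>'q\<close> names the states.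
  Well-formedness makes the tables specify transformations, all types being unconstrained.\<close>

lemma wf_pres_presents:
  fixes Q :: "('a, 'g) presentation"
  assumes "wf_pres al rk Q" and rk: "set rk = range (\<lambda>g. (g, rank g))"
    and "infinite (UNIV :: 'q set)"
  shows "\<exists>(M :: ('q, 'a, 'g) transducer) I F E \<nu>. presented rank M I F E Q \<nu> \<and> presents rank Q M \<and>
    (\<forall>q\<in>states M. \<exists>n. state_ty M q = (Arity n, {}))"
proof -
  obtain \<nu> :: "nat \<Rightarrow> 'q" where \<nu>: "inj \<nu>"
    using assms(3) infinite_countable_subset by blast
  let ?n = "length (snd Q)"
  let ?k = "inv \<nu>"
  have k: "?k (\<nu> j) = j" for j using \<nu> by simp
  define X :: "('q, 'g) space" where "X = (\<nu> ` {..<?n}, \<lambda>q. (pbase Q (?k q), {}))"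
  define I where "I = (\<lambda>_ :: unit. map_option (map_prod \<nu> id) (fst Q))"
  define F where "F a q = (if q \<in> \<nu> ` {..<?n} then map_option (map_prod \<nu> id) (ptrans Q (?k q) a) else None)"
    for a q
  define E where "E q = (if q \<in> \<nu> ` {..<?n} then map_option (Pair ()) (pfin Q (?k q)) else None)" for q
  define M :: "('q, 'a, 'g) transducer" where
    "M = \<lparr>states = fst X, state_ty = snd X, delta_init = realize rank start_space I,
       delta = (\<lambda>a. realize rank X (F a)), delta_final = realize rank X E\<rparr>"
  have sp: "space M = X" by (simp add: space_def M_def)
  have base: "\<exists>n. pbase Q j = Arity n" if "j < ?n" for j
    using assms(1) that by (cases "pbase Q j") (auto simp: wf_pres_def)
  have upd: "us \<in> updates rank b (pbase Q j)" if "target_ok rk Q b (j, us)" for b j us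
    using that base[of j] upd_ok_iff(1)[OF rk] by (auto simp: target_ok_def)
  have trans: "target_ok rk Q (pbase Q j) y" if "j < ?n" "ptrans Q j a = Some y" for j a y
    using assms(1) that map_of_SomeD[of "ptable Q j" a y] by (fastforce simp: wf_pres_def ptrans_def)
  have init: "specifies rank start_space X I (realize rank start_space I)"
  proof (rule specifies_realize)
    fix p q us assume "I p = Some (q, us)"
    then obtain j where j: "fst Q = Some (j, us)" "q = \<nu> j" by (auto simp: I_def)
    then have ok: "target_ok rk Q Init (j, us)" using assms(1) by (simp add: wf_pres_def)
    with upd[OF ok] j show "p \<in> fst start_space \<and> q \<in> fst X \<and>
        us \<in> updates rank (fst (snd start_space p)) (fst (snd X q)) \<and> snd (snd X q) = {}"
      by (auto simp: start_space_def X_def k target_ok_def)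
  qed
  have step: "specifies rank X X (F a) (realize rank X (F a))" for a
  proof (rule specifies_realize)
    fix p q us assume "F a p = Some (q, us)"
    then obtain i j where j: "p = \<nu> i" "i < ?n" "ptrans Q i a = Some (j, us)" "q = \<nu> j"
      by (auto simp: F_def k split: if_splits)
    note ok = trans[OF j(2,3)]
    with upd[OF ok] j show "p \<in> fst X \<and> q \<in> fst X \<and>
        us \<in> updates rank (fst (snd X p)) (fst (snd X q)) \<and> snd (snd X q) = {}"
      by (auto simp: X_def k target_ok_def)
  qed
  have final: "specifies rank X end_space E (realize rank X E)"
  proof (rule specifies_realize)
    fix p q us assume "E p = Some (q, us)"
    then obtain i where j: "p = \<nu> i" "i < ?n" "pfin Q i = Some us"
      by (auto simp: E_def k split: if_splits)
    then have "upd_ok rk us (pbase Q i) (Arity 0)" using assms(1) by (fastforce simp: wf_pres_def)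
    then show "p \<in> fst X \<and> q \<in> fst end_space \<and>
        us \<in> updates rank (fst (snd X p)) (fst (snd end_space q)) \<and> snd (snd end_space q) = {}"
      using j upd_ok_iff(1)[OF rk] by (simp add: X_def k end_space_def)
  qed
  have transd: "is_transducer rank M"
    unfolding is_transducer_def transformation_def sp
    using init step final by (auto simp: M_def X_def is_ty_def)
  have pres: "presented rank M I F E Q \<nu>"
    using transd init step final \<nu>
    by unfold_locales (simp_all add: sp k, simp_all add: M_def X_def I_def F_def E_def k)
  have eq: "(\<lambda>(j, us). (\<nu> j, us)) = map_prod \<nu> id" by auto
  have desc: "case snd Q ! j of (b, cs, tr, fin) \<Rightarrow>
      is_ty rank (b, set cs) \<and>
      fst (state_ty M (\<nu> j)) = b \<and> ty_dom rank (state_ty M (\<nu> j)) = ty_dom rank (b, set cs) \<and>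
      (\<forall>a. F a (\<nu> j) = map_option (\<lambda>(j, us). (\<nu> j, us)) (map_of tr a)) \<and>
      E (\<nu> j) = map_option (Pair ()) fin" if j: "j < ?n" for j
  proof -
    obtain b cs tr fin where d: "snd Q ! j = (b, cs, tr, fin)" by (cases "snd Q ! j") auto
    then have "cs = []" using assms(1) j by (auto simp: wf_pres_def pdesc_def)
    then show ?thesis
      using j unfolding d prod.case eq
      by (simp add: is_ty_def M_def X_def k F_def E_def ptrans_def ptable_def pfin_def pbase_def pdesc_def d)
  qed
  have "presents rank Q M"
    unfolding presents_def case_prod_unfold
  proof (intro conjI exI[of _ \<nu>] exI[of _ I] exI[of _ F] exI[of _ E] transd \<nu>)
    show "states M = \<nu> ` {..<length (snd Q)}" by (simp add: M_def X_def)
    show "I () = map_option (\<lambda>p. (\<nu> (fst p), snd p)) (fst Q)"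
      by (simp add: I_def map_prod_def case_prod_unfold)
    show "\<forall>k<length (snd Q).
       is_ty rank (fst (snd Q ! k), set (fst (snd (snd Q ! k)))) \<and>
       fst (state_ty M (\<nu> k)) = fst (snd Q ! k) \<and>
       ty_dom rank (state_ty M (\<nu> k)) =
       ty_dom rank (fst (snd Q ! k), set (fst (snd (snd Q ! k)))) \<and>
       (\<forall>a. F a (\<nu> k) = map_option (\<lambda>p. (\<nu> (fst p), snd p)) (map_of (fst (snd (snd (snd Q ! k)))) a)) \<and>
       E (\<nu> k) = map_option (Pair ()) (snd (snd (snd (snd Q ! k))))"
      using desc by (simp add: case_prod_unfold)
  qed (use init step final in \<open>simp_all add: sp, simp_all add: M_def\<close>)
  moreover have "\<exists>n. state_ty M q = (Arity n, {})" if "q \<in> states M" for q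
    using that base by (auto simp: M_def X_def k)
  ultimately show ?thesis using pres by blast
qed

text \<open>A certificate has the form \<open>(Q, f, D, V)\<close>, from which the search returns
  the first component. The last conjunct allows the test words to be renamed back.\<close>

definition check :: "'a list \<Rightarrow> ('g \<times> nat) list \<Rightarrow> ('a, 'g) presentation \<Rightarrow>
    ('a, 'g) presentation \<times> (nat \<times> 'g target) list \<times> nat list \<times> 'a list list \<Rightarrow> bool" where
  "check al rk P y \<longleftrightarrow> wf_pres al rk (fst y) \<and>
     sim_ok al rk P (fst y) (fst (snd y)) (fst (snd (snd y))) \<and> tests_ok (fst y) (snd (snd (snd y))) \<and>
     (\<forall>w\<in>set (snd (snd (snd y))). \<forall>a\<in>set w. a \<in> set al)"

section \<open>Soundness of certificates\<close>

lemma link_Some: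
  assumes "link f D (Some (l, us)) y"
  obtains "l \<in> set D" "y = None"
  | m u where "map_of f l = Some (m, u)" "length u = sum_list (map holes us)" "y = Some (m, fills us u)"
  using assms by (auto simp: link_def pextend_def graft_def split: option.splits if_splits)

locale checked = B: presented rank B I' F' E' P \<mu> + M: presented rank M I F E Q \<nu>
  for rank :: "'g \<Rightarrow> nat" and B :: "('p, 'a, 'g) transducer" and I' F' E'
    and P :: "('a, 'g) presentation" and \<mu>
    and M :: "('q, 'a, 'g) transducer" and I F E and Q :: "('a, 'g) presentation" and \<nu> +
  fixes al rk f D V
  assumes check: "check al rk P (Q, f, D, V)"
    and letters: "set al = UNIV"
    and types: "q \<in> states M \<Longrightarrow> \<exists>n. state_ty M q = (Arity n, {})"
begin

lemma f_entry:
  assumes "map_of f k = Some (j, u)"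
  shows "k < length (snd P)" "j < length (snd Q)" "length u = width (pbase P k)"
    "sum_list (map holes u) = width (pbase Q j)" "pfin P k = map_option (fills u) (pfin Q j)"
    "link f D (ptrans P k a) (map_option (\<lambda>(l, us). (l, fills u us)) (ptrans Q j a))"
proof -
  have "(k, j, u) \<in> set f" using assms by (rule map_of_SomeD)
  then have *: "k < length (snd P)" "target_ok rk Q (pbase P k) (j, u)"
    "pfin P k = pend Q (Some (j, u))" "link f D (ptrans P k a) (pstep Q a (Some (j, u)))"
    using check letters unfolding check_def sim_ok_def by auto
  then show 1: "k < length (snd P)" "j < length (snd Q)" "length u = width (pbase P k)"
    "sum_list (map holes u) = width (pbase Q j)"
    by (simp_all add: target_ok_def upd_ok_def)
  show "pfin P k = map_option (fills u) (pfin Q j)"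
    "link f D (ptrans P k a) (map_option (\<lambda>(l, us). (l, fills u us)) (ptrans Q j a))"
    using *(3,4) M.pend_apply[OF 1(2,4)] M.pstep_apply[OF 1(2,4)] by simp_all
qed

lemma D_entry:
  assumes "k \<in> set D"
  shows "k < length (snd P)" "pfin P k = None" "ptrans P k a = Some (l, us) \<Longrightarrow> l \<in> set D"
proof -
  have *: "k < length (snd P)" "pfin P k = None"
    "case ptrans P k a of None \<Rightarrow> True | Some y \<Rightarrow> fst y \<in> set D" for a
    using assms check letters unfolding check_def sim_ok_def fst_conv snd_conv by auto
  show "k < length (snd P)" "pfin P k = None" by (fact *)+
  show "ptrans P k a = Some (l, us) \<Longrightarrow> l \<in> set D" using *(3)[of a] by simp
qed

definition agree :: "('p \<times> 'g trm) option \<Rightarrow> ('q \<times> 'g trm) option \<Rightarrow> bool" where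
  "agree x y \<longleftrightarrow> (case x of None \<Rightarrow> y = None | Some (q, d) \<Rightarrow>
     (\<exists>k j u. q = \<mu> k \<and> map_of f k = Some (j, u) \<and> y = Some (\<nu> j, fill d u)) \<or>
     (\<exists>k\<in>set D. q = \<mu> k \<and> y = None))"

text \<open>The links carry the invariant across each letter, from a table entry to a table entry or
  into \<open>D\<close>; inside \<open>D\<close> it persists by closure. It starts with the link
  between the initial transitions.\<close>

lemma agree_run: "agree (run B w) (run M w)"
proof (induction w rule: rev_induct)
  case Nil
  have link: "link f D (fst P) (fst Q)" using check by (simp add: check_def sim_ok_def)
  show ?case
  proof (cases "fst P")
    case None
    then show ?thesis
      using link by (simp add: link_def B.run_Nil_spec M.run_Nil_spec B.init_P M.init_P agree_def)
  next
    case (Some x)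
    obtain l us where x: "fst P = Some (l, us)" using Some by (cases x) simp
    obtain d where d: "us = [d]"
      using updates_props(1)[OF B.init_updates(2)[OF x]] by (auto simp: length_Suc_conv)
    have run: "run B [] = Some (\<mu> l, d)" by (simp add: B.run_Nil_spec B.init_P x d)
    show ?thesis
      using link[unfolded x]
    proof (cases rule: link_Some)
      case 1
      then show ?thesis by (auto simp: run M.run_Nil_spec M.init_P agree_def)
    next
      case (2 m u)
      then have "run M [] = Some (\<nu> m, fill d u)"
        by (simp add: M.run_Nil_spec M.init_P d fill_take)
      then show ?thesis using 2 by (auto simp: run agree_def)
    qed
  qed
next
  case (snoc a w)
  show ?case
  proof (cases "run B w")
    case None
    then show ?thesis using snoc by (simp add: agree_def run_snoc)
  next
    case (Some x)
    obtain q d where q: "run B w = Some (q, d)" using Some by (cases x) simp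
    consider k j u where "q = \<mu> k" "map_of f k = Some (j, u)" "run M w = Some (\<nu> j, fill d u)"
      | k where "k \<in> set D" "q = \<mu> k" "run M w = None"
      using snoc by (auto simp: agree_def q)
    then show ?thesis
    proof cases
      case 1
      note f = f_entry[OF 1(2)]
      have hd: "holes d = width (pbase P k)"
        using B.run_holes[OF q] B.base_P[OF f(1)] 1(1) by simp
      have runM: "run M (w @ [a]) = map_option (\<lambda>(l, us). (\<nu> l, fill (fill d u) us)) (ptrans Q j a)"
        using M.run_snoc_spec[OF 1(3), of a] f(2)
        by (simp add: M.step_P option.map_comp comp_def case_prod_unfold)
      have runB: "run B (w @ [a]) = map_option (\<lambda>(l, us). (\<mu> l, fill d us)) (ptrans P k a)"
        using B.run_snoc_spec[OF q, of a] f(1) 1(1)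
        by (simp add: B.step_P option.map_comp comp_def case_prod_unfold)
      show ?thesis
      proof (cases "ptrans P k a")
        case None
        then have "ptrans Q j a = None" using f(6)[of a] by (simp add: link_def)
        with None show ?thesis by (simp add: runM runB agree_def)
      next
        case (Some y)
        obtain l us where y: "ptrans P k a = Some (l, us)" using Some by (cases y) simp
        have len: "length us = holes d"
          using updates_props(1)[OF B.ptrans_updates(2)[OF f(1) y]] hd by simp
        show ?thesis
          using f(6)[of a, unfolded y]
        proof (cases rule: link_Some)
          case 1
          then show ?thesis by (auto simp: runM runB y agree_def)
        next
          case (2 m u')
          then obtain vs where vs: "ptrans Q j a = Some (m, vs)" "fills us u' = fills u vs" by auto
          have "fill (fill d u) vs = fill (fill d us) u'"
            using len hd f(3) vs(2) by (simp add: fill_fill)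
          then show ?thesis using 2 vs(1) by (auto simp: runM runB y agree_def)
        qed
      qed
    next
      case 2
      have "run M (w @ [a]) = None" using 2(3) by (simp add: run_snoc)
      moreover have "run B (w @ [a]) = map_option (\<lambda>(l, us). (\<mu> l, fill d us)) (ptrans P k a)"
        using B.run_snoc_spec[OF q, of a] D_entry(1)[OF 2(1)] 2(2)
        by (simp add: B.step_P option.map_comp comp_def case_prod_unfold)
      ultimately show ?thesis
        using D_entry(3)[OF 2(1)] by (cases "ptrans P k a") (auto simp: agree_def)
    qed
  qed
qed

lemma transduction_eq: "transduction M = transduction B"
proof
  fix w
  show "transduction M w = transduction B w"
  proof (cases "run B w")
    case None
    then have "run M w = None" using agree_run[of w] by (simp add: agree_def)
    then have "transduction M (w @ []) = None" "transduction B (w @ []) = None"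
      using None M.run_prefix_defined B.run_prefix_defined by blast+
    then show ?thesis by simp
  next
    case (Some x)
    obtain q d where q: "run B w = Some (q, d)" using Some by (cases x) simp
    note tB = B.transduction_out[OF q, of "[]"]
    consider k j u where "q = \<mu> k" "map_of f k = Some (j, u)" "run M w = Some (\<nu> j, fill d u)"
      | k where "k \<in> set D" "q = \<mu> k" "run M w = None"
      using agree_run[of w] by (auto simp: agree_def q)
    then show ?thesis
    proof cases
      case 1
      note f = f_entry[OF 1(2)]
      have "length u = holes d"
        using B.run_holes[OF q] B.base_P[OF f(1)] 1(1) f(3) by simp
      then have "transduction M w = map_option (\<lambda>us. fill d (fills u us)) (pfin Q j)"
        using M.transduction_out[OF 1(3), of "[]"] f(2)
        by (simp add: M.final_P option.map_comp comp_def fill_fill)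
      then show ?thesis
        using tB f(1,5) 1(1) by (simp add: B.final_P option.map_comp comp_def)
    next
      case 2
      then have "transduction M (w @ []) = None" using M.run_prefix_defined by blast
      then show ?thesis using tB D_entry(1,2)[OF 2(1)] 2(2) by (simp add: B.final_P)
    qed
  qed
qed

text \<open>Apart from the types, each condition asks for words that witness something, and
  \<open>V\<close> contains them; \<open>pout_out\<close> turns the computed outputs into those of
  \<open>M\<close>.\<close>

lemma reduced: "reduced rank M I F E"
proof unfold_locales
  have tests: "tests_ok Q V" using check by (simp add: check_def)
  fix q assume q: "q \<in> states M"
  then obtain j where j: "q = \<nu> j" "j < length (snd Q)" by (auto simp: M.states_\<nu>)
  note out = M.pout_out[OF j(2), folded j(1)]
  show "\<exists>n. state_ty M q = (Arity n, {})" using types[OF q] .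
  obtain w where "map_option fst (psteps Q w (fst Q)) = Some j"
    using tests j(2) unfolding tests_ok_def by blast
  then obtain us where "psteps Q w (fst Q) = Some (j, us)" by auto
  then have "run M w = Some (q, hd us)" using M.run_psteps[of w] j(1) by simp
  then show "\<exists>w d. run M w = Some (q, d)" by blast
  show "\<exists>v. M.out q v \<noteq> None"
    using tests j(2) out unfolding tests_ok_def by metis
  show "spread (M.wd q) (dom (M.out q)) (\<lambda>v. the (M.out q v))"
    unfolding spread_def
  proof (intro conjI ballI allI impI)
    show "length (the (M.out q v)) = M.wd q" if "v \<in> dom (M.out q)" for v
      using that M.out_length[of v q] by auto
    fix i assume "i < M.wd q"
    then have "i < width (pbase Q j)" using M.base_P[OF j(2)] j(1) by simp
    then obtain v w where vw: "nth_root (pout Q v j) i \<noteq> None" "nth_root (pout Q w j) i \<noteq> None"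
      "nth_root (pout Q v j) i \<noteq> nth_root (pout Q w j) i"
      using tests j(2) unfolding tests_ok_def by blast
    then have "v \<in> dom (M.out q)" "w \<in> dom (M.out q)"
      "root_symbol (the (M.out q v) ! i) \<noteq> root_symbol (the (M.out q w) ! i)"
      unfolding out nth_root_def by (auto split: option.splits if_splits)
    then show "\<exists>v\<in>dom (M.out q). \<exists>w\<in>dom (M.out q).
        root_symbol (the (M.out q v) ! i) \<noteq> root_symbol (the (M.out q w) ! i)" by blast
  qed
  fix p assume "p \<in> states M" and eq: "M.out q = M.out p"
  then obtain i where i: "p = \<nu> i" "i < length (snd Q)" by (auto simp: M.states_\<nu>)
  have "pout Q v j = pout Q v i" for v
    using fun_cong[OF eq, of v] M.pout_out[OF i(2)] out i(1) by simp
  then have "j = i" using tests j(2) i(2) unfolding tests_ok_def by blast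
  then show "q = p" using i j by simp
qed

end

theorem check_sound:
  fixes A :: "('q, 'a, 'g) transducer"
  assumes "infinite (UNIV :: 'q set)" and "presents rank P A" and "check al rk P (Q, f, D, V)"
    and "set al = UNIV" and "set rk = range (\<lambda>g. (g, rank g))"
  shows "\<exists>M :: ('q, 'a, 'g) transducer. presents rank Q M \<and>
    algebraically_minimal rank (live_transducers_for rank (transduction A)) M"
proof -
  obtain I' F' E' \<mu> where A: "presented rank A I' F' E' P \<mu>"
    using presents_presented[OF assms(2)] .
  obtain M :: "('q, 'a, 'g) transducer" and I F E \<nu> where
    M: "presented rank M I F E Q \<nu>" "presents rank Q M" "\<forall>q\<in>states M. \<exists>n. state_ty M q = (Arity n, {})"
    using wf_pres_presents[OF _ assms(5,1)] assms(3) unfolding check_def fst_conv by blast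
  interpret checked rank A I' F' E' P \<mu> M I F E Q \<nu> al rk f D V
    using A M(1,3) assms(3,4) by (simp add: checked_def checked_axioms_def)
  show ?thesis
    using reduced_minimal[OF assms(1) reduced] M(2) transduction_eq by metis
qed

section \<open>Existence of certificates\<close>

text \<open>All states are reachable, hence inhabited, and cancelling a reached term recovers the
  output family from the transduction. So it does not depend on the choice of \<open>I\<close>,
  \<open>F\<close>, \<open>E\<close>; a presentation of \<open>M\<close> brings its own
  choice.\<close>

lemma reduced_respecified:
  assumes "reduced rank M I F E" and "specified rank M I' F' E'"
  shows "reduced rank M I' F' E'"
proof -
  interpret M: reduced rank M I F E by (rule assms(1))
  interpret M': specified rank M I' F' E' by (rule assms(2))
  have out: "M'.out q = M.out q" if q: "q \<in> states M" for q
  proof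
    fix v
    obtain w d where w: "run M w = Some (q, d)" using M.reachable[OF q] by blast
    have "map_option (fill d) (M'.out q v) = map_option (fill d) (M.out q v)"
      using M.transduction_out[OF w, of v] M'.transduction_out[OF w, of v] by simp
    then show "M'.out q v = M.out q v"
      using M.out_length[of v q] M'.out_length[of v q] M.run_holes[OF w]
        fill_inject(1)[of "the (M'.out q v)" d "the (M.out q v)"]
      by (cases "M.out q v"; cases "M'.out q v") auto
  qed
  show ?thesis
  proof unfold_locales
    fix q p assume q: "q \<in> states M" and p: "p \<in> states M" and "M'.out q = M'.out p"
    then show "q = p" using M.distinguished[OF q p] out by simp
  next
    fix q assume q: "q \<in> states M"
    show "\<exists>v. M'.out q v \<noteq> None" using M.productive[OF q] out[OF q] by metis
    show "spread (M'.wd q) (dom (M'.out q)) (\<lambda>v. the (M'.out q v))"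
      using M.spread_out[OF q] unfolding out[OF q] out[OF q, THEN fun_cong] .
  qed (rule M.reachable M.unconstrained, assumption)+
qed

text \<open>A presentation may list constraints, and table entries shadowed by earlier ones, which
  need not be updates. Well-formedness speaks about all entries, so the table is rebuilt from the
  effective ones.\<close>

definition normalize :: "'a list \<Rightarrow> ('a, 'g) presentation \<Rightarrow> ('a, 'g) presentation" where
  "normalize al P = (fst P, map (\<lambda>k. (pbase P k, [],
     map (\<lambda>a. (a, the (ptrans P k a))) (filter (\<lambda>a. ptrans P k a \<noteq> None) al), pfin P k)) [0..<length (snd P)])"

lemma normalize_simps:
  "fst (normalize al P) = fst P" "length (snd (normalize al P)) = length (snd P)"
  "k < length (snd P) \<Longrightarrow> pbase (normalize al P) k = pbase P k"
  "k < length (snd P) \<Longrightarrow> pfin (normalize al P) k = pfin P k"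
  "k < length (snd P) \<Longrightarrow> fst (snd (pdesc (normalize al P) k)) = []"
  "k < length (snd P) \<Longrightarrow> e \<in> set (ptable (normalize al P) k) \<Longrightarrow>
     fst e \<in> set al \<and> ptrans P k (fst e) = Some (snd e)"
  "k < length (snd P) \<Longrightarrow> set al = UNIV \<Longrightarrow> ptrans (normalize al P) k a = ptrans P k a"
proof -
  have *: "pdesc (normalize al P) k = (pbase P k, [],
     map (\<lambda>a. (a, the (ptrans P k a))) (filter (\<lambda>a. ptrans P k a \<noteq> None) al), pfin P k)"
    if "k < length (snd P)" for k
    using that by (simp add: pdesc_def normalize_def)
  show "fst (normalize al P) = fst P" "length (snd (normalize al P)) = length (snd P)"
    by (simp_all add: normalize_def)
  assume k: "k < length (snd P)"
  show "pbase (normalize al P) k = pbase P k" by (simp add: * k pbase_def[of "normalize al P"])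
  show "pfin (normalize al P) k = pfin P k" by (simp add: * k pfin_def[of "normalize al P"])
  show "fst (snd (pdesc (normalize al P) k)) = []" by (simp add: * k)
  show "e \<in> set (ptable (normalize al P) k) \<Longrightarrow> fst e \<in> set al \<and> ptrans P k (fst e) = Some (snd e)"
    by (auto simp: * k ptable_def[of "normalize al P"])
  have "ptable (normalize al P) k =
      map (\<lambda>a. (a, the (ptrans P k a))) (filter (\<lambda>a. ptrans P k a \<noteq> None) al)"
    unfolding ptable_def[of "normalize al P"] *[OF k] by simp
  then have "ptrans (normalize al P) k a =
      (if a \<in> set (filter (\<lambda>a. ptrans P k a \<noteq> None) al) then Some (the (ptrans P k a)) else None)"
    unfolding ptrans_def[of "normalize al P"] by (simp add: map_of_map_restrict restrict_map_def)
  then show "set al = UNIV \<Longrightarrow> ptrans (normalize al P) k a = ptrans P k a"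
    by (cases "ptrans P k a") simp_all
qed

lemma (in presented) presented_normalize:
  assumes "set al = UNIV"
  shows "presented rank A I F E (normalize al P) \<nu>"
  using inj_\<nu> states_\<nu> init_P step_P final_P base_P assms
  by unfold_locales (simp_all add: normalize_simps)

text \<open>Being reduced provides witness words for each state, each component of a state and each
  pair of states; for a presentation these are finitely many.\<close>

lemma finite_tests:
  assumes "reduced rank M I F E" and "presented rank M I F E Q \<nu>"
  shows "\<exists>V. tests_ok Q V"
proof -
  interpret reduced rank M I F E by (rule assms(1))
  interpret presented rank M I F E Q \<nu> by (rule assms(2))
  let ?n = "length (snd Q)"
  have st: "\<nu> j \<in> states M" if "j < ?n" for j using that by (simp add: states_iff)
  have "\<exists>w. map_option fst (psteps Q w (fst Q)) = Some j" if j: "j < ?n" for j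
  proof -
    obtain w d where "run M w = Some (\<nu> j, d)" using reachable[OF st[OF j]] by blast
    then obtain k us where "psteps Q w (fst Q) = Some (k, us)" "\<nu> k = \<nu> j"
      using run_psteps[of w] by auto
    then show ?thesis using inj_\<nu> by (auto simp: inj_eq)
  qed
  then obtain r where r: "\<And>j. j < ?n \<Longrightarrow> map_option fst (psteps Q (r j) (fst Q)) = Some j" by metis
  have "\<exists>v. pout Q v j \<noteq> None" if "j < ?n" for j
    using productive[OF st[OF that]] pout_out[OF that] by metis
  then obtain p where p: "\<And>j. j < ?n \<Longrightarrow> pout Q (p j) j \<noteq> None" by metis
  have "\<exists>v w. nth_root (pout Q v j) i \<noteq> None \<and> nth_root (pout Q w j) i \<noteq> None \<and>
        nth_root (pout Q v j) i \<noteq> nth_root (pout Q w j) i" if j: "j < ?n" and i': "i < width (pbase Q j)" for i j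
  proof -
    have i: "i < wd (\<nu> j)" using j i' base_P by simp
    then obtain v w where vw: "v \<in> dom (out (\<nu> j))" "w \<in> dom (out (\<nu> j))"
      "root_symbol (the (out (\<nu> j) v) ! i) \<noteq> root_symbol (the (out (\<nu> j) w) ! i)"
      using spread_out[OF st[OF j]] unfolding spread_def by blast
    then obtain us vs where "out (\<nu> j) v = Some us" "out (\<nu> j) w = Some vs" by auto
    then have "nth_root (pout Q v j) i \<noteq> None \<and> nth_root (pout Q w j) i \<noteq> None \<and>
        nth_root (pout Q v j) i \<noteq> nth_root (pout Q w j) i"
      using vw(3) i out_length[of v "\<nu> j" us] out_length[of w "\<nu> j" vs]
      by (simp add: pout_out[OF j] nth_root_def)
    then show ?thesis by blast
  qed
  then obtain s t where s: "\<And>j i. j < ?n \<Longrightarrow> i < width (pbase Q j) \<Longrightarrow>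
      nth_root (pout Q (s j i) j) i \<noteq> None \<and> nth_root (pout Q (t j i) j) i \<noteq> None \<and>
      nth_root (pout Q (s j i) j) i \<noteq> nth_root (pout Q (t j i) j) i" by metis
  have "\<exists>v. pout Q v j \<noteq> pout Q v j'" if "j < ?n" "j' < ?n" "j \<noteq> j'" for j j'
  proof -
    have "\<nu> j \<noteq> \<nu> j'" using that(3) inj_\<nu> by (simp add: inj_eq)
    then have "out (\<nu> j) \<noteq> out (\<nu> j')" using distinguished st that by blast
    then show ?thesis using pout_out that by (metis ext)
  qed
  then obtain d where d: "\<And>j j'. j < ?n \<Longrightarrow> j' < ?n \<Longrightarrow> j \<noteq> j' \<Longrightarrow> pout Q (d j j') j \<noteq> pout Q (d j j') j'"
    by metis
  let ?W = "r ` {..<?n} \<union> p ` {..<?n} \<union> (\<Union>j<?n. s j ` {..<width (pbase Q j)} \<union> t j ` {..<width (pbase Q j)})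
    \<union> (\<Union>j<?n. d j ` {..<?n})"
  have "finite ?W" by simp
  from finite_list[OF this] obtain V where V: "set V = ?W" ..
  have "tests_ok Q V"
    unfolding tests_ok_def
  proof (intro allI impI conjI)
    fix j assume j: "j < ?n"
    show "\<exists>w\<in>set V. map_option fst (psteps Q w (fst Q)) = Some j"
    proof (rule bexI[of _ "r j"], rule r[OF j])
      show "r j \<in> set V" unfolding V using j by simp
    qed
    show "\<exists>v\<in>set V. pout Q v j \<noteq> None"
    proof (rule bexI[of _ "p j"], rule p[OF j])
      show "p j \<in> set V" unfolding V using j by simp
    qed
    show "\<exists>v\<in>set V. \<exists>w\<in>set V. nth_root (pout Q v j) i \<noteq> None \<and> nth_root (pout Q w j) i \<noteq> None \<and>
        nth_root (pout Q v j) i \<noteq> nth_root (pout Q w j) i" if i: "i < width (pbase Q j)" for i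
    proof (rule bexI[of _ "s j i"], rule bexI[of _ "t j i"], rule s[OF j i])
      show "s j i \<in> set V" "t j i \<in> set V" unfolding V using i j by blast+
    qed
    show "\<exists>v\<in>set V. pout Q v j \<noteq> pout Q v j'" if j': "j' < ?n" "j \<noteq> j'" for j'
    proof (rule bexI[of _ "d j j'"], rule d[OF j j'])
      show "d j j' \<in> set V" unfolding V using j j'(1) by blast
    qed
  qed
  then show ?thesis ..
qed

locale presented_reduction = reduction rank B I' F' E' M I F E +
    B: presented rank B I' F' E' P \<mu> + M: presented rank M I F E Q \<nu>
  for rank :: "'g \<Rightarrow> nat" and B :: "('p, 'a, 'g) transducer" and I' F' E'
    and M :: "('q, 'a, 'g) transducer" and I F E P \<mu> Q \<nu> +
  fixes rk :: "('g \<times> nat) list"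
  assumes rk: "set rk = range (\<lambda>g. (g, rank g))"
begin

definition sim_table :: "(nat \<times> 'g target) list" where
  "sim_table = map (\<lambda>k. (k, inv \<nu> (fst (proj (\<mu> k))), snd (proj (\<mu> k))))
     (filter (\<lambda>k. B.useful (\<mu> k)) [0..<length (snd P)])"

text \<open>Reachability has to be demanded: an unreachable state is not \<open>useful\<close> even
  if it has outputs, and could violate the conditions on dead states.\<close>

definition dead_list :: "nat list" where
  "dead_list = filter (\<lambda>k. (\<exists>w d. run B w = Some (\<mu> k, d)) \<and> \<not> B.useful (\<mu> k)) [0..<length (snd P)]"

lemma map_of_sim_table:
  assumes "k < length (snd P)" and "B.useful (\<mu> k)"
  shows "map_of sim_table k = Some (inv \<nu> (fst (proj (\<mu> k))), snd (proj (\<mu> k)))"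
  using assms by (simp add: sim_table_def map_of_map_restrict)

lemma in_dead_list:
  assumes "run B w = Some (\<mu> k, d)" and "\<not> B.useful (\<mu> k)"
  shows "k \<in> set dead_list"
  using assms B.run_states[OF assms(1)] by (auto simp: dead_list_def B.states_iff)

lemma proj_index:
  assumes "B.useful (\<mu> k)"
  obtains j u where "proj (\<mu> k) = (\<nu> j, u)" "j < length (snd Q)" "inv \<nu> (\<nu> j) = j"
    "u \<in> updates rank (fst (state_ty B (\<mu> k))) (pbase Q j)"
proof -
  obtain m u where mu: "proj (\<mu> k) = (m, u)" by fastforce
  have "m \<in> states M" "u \<in> updates rank (fst (state_ty B (\<mu> k))) (fst (state_ty M m))"
    using proj_run(1)[OF assms] by (auto simp: mu sim_def)
  moreover from this obtain j where "m = \<nu> j" "j < length (snd Q)" by (auto simp: M.states_\<nu>)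
  ultimately show ?thesis using that mu M.base_P M.inj_\<nu> by simp
qed

lemma link_useful:
  assumes "x = Some (l, us)" and "l < length (snd P)" and "B.useful (\<mu> l)"
    and "proj (\<mu> l) = (\<nu> j, u)" and "sum_list (map holes us) = width (pbase P l)"
  shows "link sim_table dead_list x (Some (j, fills us u))"
proof -
  obtain j' u' where *: "proj (\<mu> l) = (\<nu> j', u')" "u' \<in> updates rank (fst (state_ty B (\<mu> l))) (pbase Q j')"
    using proj_index[OF assms(3)] by metis
  then have "length u = width (pbase P l)"
    using updates_props(1)[OF *(2)] assms(2,4) B.base_P by simp
  then show ?thesis
    using assms M.inj_\<nu> by (simp add: link_def map_of_sim_table pextend_def graft_def)
qed

lemma useful_step:
  assumes "F' a q = Some (p, us)" and "B.useful p" and "run B w = Some (q, d)"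
  shows "B.useful q"
proof -
  obtain v where "B.out p v \<noteq> None" using assms(2) by (auto simp: B.useful_def)
  then have "B.out q (a # v) \<noteq> None" using assms(1) by auto
  with assms(3) show ?thesis unfolding B.useful_def by blast
qed

text \<open>The links are the squares for \<open>proj\<close>. Where \<open>M\<close> has no
  transition, \<open>B\<close> can only move into a reachable state that is not useful, hence into
  \<open>dead_list\<close>.\<close>

lemma sim_ok: "sim_ok al rk P Q sim_table dead_list"
  unfolding sim_ok_def
proof (intro conjI ballI)
  show "link sim_table dead_list (fst P) (fst Q)"
  proof (cases "fst Q")
    case None
    then have I: "I () = None" by (simp add: M.init_P)
    show ?thesis
    proof (cases "fst P")
      case (Some x)
      obtain l us where x: "x = (l, us)" by fastforce
      then have I': "I' () = Some (\<mu> l, us)" using Some by (simp add: B.init_P)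
      then have "run B [] = Some (\<mu> l, hd us)" by (simp add: B.run_Nil_spec)
      moreover have "\<not> B.useful (\<mu> l)" by (rule proj_init(2)[OF I I'])
      ultimately have "l \<in> set dead_list" by (rule in_dead_list)
      then show ?thesis by (simp add: link_def Some x None)
    qed (simp add: link_def None)
  next
    case (Some y)
    obtain j vs where y: "fst Q = Some (j, vs)" using Some by (cases y) simp
    then have "I () = Some (\<nu> j, vs)" by (simp add: M.init_P)
    then obtain q us u where q: "I' () = Some (q, us)" "B.useful q" "proj q = (\<nu> j, u)" "fills us u = vs"
      using proj_init(1) by blast
    then obtain l where l: "fst P = Some (l, us)" "q = \<mu> l" by (auto simp: B.init_P)
    show ?thesis
      unfolding y q(4)[symmetric]
      by (rule link_useful[OF l(1)])
        (use q l B.init_updates[OF l(1)] updates_props(3)[OF B.init_updates(2)[OF l(1)]] in simp_all)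
  qed
next
  fix e assume "e \<in> set sim_table"
  then obtain k where k: "k < length (snd P)" "B.useful (\<mu> k)"
    and e': "e = (k, inv \<nu> (fst (proj (\<mu> k))), snd (proj (\<mu> k)))"
    by (auto simp: sim_table_def)
  obtain j u where ju: "proj (\<mu> k) = (\<nu> j, u)" "j < length (snd Q)" "inv \<nu> (\<nu> j) = j"
    "u \<in> updates rank (fst (state_ty B (\<mu> k))) (pbase Q j)"
    using proj_index[OF k(2)] .
  have e: "e = (k, j, u)" using e' ju by simp
  note u = ju(4)[unfolded B.base_P[OF k(1)]]
  show "fst e < length (snd P)" using k(1) by (simp add: e)
  show "target_ok rk Q (pbase P (fst e)) (snd e)"
    using upd_ok_iff(2)[OF rk u] ju(2) by (simp add: e target_ok_def)
  note hu = updates_props(3)[OF u]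
  show "pfin P (fst e) = pend Q (Some (snd e))"
    using proj_final[OF k(2) ju(1)] k(1) ju(2) hu
    by (cases "pfin P k"; cases "pfin Q j") (simp_all add: e M.pend_apply B.final_P M.final_P)
  fix a
  have y: "pstep Q a (Some (snd e)) = map_option (\<lambda>(l, us). (l, fills u us)) (ptrans Q j a)"
    using M.pstep_apply[OF ju(2) hu] by (simp add: e)
  obtain w d where w: "run B w = Some (\<mu> k, d)" using k(2) unfolding B.useful_def by blast
  show "link sim_table dead_list (ptrans P (fst e) a) (pstep Q a (Some (snd e)))"
  proof (cases "ptrans Q j a")
    case None
    then have F: "F a (\<nu> j) = None" using ju(2) by (simp add: M.step_P)
    show ?thesis
    proof (cases "ptrans P k a")
      case (Some x)
      obtain l us where x: "x = (l, us)" by fastforce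
      then have F': "F' a (\<mu> k) = Some (\<mu> l, us)" using Some k(1) by (simp add: B.step_P)
      have "run B (w @ [a]) = Some (\<mu> l, fill d us)"
        using B.run_snoc_spec[OF w, of a] F' by simp
      moreover have "\<not> B.useful (\<mu> l)" by (rule proj_step(1)[OF k(2) ju(1) F F'])
      ultimately have "l \<in> set dead_list" by (rule in_dead_list)
      then show ?thesis unfolding y by (simp add: link_def None Some x e)
    qed (use y None in \<open>simp add: link_def e\<close>)
  next
    case (Some x)
    obtain m vs where x: "ptrans Q j a = Some (m, vs)" using Some by (cases x) simp
    then have "F a (\<nu> j) = Some (\<nu> m, vs)" using ju(2) by (simp add: M.step_P)
    then obtain p us u' where p: "F' a (\<mu> k) = Some (p, us)" "B.useful p" "proj p = (\<nu> m, u')"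
      "fills us u' = fills u vs"
      using proj_step(2)[OF k(2) ju(1)] by blast
    then obtain l where l: "ptrans P k a = Some (l, us)" "p = \<mu> l"
      using k(1) by (auto simp: B.step_P)
    note us = B.ptrans_updates[OF k(1) l(1)]
    have "link sim_table dead_list (ptrans P k a) (Some (m, fills us u'))"
      by (rule link_useful[OF l(1)]) (use p l us updates_props(3)[OF us(2)] in simp_all)
    then show ?thesis unfolding y by (simp add: x e p(4))
  qed
next
  fix k assume "k \<in> set dead_list"
  then obtain w d where k: "k < length (snd P)" "run B w = Some (\<mu> k, d)" "\<not> B.useful (\<mu> k)"
    by (auto simp: dead_list_def)
  show "k < length (snd P)" by (rule k)
  show "pfin P k = None"
  proof (rule ccontr)
    assume "pfin P k \<noteq> None"
    then have "B.out (\<mu> k) [] \<noteq> None" using k(1) by (auto simp: B.final_P)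
    with k(2,3) show False unfolding B.useful_def by blast
  qed
  fix a
  show "case ptrans P k a of None \<Rightarrow> True | Some y \<Rightarrow> fst y \<in> set dead_list"
  proof (cases "ptrans P k a")
    case (Some x)
    obtain l us where x: "x = (l, us)" by fastforce
    then have F': "F' a (\<mu> k) = Some (\<mu> l, us)" using Some k(1) by (simp add: B.step_P)
    have "run B (w @ [a]) = Some (\<mu> l, fill d us)"
      using B.run_snoc_spec[OF k(2), of a] F' by simp
    moreover have "\<not> B.useful (\<mu> l)" using useful_step[OF F' _ k(2)] k(3) by blast
    ultimately show ?thesis by (simp add: Some x in_dead_list)
  qed simp
qed

end

theorem check_complete:
  fixes A :: "('q, 'a, 'g) transducer"
  assumes "infinite (UNIV :: 'q set)" and "finite (UNIV :: 'a set)" and "presents rank P A"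
    and "set al = UNIV" and "set rk = range (\<lambda>g. (g, rank g))"
  shows "\<exists>y. check al rk P y"
proof -
  obtain I' F' E' \<mu> where A: "presented rank A I' F' E' P \<mu>"
    using presents_presented[OF assms(3)] .
  then interpret A: presented rank A I' F' E' P \<mu> .
  obtain M :: "('q, 'a, 'g) transducer" and I0 F0 E0 where
    M: "reduced rank M I0 F0 E0" "transduction M = transduction A" "states M \<subseteq> states A"
    using reduced_exists[OF A.transducer] by blast
  have "finite (states A)" by (simp add: A.states_\<nu>)
  then have "finite (states M)" using M(3) finite_subset by blast
  moreover have "is_transducer rank M" using M(1) by (simp add: reduced_def specified_def)
  ultimately obtain Q0 where "presents rank Q0 M"
    using finite_transducer_presentable[OF assms(1,2)] by blast
  then obtain I F E \<nu> where "presented rank M I F E Q0 \<nu>" using presents_presented by blast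
  then interpret M0: presented rank M I F E Q0 \<nu> .
  define Q where "Q = normalize al Q0"
  have pM: "presented rank M I F E Q \<nu>"
    unfolding Q_def by (rule M0.presented_normalize[OF assms(4)])
  have rM: "reduced rank M I F E"
    using reduced_respecified[OF M(1)] M0.specified_axioms by blast
  interpret reduction rank A I' F' E' M I F E
    using A.specified_axioms rM M(2) by (simp add: reduction_def reduction_axioms_def)
  interpret presented_reduction rank A I' F' E' M I F E P \<mu> Q \<nu> rk
    using A pM assms(5) reduction_axioms
    by (simp add: presented_reduction_def presented_reduction_axioms_def)
  have base: "\<exists>n. pbase Q k = Arity n" if k: "k < length (snd Q)" for k
  proof -
    have "\<nu> k \<in> states M" using k by (simp add: M.states_iff)
    then obtain n where "state_ty M (\<nu> k) = (Arity n, {})" using M.unconstrained by blast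
    then have "pbase Q k = Arity n" using M.base_P[OF k] by simp
    then show ?thesis ..
  qed
  have Q: "k < length (snd Q) \<Longrightarrow> k < length (snd Q0)" for k by (simp add: Q_def normalize_simps)
  have target: "target_ok rk Q b (l, us)" if "l < length (snd Q)" "us \<in> updates rank b (pbase Q l)" for b l us
    using that upd_ok_iff(2)[OF assms(5)] by (simp add: target_ok_def)
  have "wf_pres al rk Q"
    unfolding wf_pres_def
  proof (intro conjI allI impI ballI)
    fix k assume k: "k < length (snd Q)"
    show "pbase Q k \<noteq> Init" using base[OF k] by auto
    show "fst (snd (pdesc Q k)) = []" using Q[OF k] by (simp add: Q_def normalize_simps)
    show "case pfin Q k of None \<Rightarrow> True | Some us \<Rightarrow> upd_ok rk us (pbase Q k) (Arity 0)"
      using M.pfin_updates[OF k] upd_ok_iff(2)[OF assms(5)] by (auto split: option.splits)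
    fix e assume e: "e \<in> set (ptable Q k)"
    then have "ptrans Q0 k (fst e) = Some (snd e)"
      using normalize_simps(6)[OF Q[OF k]] unfolding Q_def by blast
    then have "ptrans Q k (fst e) = Some (fst (snd e), snd (snd e))"
      using normalize_simps(7)[OF Q[OF k] assms(4)] unfolding Q_def by simp
    from target[OF M.ptrans_updates[OF k this]]
    show "target_ok rk Q (pbase Q k) (snd e)" by simp
    show "fst e \<in> set al" using assms(4) by simp
  next
    show "case fst Q of None \<Rightarrow> True | Some y \<Rightarrow> target_ok rk Q Init y"
      using M.init_updates target by (auto split: option.splits)
  qed
  moreover obtain V where "tests_ok Q V" using finite_tests[OF rM pM] by blast
  ultimately have "check al rk P (Q, sim_table, dead_list, V)"
    using sim_ok by (simp add: check_def assms(4))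
  then show ?thesis ..
qed

section \<open>Computable functions on coded types\<close>

text \<open>Codes are bijective, so that an unbounded search over codes enumerates all values.\<close>

class coded =
  fixes code :: "'a \<Rightarrow> nat"
  assumes bij_code: "bij code"
begin

lemma code_eq_iff [simp]: "code x = code y \<longleftrightarrow> x = y"
  using bij_code by (auto simp: bij_def inj_def)

definition decode :: "nat \<Rightarrow> 'a" where
  "decode = inv code"

lemma code_decode [simp]: "code (decode n) = n"
  using bij_code by (simp add: decode_def bij_is_surj surj_f_inv_f)

lemma decode_code [simp]: "decode (code x) = x"
  using bij_code by (simp add: decode_def bij_is_inj)

end

instantiation nat :: coded
begin

definition code_nat :: "nat \<Rightarrow> nat" where [simp]: "code_nat n = n"

instance by standard (simp add: bij_def inj_def surj_def)

end

instantiation prod :: (coded, coded) coded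
begin

definition code_prod :: "'a \<times> 'b \<Rightarrow> nat" where "code_prod = pair_code code code"

instance
proof
  have "inj (code :: 'a \<times> 'b \<Rightarrow> nat)"
    by (auto simp: inj_def code_prod_def pair_code_def)
  moreover have "\<exists>x :: 'a \<times> 'b. n = code x" for n
  proof -
    obtain a b where "prod_decode n = (a, b)" by fastforce
    then have "n = code (decode a :: 'a, decode b :: 'b)"
      unfolding code_prod_def pair_code_def by simp (metis prod_decode_inverse)
    then show ?thesis ..
  qed
  ultimately show "bij (code :: 'a \<times> 'b \<Rightarrow> nat)" by (simp add: bij_def surj_def)
qed

end

instantiation list :: (coded) coded
begin

definition code_list :: "'a list \<Rightarrow> nat" where "code_list xs = list_encode (map code xs)"

instance
proof
  have "inj (code :: 'a list \<Rightarrow> nat)"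
    by (rule injI) (simp add: code_list_def list_encode_eq inj_map_eq_map[OF bij_is_inj[OF bij_code]])
  moreover have "n = code (map decode (list_decode n) :: 'a list)" for n
    by (simp add: code_list_def comp_def)
  ultimately show "bij (code :: 'a list \<Rightarrow> nat)" unfolding bij_def surj_def by blast
qed

end

instantiation option :: (coded) coded
begin

definition code_option :: "'a option \<Rightarrow> nat" where "code_option = option_code code"

instance
proof
  have "inj (code :: 'a option \<Rightarrow> nat)"
    by (auto simp: inj_def code_option_def option_code_def split: option.splits)
  moreover have "\<exists>x :: 'a option. n = code x" for n
  proof (cases n)
    case 0
    then have "n = code (None :: 'a option)" by (simp add: code_option_def option_code_def)
    then show ?thesis ..
  next
    case (Suc m)
    then have "n = code (Some (decode m :: 'a))" by (simp add: code_option_def option_code_def)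
    then show ?thesis ..
  qed
  ultimately show "bij (code :: 'a option \<Rightarrow> nat)" by (simp add: bij_def surj_def)
qed

end

instantiation base :: coded
begin

definition code_base :: "base \<Rightarrow> nat" where "code_base = base_code"

instance
proof
  have "inj (code :: base \<Rightarrow> nat)"
    by (auto simp: inj_def code_base_def base_code_def split: base.splits)
  moreover have "\<exists>x :: base. n = code x" for n
  proof (cases n)
    case 0
    then have "n = code Init" by (simp add: code_base_def base_code_def)
    then show ?thesis ..
  next
    case (Suc m)
    then have "n = code (Arity m)" by (simp add: code_base_def base_code_def)
    then show ?thesis ..
  qed
  ultimately show "bij (code :: base \<Rightarrow> nat)" by (simp add: bij_def surj_def)
qed

end

lemma trm_code_inj: "inj e \<Longrightarrow> trm_code e s = trm_code e t \<longleftrightarrow> s = t"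
proof (induction s arbitrary: t)
  case Hole
  then show ?case by (cases t) auto
next
  case (Node g ss)
  show ?case
  proof (cases t)
    case t: (Node h ts)
    have "map (trm_code e) ss = map (trm_code e) ts \<longleftrightarrow> ss = ts"
      using Node.IH[OF _ Node.prems]
    proof (induction ss arbitrary: ts)
      case (Cons s ss)
      then show ?case by (cases ts) auto
    qed auto
    then show ?thesis using Node.prems by (simp add: t list_encode_eq inj_eq)
  qed simp
qed

lemma prod_encode_ge: "m + n \<le> prod_encode (m, n)"
proof -
  have "k \<le> triangle k" for k by (induction k) auto
  then have "m + n \<le> triangle (m + n)" .
  then show ?thesis by (simp add: prod_encode_def)
qed

text \<open>Members have smaller codes than their list, which bounds recursions over codes.\<close>

lemma list_encode_ge: "sum_list (map Suc xs) \<le> list_encode xs"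
proof (induction xs)
  case (Cons x xs)
  then show ?case using prod_encode_ge[of x "list_encode xs"] by simp
qed simp

instantiation trm :: (coded) coded
begin

definition code_trm :: "'a trm \<Rightarrow> nat" where "code_trm = trm_code code"

instance
proof
  have "inj (code :: 'a trm \<Rightarrow> nat)"
    by (rule injI) (simp add: code_trm_def trm_code_inj bij_is_inj[OF bij_code])
  moreover have "\<exists>t :: 'a trm. n = trm_code code t" for n
  proof (induction n rule: less_induct)
    case (less n)
    show ?case
    proof (cases n)
      case 0
      then have "n = trm_code code (Hole :: 'a trm)" by simp
      then show ?thesis ..
    next
      case (Suc m)
      obtain a b where ab: "prod_decode m = (a, b)" by fastforce
      then have m: "m = prod_encode (a, b)" by (metis prod_decode_inverse)
      \<comment> \<open>The numbers decoded as children are smaller than \<open>n\<close>, so by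
        induction they are codes of terms.\<close>
      have "k < n" if "k \<in> set (list_decode b)" for k
      proof -
        have "k \<in> set (list_decode b) \<Longrightarrow> k < sum_list (map Suc (list_decode b))"
          using member_le_sum_list[of "Suc k" "map Suc (list_decode b)"] by simp
        then show ?thesis
          using that list_encode_ge[of "list_decode b"] prod_encode_ge[of a b] Suc m by simp
      qed
      then have "\<forall>k\<in>set (list_decode b). \<exists>t :: 'a trm. k = trm_code code t" using less by blast
      then obtain T :: "nat \<Rightarrow> 'a trm" where T: "\<forall>k\<in>set (list_decode b). k = trm_code code (T k)"
        by metis
      then have "map (trm_code code) (map T (list_decode b)) = list_decode b"
        by (simp add: map_idI)
      then have "n = trm_code code (Node (decode a :: 'a) (map T (list_decode b)))"
        using Suc m by simp
      then show ?thesis ..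
    qed
  qed
  ultimately show "bij (code :: 'a trm \<Rightarrow> nat)" by (simp add: bij_def surj_def code_trm_def)
qed

end

lemma code_Pair: "code (x, y) = prod_encode (code x, code y)"
  by (simp add: code_prod_def pair_code_def)

lemma code_Nil: "code [] = 0" and code_Cons: "code (x # xs) = Suc (code (x, xs))"
  by (simp_all add: code_list_def code_Pair)

lemma code_None: "code None = 0" and code_Some: "code (Some x) = Suc (code x)"
  by (simp_all add: code_option_def option_code_def)

lemma code_Init: "code Init = 0" and code_Arity: "code (Arity n) = Suc n"
  by (simp_all add: code_base_def base_code_def)

lemma code_Hole: "code Hole = 0" and code_Node: "code (Node g ts) = Suc (code (g, ts))"
  by (simp_all add: code_trm_def code_Pair code_list_def)

text \<open>Allows the code of a list to serve as the number of iterations of a loop over the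
  list.\<close>

lemma length_le_code: "length xs \<le> code xs"
proof (induction xs)
  case (Cons x xs)
  then show ?case using prod_encode_ge[of "code x" "code xs"] by (simp add: code_Cons code_Pair)
qed simp

subsection \<open>Total recursive functions on lists of arguments\<close>

definition rec_fun :: "nat \<Rightarrow> (nat list \<Rightarrow> nat) \<Rightarrow> bool" where
  "rec_fun k f \<longleftrightarrow> (\<exists>p. \<forall>xs. length xs = k \<longrightarrow> eval p xs = Some (f xs))"

lemma eval_Comp: "map (\<lambda>g. eval g xs) gs = map Some ys \<Longrightarrow> eval (Comp f gs) xs = eval f ys"
  by (simp add: Let_def comp_def)

lemma eval_PrimRec:
  assumes "eval f ys = Some (b ys)" and "\<And>m v. eval g (m # v # ys) = Some (s m v)"
  shows "eval (PrimRec f g) (n # ys) = Some (rec_nat (b ys) s n)"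
  by (induction n) (use assms in auto)

lemma rec_fun_nth: "i < k \<Longrightarrow> rec_fun k (\<lambda>xs. xs ! i)"
  unfolding rec_fun_def by (rule exI[of _ "Proj i"]) simp

lemma rec_fun_Suc: "rec_fun k f \<Longrightarrow> rec_fun k (\<lambda>xs. Suc (f xs))"
  unfolding rec_fun_def
proof (elim exE)
  fix p assume "\<forall>xs. length xs = k \<longrightarrow> eval p xs = Some (f xs)"
  then show "\<exists>p. \<forall>xs. length xs = k \<longrightarrow> eval p xs = Some (Suc (f xs))"
    by (intro exI[of _ "Comp Succ [p]"]) simp
qed

lemma rec_fun_const: "rec_fun k (\<lambda>_. c)"
proof (induction c)
  case 0
  show ?case unfolding rec_fun_def by (rule exI[of _ Zero]) simp
qed (rule rec_fun_Suc)

lemma rec_fun_comp1: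
  assumes "rec_fun 1 (\<lambda>ys. g (ys ! 0))" and "rec_fun k f"
  shows "rec_fun k (\<lambda>xs. g (f xs))"
proof -
  obtain p q where "\<forall>ys. length ys = 1 \<longrightarrow> eval p ys = Some (g (ys ! 0))"
    "\<forall>xs. length xs = k \<longrightarrow> eval q xs = Some (f xs)"
    using assms unfolding rec_fun_def by blast
  then show ?thesis unfolding rec_fun_def by (intro exI[of _ "Comp p [q]"]) simp
qed

lemma rec_fun_comp2:
  assumes "rec_fun 2 (\<lambda>ys. g (ys ! 0) (ys ! 1))" and "rec_fun k f" and "rec_fun k h"
  shows "rec_fun k (\<lambda>xs. g (f xs) (h xs))"
proof -
  obtain p q r where "\<forall>ys. length ys = 2 \<longrightarrow> eval p ys = Some (g (ys ! 0) (ys ! 1))"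
    "\<forall>xs. length xs = k \<longrightarrow> eval q xs = Some (f xs)"
    "\<forall>xs. length xs = k \<longrightarrow> eval r xs = Some (h xs)"
    using assms unfolding rec_fun_def by blast
  then show ?thesis unfolding rec_fun_def by (intro exI[of _ "Comp p [q, r]"]) simp
qed

lemma rec_fun_rec_nat:
  assumes "rec_fun k f" and "rec_fun (Suc (Suc k)) (\<lambda>ys. g (ys ! 0) (ys ! 1) (drop 2 ys))"
    and "rec_fun k n"
  shows "rec_fun k (\<lambda>xs. rec_nat (f xs) (\<lambda>m r. g m r xs) (n xs))"
proof -
  obtain p q r where p: "\<And>xs. length xs = k \<Longrightarrow> eval p xs = Some (f xs)"
    and q: "\<And>ys. length ys = Suc (Suc k) \<Longrightarrow> eval q ys = Some (g (ys ! 0) (ys ! 1) (drop 2 ys))"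
    and r: "\<And>xs. length xs = k \<Longrightarrow> eval r xs = Some (n xs)"
    using assms unfolding rec_fun_def by blast
  \<comment> \<open>The recursion runs on \<open>n xs\<close> followed by a copy of all arguments,
    supplied by the projections. The step program sees the counter, the previous value and then
    these arguments, hence \<open>drop 2\<close>.\<close>
  have "eval (Comp (PrimRec p q) (r # map Proj [0..<k])) xs =
      Some (rec_nat (f xs) (\<lambda>m r. g m r xs) (n xs))" if "length xs = k" for xs
  proof -
    have "map (\<lambda>g. eval g xs) (map Proj [0..<k]) = map Some xs"
      by (rule nth_equalityI) (use that in auto)
    then have "eval (Comp (PrimRec p q) (r # map Proj [0..<k])) xs = eval (PrimRec p q) (n xs # xs)"
      by (intro eval_Comp) (simp add: r that)
    also have "\<dots> = Some (rec_nat (f xs) (\<lambda>m r. g m r xs) (n xs))"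
      by (rule eval_PrimRec) (use that in \<open>simp_all add: p q numeral_2_eq_2\<close>)
    finally show ?thesis .
  qed
  then show ?thesis unfolding rec_fun_def by blast
qed

lemma rec_fun_add:
  assumes "rec_fun k f" and "rec_fun k g"
  shows "rec_fun k (\<lambda>xs. f xs + g xs)"
proof -
  have "rec_nat a (\<lambda>m r. Suc r) b = a + b" for a b :: nat
    by (induction b) auto
  moreover have "rec_fun k (\<lambda>xs. rec_nat (f xs) (\<lambda>m r. Suc r) (g xs))"
    by (rule rec_fun_rec_nat) (use assms in \<open>auto intro: rec_fun_Suc rec_fun_nth\<close>)
  ultimately show ?thesis by simp
qed

lemma rec_fun_diff:
  assumes "rec_fun k f" and "rec_fun k g"
  shows "rec_fun k (\<lambda>xs. f xs - g xs)"
proof -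
  \<comment> \<open>The predecessor, obtained by returning the counter instead of the previous
    value.\<close>
  have "rec_nat 0 (\<lambda>m r. m) b = b - 1" for b :: nat
    by (induction b) auto
  moreover have "rec_fun 1 (\<lambda>xs. rec_nat 0 (\<lambda>m r. m) (xs ! 0))"
    by (rule rec_fun_rec_nat) (auto intro: rec_fun_nth rec_fun_const)
  ultimately have pred: "rec_fun 1 (\<lambda>xs. xs ! 0 - 1)" by simp
  have "rec_nat a (\<lambda>m r. r - 1) b = a - b" for a b :: nat
    by (induction b) auto
  moreover have "rec_fun (Suc (Suc k)) (\<lambda>ys. ys ! 1 - 1)"
    by (rule rec_fun_comp1[OF pred rec_fun_nth]) simp
  then have "rec_fun k (\<lambda>xs. rec_nat (f xs) (\<lambda>m r. r - 1) (g xs))"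
    by (rule rec_fun_rec_nat[OF assms(1) _ assms(2)])
  ultimately show ?thesis by simp
qed

text \<open>Both branches are evaluated, which is harmless for total functions; the value is a sum
  in which \<open>sel\<close> blanks out one summand.\<close>

lemma rec_fun_if:
  assumes "rec_fun k f" and "rec_fun k g" and "rec_fun k h"
  shows "rec_fun k (\<lambda>xs. if f xs = 0 then g xs else h xs)"
proof -
  have "rec_fun 2 (\<lambda>ys. rec_nat (ys ! 0) (\<lambda>m r. 0) (ys ! 1))"
    by (rule rec_fun_rec_nat) (auto intro: rec_fun_nth rec_fun_const)
  moreover have "rec_nat a (\<lambda>m r. 0) b = (if b = 0 then a else 0)" for a b :: nat
    by (cases b) auto
  ultimately have sel: "rec_fun 2 (\<lambda>ys. if ys ! 1 = 0 then ys ! 0 else 0)" by simp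
  have "rec_fun k (\<lambda>xs. (if f xs = 0 then g xs else 0) + (if 1 - f xs = 0 then h xs else 0))"
    using assms
    by (intro rec_fun_add rec_fun_comp2[where g = "\<lambda>a b. if b = 0 then a else 0", OF sel]
        rec_fun_diff rec_fun_const)
  moreover have "(if f xs = 0 then g xs else 0) + (if 1 - f xs = 0 then h xs else 0) =
      (if f xs = 0 then g xs else h xs)" for xs
    by auto
  ultimately show ?thesis by simp
qed

lemma rec_fun_triangle:
  assumes "rec_fun k f"
  shows "rec_fun k (\<lambda>xs. triangle (f xs))"
proof -
  have "rec_nat 0 (\<lambda>m r. r + Suc m) n = triangle n" for n
    by (induction n) auto
  moreover have "rec_fun 1 (\<lambda>xs. rec_nat 0 (\<lambda>m r. r + Suc m) (xs ! 0))"
    by (rule rec_fun_rec_nat) (intro rec_fun_nth rec_fun_const rec_fun_add rec_fun_Suc; simp)+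
  ultimately have "rec_fun 1 (\<lambda>ys. triangle (ys ! 0))" by simp
  from rec_fun_comp1[OF this assms] show ?thesis .
qed

lemma rec_fun_prod_encode:
  assumes "rec_fun k f" and "rec_fun k g"
  shows "rec_fun k (\<lambda>xs. prod_encode (f xs, g xs))"
  unfolding prod_encode_def prod.case
  by (intro rec_fun_add rec_fun_triangle assms)

text \<open>The largest \<open>r\<close> with \<open>triangle r \<le> n\<close>, which is the index
  of the diagonal of \<open>n\<close> in the pairing function: it grows at \<open>Suc m\<close> when
  the next triangular number is reached.\<close>

definition triangle_root :: "nat \<Rightarrow> nat" where
  "triangle_root = rec_nat 0 (\<lambda>m r. if triangle (Suc r) - Suc m = 0 then Suc r else r)"

lemma triangle_root: "triangle (triangle_root n) \<le> n \<and> n < triangle (Suc (triangle_root n))"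
  by (induction n) (auto simp: triangle_root_def)

lemma prod_decode_triangle_root:
  "prod_decode n = (n - triangle (triangle_root n), triangle_root n - (n - triangle (triangle_root n)))"
proof -
  have "prod_encode (n - triangle (triangle_root n),
      triangle_root n - (n - triangle (triangle_root n))) = n"
    using triangle_root[of n] by (simp add: prod_encode_def)
  then show ?thesis by (metis prod_encode_inverse)
qed

lemma rec_fun_prod_decode:
  assumes "rec_fun k f"
  shows "rec_fun k (\<lambda>xs. fst (prod_decode (f xs)))" "rec_fun k (\<lambda>xs. snd (prod_decode (f xs)))"
proof -
  have "rec_fun 1 (\<lambda>xs. triangle_root (xs ! 0))"
    unfolding triangle_root_def
    by (rule rec_fun_rec_nat)
      (intro rec_fun_nth rec_fun_const rec_fun_Suc rec_fun_triangle rec_fun_diff rec_fun_if; simp)+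
  note root = rec_fun_comp1[OF this assms]
  show "rec_fun k (\<lambda>xs. fst (prod_decode (f xs)))" "rec_fun k (\<lambda>xs. snd (prod_decode (f xs)))"
    unfolding prod_decode_triangle_root fst_conv snd_conv
    by (intro rec_fun_diff rec_fun_triangle root assms)+
qed

subsection \<open>Computable functions between coded types\<close>

definition computable :: "('a::coded \<Rightarrow> 'b::coded) \<Rightarrow> bool" where
  "computable f \<longleftrightarrow> (\<exists>p. \<forall>x. eval p [code x] = Some (code (f x)))"

text \<open>Every number is a code, so a program that is correct on codes computes a total function
  on numbers, and the closure properties of \<open>rec_fun\<close> carry over.\<close>

lemma computable_rec_fun: "computable f \<longleftrightarrow> rec_fun 1 (\<lambda>xs. code (f (decode (xs ! 0))))"
  unfolding computable_def rec_fun_def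
proof (intro ex_cong1 iffI allI impI)
  fix p and xs :: "nat list"
  assume "\<forall>x. eval p [code x] = Some (code (f x))" and "length xs = 1"
  moreover from this obtain n where "xs = [n]" by (auto simp: length_Suc_conv)
  ultimately show "eval p xs = Some (code (f (decode (xs ! 0))))"
    by (metis code_decode nth_Cons_0)
qed simp

lemma computable_comp:
  assumes "computable h" and "computable f"
  shows "computable (\<lambda>x. h (f x))"
proof -
  obtain p q where "\<And>x. eval p [code x] = Some (code (h x))" "\<And>x. eval q [code x] = Some (code (f x))"
    using assms unfolding computable_def by blast
  then show ?thesis unfolding computable_def by (intro exI[of _ "Comp p [q]"]) simp
qed

lemma computable_id: "computable (\<lambda>x. x)"
  unfolding computable_def by (intro exI[of _ "Proj 0"]) simp

lemma computable_const: "computable (\<lambda>_. c)"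
  unfolding computable_rec_fun by (rule rec_fun_const)

text \<open>A number is its own code, so a value and its code have the same code, and one program
  serves for both.\<close>

lemma computable_code: "computable f \<Longrightarrow> computable (\<lambda>x. code (f x))"
  unfolding computable_def by simp

lemma computable_decode: "computable f \<Longrightarrow> computable (\<lambda>x. decode (f x))"
  unfolding computable_def by simp

lemma computable_Pair: "computable f \<Longrightarrow> computable g \<Longrightarrow> computable (\<lambda>x. (f x, g x))"
  unfolding computable_rec_fun code_Pair by (rule rec_fun_prod_encode)

lemma code_fst: "code (fst z) = fst (prod_decode (code z))"
  and code_snd: "code (snd z) = snd (prod_decode (code z))"
  by (cases z; simp add: code_Pair)+

lemma computable_fst: "computable f \<Longrightarrow> computable (\<lambda>x. fst (f x))"
  unfolding computable_rec_fun code_fst by (rule rec_fun_prod_decode)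

lemma computable_snd: "computable f \<Longrightarrow> computable (\<lambda>x. snd (f x))"
  unfolding computable_rec_fun code_snd by (rule rec_fun_prod_decode)

lemma computable_comp2:
  assumes "computable (\<lambda>z. h (fst z) (snd z))" and "computable f" and "computable g"
  shows "computable (\<lambda>x. h (f x) (g x))"
  using computable_comp[OF assms(1) computable_Pair[OF assms(2,3)]] by simp

lemma computable_Suc: "computable f \<Longrightarrow> computable (\<lambda>x. Suc (f x))"
  unfolding computable_rec_fun by (simp add: rec_fun_Suc)

lemma computable_diff: "computable f \<Longrightarrow> computable g \<Longrightarrow> computable (\<lambda>x. f x - g x :: nat)"
  unfolding computable_rec_fun by (simp add: rec_fun_diff)

text \<open>The step of a primitive recursion has three arguments, whereas \<open>g\<close> is
  computed from the code of one triple; \<open>?c\<close> packs the former into the latter.\<close>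

lemma computable_rec_nat:
  fixes g :: "nat \<Rightarrow> 'b::coded \<Rightarrow> 'a::coded \<Rightarrow> 'b"
  assumes "computable n" and "computable f"
    and "computable (\<lambda>z. g (fst z) (fst (snd z)) (snd (snd z)))"
  shows "computable (\<lambda>x. rec_nat (f x) (\<lambda>m r. g m r x) (n x))"
proof -
  let ?G = "\<lambda>m r xs. code (g m (decode r) (decode (xs ! 0)))"
  let ?d = "decode :: nat \<Rightarrow> nat \<times> 'b \<times> 'a"
  let ?c = "\<lambda>ys :: nat list. prod_encode (ys ! 0, prod_encode (ys ! 1, ys ! 2))"
  have "rec_fun 3 (\<lambda>ys. code (g (fst (?d (?c ys))) (fst (snd (?d (?c ys))))
      (snd (snd (?d (?c ys))))))"
    using assms(3) unfolding computable_rec_fun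
    by (rule rec_fun_comp1[where g = "\<lambda>n. code (g (fst (?d n)) (fst (snd (?d n))) (snd (snd (?d n))))"])
      (intro rec_fun_prod_encode rec_fun_nth; simp)
  moreover have "?d (?c ys) = (ys ! 0, decode (ys ! 1), decode (ys ! 2))" for ys
    by (subst decode_code[symmetric]) (simp add: code_Pair)
  ultimately have "rec_fun 3 (\<lambda>ys. code (g (ys ! 0) (decode (ys ! 1)) (decode (ys ! 2))))"
    by simp
  then have "rec_fun 3 (\<lambda>ys. ?G (ys ! 0) (ys ! 1) (drop 2 ys))"
    unfolding rec_fun_def by simp
  then have "rec_fun 1 (\<lambda>xs. rec_nat (code (f (decode (xs ! 0)))) (\<lambda>m r. ?G m r xs) (n (decode (xs ! 0))))"
    using assms(1,2) unfolding computable_rec_fun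
    by (intro rec_fun_rec_nat) (simp_all add: numeral_3_eq_3)
  moreover have "rec_nat (code (f x)) (\<lambda>m r. code (g m (decode r) x)) k = code (rec_nat (f x) (\<lambda>m r. g m r x) k)"
    for k x
    by (induction k) auto
  ultimately show ?thesis unfolding computable_rec_fun by simp
qed

definition decidable :: "('a::coded \<Rightarrow> bool) \<Rightarrow> bool" where
  "decidable P \<longleftrightarrow> computable (\<lambda>x. of_bool (P x) :: nat)"

lemma computable_If:
  assumes "decidable P" and "computable f" and "computable g"
  shows "computable (\<lambda>x. if P x then f x else g x)"
proof -
  have "computable (\<lambda>x. rec_nat (g x) (\<lambda>m r. f x) (of_bool (P x)))"
    using assms(1,3) unfolding decidable_def
    by (intro computable_rec_nat computable_comp[OF assms(2)] computable_snd computable_id)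
  moreover have "rec_nat (g x) (\<lambda>m r. f x) (of_bool (P x)) = (if P x then f x else g x)" for x
    by simp
  ultimately show ?thesis by simp
qed

lemma decidable_comp: "decidable P \<Longrightarrow> computable f \<Longrightarrow> decidable (\<lambda>x. P (f x))"
  unfolding decidable_def by (rule computable_comp)

lemma decidable_comp2:
  assumes "decidable (\<lambda>z. P (fst z) (snd z))" and "computable f" and "computable g"
  shows "decidable (\<lambda>x. P (f x) (g x))"
  using decidable_comp[OF assms(1) computable_Pair[OF assms(2,3)]] by simp

lemma decidable_const: "decidable (\<lambda>_. b)"
  unfolding decidable_def by (rule computable_const)

lemma decidable_not:
  assumes "decidable P"
  shows "decidable (\<lambda>x. \<not> P x)"
proof -
  have "computable (\<lambda>x. 1 - of_bool (P x) :: nat)"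
    using assms unfolding decidable_def by (intro computable_diff computable_const)
  moreover have "1 - of_bool b = (of_bool (\<not> b) :: nat)" for b by simp
  ultimately show ?thesis by (simp only: decidable_def)
qed

lemma decidable_conj:
  assumes "decidable P" and "decidable Q"
  shows "decidable (\<lambda>x. P x \<and> Q x)"
proof -
  have "computable (\<lambda>x. if P x then of_bool (Q x) else 0 :: nat)"
    using assms by (intro computable_If computable_const) (auto simp: decidable_def)
  moreover have "(if a then of_bool b else 0 :: nat) = of_bool (a \<and> b)" for a b by simp
  ultimately show ?thesis by (simp only: decidable_def)
qed

lemma decidable_imp:
  assumes "decidable P" and "decidable Q"
  shows "decidable (\<lambda>x. P x \<longrightarrow> Q x)"
proof -
  have "decidable (\<lambda>x. \<not> (P x \<and> \<not> Q x))"
    using assms by (intro decidable_not decidable_conj)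
  moreover have "(\<not> (a \<and> \<not> b)) = (a \<longrightarrow> b)" for a b by simp
  ultimately show ?thesis by (simp only:)
qed

lemma decidable_disj:
  assumes "decidable P" and "decidable Q"
  shows "decidable (\<lambda>x. P x \<or> Q x)"
proof -
  have "decidable (\<lambda>x. \<not> P x \<longrightarrow> Q x)"
    using assms by (intro decidable_not decidable_imp)
  moreover have "(\<not> a \<longrightarrow> b) = (a \<or> b)" for a b by auto
  ultimately show ?thesis by (simp only:)
qed

lemma decidable_le: "computable f \<Longrightarrow> computable g \<Longrightarrow> decidable (\<lambda>x. f x \<le> (g x :: nat))"
proof -
  assume "computable f" "computable g"
  then have "computable (\<lambda>x. 1 - (f x - g x))" by (intro computable_diff computable_const)
  moreover have "1 - (f x - g x) = of_bool (f x \<le> g x)" for x by auto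
  ultimately show ?thesis by (simp add: decidable_def)
qed

lemma decidable_less:
  assumes "computable f" and "computable g"
  shows "decidable (\<lambda>x. f x < (g x :: nat))"
proof -
  have "decidable (\<lambda>x. \<not> g x \<le> f x)" using assms by (intro decidable_not decidable_le)
  then show ?thesis by (simp only: not_le)
qed

lemma decidable_eq: "computable f \<Longrightarrow> computable g \<Longrightarrow> decidable (\<lambda>x. f x = g x)"
proof -
  assume "computable f" "computable g"
  then have "decidable (\<lambda>x. code (f x) \<le> code (g x) \<and> code (g x) \<le> code (f x))"
    by (intro decidable_conj decidable_le computable_code)
  moreover have "code (f x) \<le> code (g x) \<and> code (g x) \<le> code (f x) \<longleftrightarrow> f x = g x" for x
    by (metis code_eq_iff eq_iff)
  ultimately show ?thesis by simp
qed

lemma computable_case_nat: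
  assumes "computable n" and "computable f" and "computable (\<lambda>z. g (fst z) (snd z))"
  shows "computable (\<lambda>x. case n x of 0 \<Rightarrow> f x | Suc m \<Rightarrow> g m x)"
proof -
  have "computable (\<lambda>x. rec_nat (f x) (\<lambda>m r. g m x) (n x))"
    by (intro computable_rec_nat assms computable_comp2[OF assms(3)] computable_fst computable_snd
        computable_id)
  moreover have "rec_nat (f x) (\<lambda>m r. g m x) (n x) = (case n x of 0 \<Rightarrow> f x | Suc m \<Rightarrow> g m x)" for x
    by (cases "n x") auto
  ultimately show ?thesis by (simp only:)
qed

text \<open>The code of an option is \<open>0\<close> or the successor of the code of its content,
  so the distinction is one on numbers. Base types, lists and terms follow the same pattern.\<close>

lemma computable_case_option:
  assumes "computable l" and "computable f" and "computable (\<lambda>z. g (fst z) (snd z))"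
  shows "computable (\<lambda>x. case l x of None \<Rightarrow> f x | Some y \<Rightarrow> g y x)"
proof -
  have "computable (\<lambda>x. case code (l x) of 0 \<Rightarrow> f x | Suc m \<Rightarrow> g (decode m) x)"
    by (intro computable_case_nat assms computable_code computable_comp2[OF assms(3)]
        computable_decode computable_fst computable_snd computable_id)
  moreover have "(case code (l x) of 0 \<Rightarrow> f x | Suc m \<Rightarrow> g (decode m) x) =
      (case l x of None \<Rightarrow> f x | Some y \<Rightarrow> g y x)" for x
    by (cases "l x") (auto simp: code_None code_Some)
  ultimately show ?thesis by (simp only:)
qed

lemma computable_case_base:
  assumes "computable l" and "computable f" and "computable (\<lambda>z. g (fst z) (snd z))"
  shows "computable (\<lambda>x. case l x of Init \<Rightarrow> f x | Arity n \<Rightarrow> g n x)"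
proof -
  have "computable (\<lambda>x. case code (l x) of 0 \<Rightarrow> f x | Suc m \<Rightarrow> g m x)"
    by (intro computable_case_nat assms computable_code)
  moreover have "(case code (l x) of 0 \<Rightarrow> f x | Suc m \<Rightarrow> g m x) =
      (case l x of Init \<Rightarrow> f x | Arity n \<Rightarrow> g n x)" for x
    by (cases "l x") (auto simp: code_Init code_Arity)
  ultimately show ?thesis by (simp only:)
qed

lemma computable_case_list:
  fixes l :: "'a::coded \<Rightarrow> 'b::coded list" and g :: "_ \<Rightarrow> _ \<Rightarrow> _ \<Rightarrow> 'c::coded"
  assumes "computable l" and "computable f"
    and "computable (\<lambda>z. g (fst z) (fst (snd z)) (snd (snd z)))"
  shows "computable (\<lambda>x. case l x of [] \<Rightarrow> f x | y # ys \<Rightarrow> g y ys x)"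
proof -
  let ?d = "decode :: nat \<Rightarrow> 'b \<times> 'b list"
  have "computable (\<lambda>z. g (fst (?d (fst z))) (snd (?d (fst z))) (snd z))"
    using computable_comp[OF assms(3), of "\<lambda>z. (fst (?d (fst z)), snd (?d (fst z)), snd z)"]
    by (simp add: computable_Pair computable_fst computable_snd computable_decode computable_id)
  then have "computable (\<lambda>x. case code (l x) of 0 \<Rightarrow> f x |
      Suc m \<Rightarrow> g (fst (?d m)) (snd (?d m)) x)"
    by (intro computable_case_nat assms computable_code)
  moreover have "(case code (l x) of 0 \<Rightarrow> f x | Suc m \<Rightarrow> g (fst (?d m)) (snd (?d m)) x) =
      (case l x of [] \<Rightarrow> f x | y # ys \<Rightarrow> g y ys x)" for x
    by (cases "l x") (auto simp: code_Nil code_Cons)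
  ultimately show ?thesis by (simp only:)
qed

lemma computable_case_trm:
  fixes l :: "'a::coded \<Rightarrow> 'b::coded trm" and g :: "_ \<Rightarrow> _ \<Rightarrow> _ \<Rightarrow> 'c::coded"
  assumes "computable l" and "computable f"
    and "computable (\<lambda>z. g (fst z) (fst (snd z)) (snd (snd z)))"
  shows "computable (\<lambda>x. case l x of Hole \<Rightarrow> f x | Node h ts \<Rightarrow> g h ts x)"
proof -
  let ?d = "decode :: nat \<Rightarrow> 'b \<times> 'b trm list"
  have "computable (\<lambda>z. g (fst (?d (fst z))) (snd (?d (fst z))) (snd z))"
    using computable_comp[OF assms(3), of "\<lambda>z. (fst (?d (fst z)), snd (?d (fst z)), snd z)"]
    by (simp add: computable_Pair computable_fst computable_snd computable_decode computable_id)
  then have "computable (\<lambda>x. case code (l x) of 0 \<Rightarrow> f x |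
      Suc m \<Rightarrow> g (fst (?d m)) (snd (?d m)) x)"
    by (intro computable_case_nat assms computable_code)
  moreover have "(case code (l x) of 0 \<Rightarrow> f x | Suc m \<Rightarrow> g (fst (?d m)) (snd (?d m)) x) =
      (case l x of Hole \<Rightarrow> f x | Node h ts \<Rightarrow> g h ts x)" for x
    by (cases "l x") (auto simp: code_Hole code_Node)
  ultimately show ?thesis by (simp only:)
qed

lemma computable_Some: "computable f \<Longrightarrow> computable (\<lambda>x. Some (f x))"
  unfolding computable_rec_fun code_Some by (rule rec_fun_Suc)

lemma computable_Cons:
  assumes "computable f" and "computable g"
  shows "computable (\<lambda>x. f x # g x)"
proof -
  have "rec_fun 1 (\<lambda>xs. Suc (code (f (decode (xs ! 0)), g (decode (xs ! 0)))))"
    using computable_Pair[OF assms] unfolding computable_rec_fun by (rule rec_fun_Suc)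
  then show ?thesis unfolding computable_rec_fun code_Cons .
qed

lemma computable_Node:
  assumes "computable f" and "computable g"
  shows "computable (\<lambda>x. Node (f x) (g x))"
proof -
  have "rec_fun 1 (\<lambda>xs. Suc (code (f (decode (xs ! 0)), g (decode (xs ! 0)))))"
    using computable_Pair[OF assms] unfolding computable_rec_fun by (rule rec_fun_Suc)
  then show ?thesis unfolding computable_rec_fun code_Node .
qed

lemmas computable_basic = computable_id computable_const computable_Pair computable_fst computable_snd
  computable_Suc computable_diff computable_Some computable_Cons computable_Node

section \<open>Computable operations on lists\<close>

text \<open>Iterates a step on pairs of remaining list and accumulator. The code of the list bounds
  its length, and surplus steps do nothing.\<close>

lemma computable_fold:
  assumes "computable l" and "computable i"
    and "computable (\<lambda>z. g (fst z) (fst (snd z)) (snd (snd z)))"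
  shows "computable (\<lambda>x. fold (\<lambda>y acc. g y acc x) (l x) (i x))"
proof -
  define st where "st x s = (case fst s of [] \<Rightarrow> s | y # ys \<Rightarrow> (ys, g y (snd s) x))"
    for x and s :: "'b list \<times> 'c"
  have g: "computable (\<lambda>z. g (a z) (b z) (c z))" if "computable a" "computable b" "computable c"
    for a b and c :: "'d::coded \<Rightarrow> 'a"
    using computable_comp[OF assms(3), of "\<lambda>z. (a z, b z, c z)"] that by (simp add: computable_Pair)
  have "computable (\<lambda>x. snd (rec_nat (l x, i x) (\<lambda>m s. st x s) (code (l x))))"
    unfolding st_def
    by (intro computable_snd computable_rec_nat computable_Pair computable_case_list g computable_code
        computable_fst computable_id assms(1,2))
  moreover have iter: "snd (rec_nat (ys, a) (\<lambda>m s. st x s) n) = fold (\<lambda>y acc. g y acc x) ys a"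
    if "length ys \<le> n" for ys a n x
  proof -
    have step: "rec_nat s (\<lambda>m s. st x s) (Suc n) = rec_nat (st x s) (\<lambda>m s. st x s) n" for s n
      by (induction n) auto
    show ?thesis using that
    proof (induction n arbitrary: ys a)
      case (Suc n)
      have "st x ([], a) = ([], a)" "st x (z # zs, a) = (zs, g z a x)" for z zs
        by (simp_all add: st_def)
      with Suc show ?case
        unfolding step by (cases ys) simp_all
    qed simp
  qed
  ultimately show ?thesis by (simp add: iter length_le_code)
qed

lemma computable_rev: "computable l \<Longrightarrow> computable (\<lambda>x. rev (l x))"
proof -
  assume "computable l"
  then have "computable (\<lambda>x. fold (\<lambda>y acc. y # acc) (l x) [])"
    by (intro computable_fold computable_basic) auto
  then show ?thesis by (simp add: fold_Cons_rev)
qed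

lemma computable_foldr:
  assumes "computable l" and "computable i"
    and "computable (\<lambda>z. g (fst z) (fst (snd z)) (snd (snd z)))"
  shows "computable (\<lambda>x. foldr (\<lambda>y acc. g y acc x) (l x) (i x))"
  using computable_fold[OF computable_rev[OF assms(1)] assms(2,3)] by (simp add: foldr_conv_fold)

lemma computable_append: "computable f \<Longrightarrow> computable g \<Longrightarrow> computable (\<lambda>x. f x @ g x)"
proof -
  assume "computable f" "computable g"
  then have "computable (\<lambda>x. foldr (\<lambda>y acc. y # acc) (f x) (g x))"
    by (intro computable_foldr computable_basic) auto
  moreover have "foldr (\<lambda>y acc. y # acc) xs ys = xs @ ys" for xs ys :: "'b list"
    by (induction xs) auto
  ultimately show ?thesis by simp
qed

lemma computable_map:
  assumes "computable (\<lambda>z. f (fst z) (snd z))" and "computable l"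
  shows "computable (\<lambda>x. map (\<lambda>y. f y x) (l x))"
proof -
  have "computable (\<lambda>x. foldr (\<lambda>y acc. f y x # acc) (l x) [])"
    by (intro computable_foldr computable_comp2[OF assms(1)] computable_Cons assms(2) computable_const
        computable_fst computable_snd computable_id)
  moreover have "foldr (\<lambda>y acc. f y x # acc) ys [] = map (\<lambda>y. f y x) ys" for x ys
    by (induction ys) auto
  ultimately show ?thesis by (simp only:)
qed

lemma computable_length: "computable l \<Longrightarrow> computable (\<lambda>x. length (l x))"
proof -
  assume "computable l"
  then have "computable (\<lambda>x. foldr (\<lambda>y acc. Suc acc) (l x) 0)"
    by (intro computable_foldr computable_basic) auto
  moreover have "foldr (\<lambda>y acc. Suc acc) xs 0 = length xs" for xs :: "'b list"
    by (induction xs) auto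
  ultimately show ?thesis by simp
qed

lemma computable_hd: "computable l \<Longrightarrow> computable (\<lambda>x. hd (l x))"
proof -
  assume "computable l"
  \<comment> \<open>\<open>hd []\<close> is some fixed element, so it enters as a constant.\<close>
  then have "computable (\<lambda>x. case l x of [] \<Rightarrow> hd [] | y # ys \<Rightarrow> y)"
    by (intro computable_case_list computable_basic) auto
  moreover have "(case xs of [] \<Rightarrow> hd [] | y # ys \<Rightarrow> y) = hd xs" for xs :: "'b list"
    by (cases xs) auto
  ultimately show ?thesis by simp
qed

lemma computable_tl: "computable l \<Longrightarrow> computable (\<lambda>x. tl (l x))"
  unfolding tl_def by (intro computable_case_list computable_basic) auto

lemma computable_drop: "computable n \<Longrightarrow> computable l \<Longrightarrow> computable (\<lambda>x. drop (n x) (l x))"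
proof -
  assume "computable n" "computable l"
  then have "computable (\<lambda>x. rec_nat (l x) (\<lambda>m r. tl r) (n x))"
    by (intro computable_rec_nat computable_tl computable_basic) auto
  moreover have "rec_nat xs (\<lambda>m r. tl r) k = drop k xs" for k and xs :: "'b list"
    by (induction k) (auto simp: drop_Suc tl_drop)
  ultimately show ?thesis by simp
qed

lemma computable_take: "computable n \<Longrightarrow> computable l \<Longrightarrow> computable (\<lambda>x. take (n x) (l x))"
proof -
  assume "computable n" "computable l"
  then have "computable (\<lambda>x. rev (drop (length (l x) - n x) (rev (l x))))"
    by (intro computable_rev computable_drop computable_diff computable_length)
  moreover have "rev (drop (length xs - k) (rev xs)) = take k xs" for k and xs :: "'b list"
    by (cases "k \<le> length xs") (simp_all add: drop_rev)
  ultimately show ?thesis by simp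
qed

lemma computable_upt: "computable n \<Longrightarrow> computable (\<lambda>x. [0..<n x])"
proof -
  assume "computable n"
  then have "computable (\<lambda>x. rec_nat [] (\<lambda>m r. r @ [m]) (n x))"
    by (intro computable_rec_nat computable_append computable_basic) auto
  moreover have "rec_nat [] (\<lambda>m r. r @ [m]) k = [0..<k]" for k
    by (induction k) auto
  ultimately show ?thesis by simp
qed

lemma computable_map_of:
  "computable l \<Longrightarrow> computable k \<Longrightarrow> computable (\<lambda>x. map_of (l x) (k x))"
proof -
  assume "computable l" and k: "computable k"
  then have "computable (\<lambda>x. foldr (\<lambda>p acc. if fst p = k x then Some (snd p) else acc) (l x) None)"
    by (intro computable_foldr computable_If decidable_eq computable_comp[OF k] computable_basic) auto
  moreover have "foldr (\<lambda>p acc. if fst p = j then Some (snd p) else acc) ps None = map_of ps j"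
    for j and ps :: "('b \<times> 'c) list"
    by (induction ps) auto
  ultimately show ?thesis by simp
qed

lemma decidable_Ball:
  assumes "decidable (\<lambda>z. Q (fst z) (snd z))" and "computable l"
  shows "decidable (\<lambda>x. \<forall>y\<in>set (l x). Q y x)"
proof -
  have "computable (\<lambda>x. foldr (\<lambda>y acc. if Q y x then acc else 0) (l x) (1 :: nat))"
    by (intro computable_foldr computable_If decidable_comp2[OF assms(1)] computable_basic assms(2))
  moreover have "foldr (\<lambda>y acc. if Q y x then acc else 0) ys 1 = (of_bool (\<forall>y\<in>set ys. Q y x) :: nat)"
    for x ys
    by (induction ys) auto
  ultimately show ?thesis by (simp only: decidable_def)
qed

lemma decidable_Bex:
  assumes "decidable (\<lambda>z. Q (fst z) (snd z))" and "computable l"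
  shows "decidable (\<lambda>x. \<exists>y\<in>set (l x). Q y x)"
proof -
  have "decidable (\<lambda>x. \<not> (\<forall>y\<in>set (l x). \<not> Q y x))"
    using assms by (intro decidable_not decidable_Ball)
  then show ?thesis by (simp only: Set.bex_simps not_not ball_simps)
qed

lemma decidable_All_less:
  assumes "decidable (\<lambda>z. Q (fst z) (snd z))" and "computable n"
  shows "decidable (\<lambda>x. \<forall>i<(n x :: nat). Q i x)"
  using decidable_Ball[OF assms(1) computable_upt[OF assms(2)]] by (simp add: Ball_def)

text \<open>As every number is the code of a candidate and \<open>R\<close> is decidable, all
  evaluations before the first hit converge. Nothing is claimed for an \<open>x\<close> without
  solution, where the search may diverge.\<close>

theorem computable_search:
  fixes R :: "'a::coded \<Rightarrow> 'b::coded \<Rightarrow> bool"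
  assumes "decidable (\<lambda>z. R (fst z) (snd z))" and "computable h"
  shows "\<exists>p. \<forall>x. (\<exists>y. R x y) \<longrightarrow> (\<exists>y. R x y \<and> eval p [code x] = Some (code (h y)))"
proof -
  \<comment> \<open>Minimization looks for a zero in its first argument, hence the complemented
    truth value and the candidate in front.\<close>
  have "computable (\<lambda>z :: nat \<times> 'a. 1 - of_bool (R (snd z) (decode (fst z))) :: nat)"
    using decidable_comp[OF assms(1), of "\<lambda>z. (snd z, decode (fst z))"]
    by (intro computable_diff computable_const)
      (simp add: decidable_def computable_Pair computable_fst computable_snd computable_decode computable_id)
  then obtain q where q: "\<And>n x. eval q [prod_encode (n, code x)] = Some (1 - of_bool (R x (decode n)))"
    unfolding computable_def by (force simp: code_Pair)
  have "rec_fun 2 (\<lambda>xs. prod_encode (xs ! 0, xs ! 1))"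
    by (intro rec_fun_prod_encode rec_fun_nth) simp_all
  then obtain r where "\<forall>xs. length xs = 2 \<longrightarrow> eval r xs = Some (prod_encode (xs ! 0, xs ! 1))"
    unfolding rec_fun_def by blast
  then have r: "eval r [m, n] = Some (prod_encode (m, n))" for m n by simp
  obtain s where s: "\<And>y. eval s [code y] = Some (code (h y))"
    using assms(2) unfolding computable_def by blast
  define c where "c = Comp q [r]"
  have f: "eval c [n, code x] = Some (1 - of_bool (R x (decode n)))" for n x
    by (simp add: c_def q r)
  have "\<exists>y. R x y \<and> eval (Comp s [Mu c]) [code x] = Some (code (h y))" if "R x y0" for x y0
  proof -
    let ?n = "LEAST n. eval c [n, code x] = Some 0"
    have "eval c [code y0, code x] = Some 0" using that unfolding f by simp
    then have n: "eval c [?n, code x] = Some 0" by (rule LeastI)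
    moreover have "\<exists>v. eval c [m, code x] = Some (Suc v)" if "m < ?n" for m
      using not_less_Least[OF that] unfolding f by (auto split: if_splits)
    ultimately have "eval (Mu c) [code x] = Some ?n" by auto
    then have "eval (Comp s [Mu c]) [code x] = eval s [?n]" by simp
    moreover have "R x (decode ?n)"
    proof (rule ccontr)
      assume "\<not> R x (decode ?n)"
      then have "eval c [?n, code x] = Some 1" by (simp only: f of_bool_eq diff_zero)
      with n show False by simp
    qed
    ultimately show ?thesis using s[of "decode ?n"] by auto
  qed
  then show ?thesis by blast
qed

section \<open>Computability of the certificate check\<close>

lemma computable_comp3:
  assumes "computable (\<lambda>z. h (fst z) (fst (snd z)) (snd (snd z)))"
    and "computable f" and "computable g" and "computable k"
  shows "computable (\<lambda>x. h (f x) (g x) (k x))"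
  using computable_comp[OF assms(1) computable_Pair[OF assms(2) computable_Pair[OF assms(3,4)]]] by simp

lemma decidable_comp3:
  assumes "decidable (\<lambda>z. h (fst z) (fst (snd z)) (snd (snd z)))"
    and "computable f" and "computable g" and "computable k"
  shows "decidable (\<lambda>x. h (f x) (g x) (k x))"
  using decidable_comp[OF assms(1) computable_Pair[OF assms(2) computable_Pair[OF assms(3,4)]]] by simp

lemma decidable_comp4:
  assumes "decidable (\<lambda>z. h (fst z) (fst (snd z)) (fst (snd (snd z))) (snd (snd (snd z))))"
    and "computable f" and "computable g" and "computable k" and "computable l"
  shows "decidable (\<lambda>x. h (f x) (g x) (k x) (l x))"
  using decidable_comp[OF assms(1) computable_Pair[OF assms(2) computable_Pair[OF assms(3)
        computable_Pair[OF assms(4,5)]]]] by simp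

lemma decidable_case_option:
  assumes "computable l" and "decidable f" and "decidable (\<lambda>z. g (fst z) (snd z))"
  shows "decidable (\<lambda>x. case l x of None \<Rightarrow> f x | Some y \<Rightarrow> g y x)"
proof -
  have "computable (\<lambda>x. case l x of None \<Rightarrow> of_bool (f x) :: nat | Some y \<Rightarrow> of_bool (g y x))"
    using assms unfolding decidable_def by (intro computable_case_option)
  moreover have "(case l x of None \<Rightarrow> of_bool (f x) :: nat | Some y \<Rightarrow> of_bool (g y x)) =
      of_bool (case l x of None \<Rightarrow> f x | Some y \<Rightarrow> g y x)" for x
    by (cases "l x") simp_all
  ultimately show ?thesis by (simp only: decidable_def)
qed

lemma decidable_mem:
  assumes "computable f" and "computable l"
  shows "decidable (\<lambda>x. f x \<in> set (l x))"
proof -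
  have "decidable (\<lambda>x. \<exists>y\<in>set (l x). y = f x)"
    by (intro decidable_Bex decidable_eq computable_comp[OF assms(1)] assms(2) computable_basic)
  moreover have "(\<exists>y\<in>set (l x). y = f x) \<longleftrightarrow> f x \<in> set (l x)" for x by blast
  ultimately show ?thesis by (simp only:)
qed

lemma computable_map_option:
  assumes "computable (\<lambda>z. f (fst z) (snd z))" and "computable l"
  shows "computable (\<lambda>x. map_option (\<lambda>y. f y x) (l x))"
proof -
  have "computable (\<lambda>x. case l x of None \<Rightarrow> None | Some y \<Rightarrow> Some (f y x))"
    by (intro computable_case_option computable_Some assms computable_const)
  then show ?thesis by (simp only: map_option_case)
qed

lemmas computable_intros = computable_basic computable_If computable_case_option computable_case_base
  computable_case_list computable_case_trm computable_fold computable_foldr computable_rec_nat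
  computable_map computable_map_option computable_append computable_rev computable_length
  computable_hd computable_tl computable_take computable_drop computable_upt
  computable_map_of computable_code
  decidable_const decidable_not decidable_conj decidable_disj decidable_imp decidable_eq decidable_le
  decidable_less decidable_case_option decidable_mem decidable_Ball decidable_Bex decidable_All_less

section \<open>Computing with forests through their tokens\<close>

lemma code_list_ge: "sum_list (map (\<lambda>x. Suc (code x)) xs) \<le> code xs"
  using list_encode_ge[of "map code xs"] by (simp add: code_list_def comp_def)

lemma length_toks_le: "length (toks ts) \<le> code ts"
proof -
  \<comment> \<open>The successor accounts for \<open>Hole\<close>, whose code is \<open>0\<close>
    although it yields a token.\<close>
  have flat: "length (flat t) \<le> Suc (code t)" for t :: "'a trm"
  proof (induction t)
    case (Node g ts)
    have "length (concat (map flat ts)) \<le> sum_list (map (\<lambda>t. Suc (code t)) ts)"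
      using Node unfolding length_concat by (simp add: comp_def) (rule sum_list_mono, simp)
    also have "\<dots> \<le> code ts" by (rule code_list_ge)
    finally show ?case
      using prod_encode_ge[of "code g" "code ts"] by (simp add: code_Node code_Pair)
  qed simp
  have "length (toks ts) \<le> sum_list (map (\<lambda>t. Suc (code t)) ts)"
    unfolding toks_def length_concat using flat by (simp add: comp_def) (rule sum_list_mono, simp)
  with code_list_ge[of ts] show ?thesis by simp
qed

text \<open>One step of a preorder traversal with an explicit stack of trees, which replaces
  recursion over terms by iteration. Tokens are collected in reverse.\<close>

definition scan :: "'g trm list \<times> ('g \<times> nat) option list \<Rightarrow> 'g trm list \<times> ('g \<times> nat) option list" where
  "scan s = (case fst s of [] \<Rightarrow> s | t # ts \<Rightarrow>
     (case t of Hole \<Rightarrow> (ts, None # snd s) | Node g us \<Rightarrow> (us @ ts, Some (g, length us) # snd s)))"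

text \<open>Each step emits one token until the stack is empty; then the state no longer changes, so
  every sufficiently large \<open>n\<close> will do.\<close>

lemma scan_toks:
  "length (toks ts) \<le> n \<Longrightarrow> snd (rec_nat (ts, xs) (\<lambda>m s. scan s) n) = rev (toks ts) @ xs"
proof (induction n arbitrary: ts xs)
  case 0
  then have "ts = []"
  proof (cases ts)
    case (Cons t ts')
    with 0 show ?thesis by (cases t) (simp_all add: toks_def)
  qed
  then show ?case by (simp add: toks_def)
next
  case (Suc n)
  have step: "rec_nat s (\<lambda>m s. scan s) (Suc n) = rec_nat (scan s) (\<lambda>m s. scan s) n"
    for s :: "'a trm list \<times> ('a \<times> nat) option list" and n
    by (induction n) auto
  show ?case
  proof (cases ts)
    case Nil
    have "scan ([], xs) = ([], xs)" by (simp add: scan_def)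
    with Suc.IH[of "[]" xs] show ?thesis unfolding step Nil by (simp add: toks_def)
  next
    case (Cons t ts')
    show ?thesis
    proof (cases t)
      case Hole
      have "scan (ts, xs) = (ts', None # xs)" by (simp add: scan_def Cons Hole)
      with Suc.IH[of ts' "None # xs"] Suc.prems show ?thesis
        unfolding step by (simp add: Cons Hole toks_def)
    next
      case (Node g us)
      have "scan (ts, xs) = (us @ ts', Some (g, length us) # xs)" by (simp add: scan_def Cons Node)
      with Suc.IH[of "us @ ts'" "Some (g, length us) # xs"] Suc.prems show ?thesis
        unfolding step by (simp add: Cons Node toks_def)
    qed
  qed
qed

lemma computable_toks: "computable f \<Longrightarrow> computable (\<lambda>x. toks (f x))"
proof (rule computable_comp[of toks])
  have "computable (\<lambda>ts :: 'b trm list. rev (snd (rec_nat (ts, []) (\<lambda>m s. scan s) (code ts))))"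
    unfolding scan_def by (intro computable_intros)
  then show "computable (toks :: 'b trm list \<Rightarrow> _)"
    by (simp add: scan_toks length_toks_le)
qed

text \<open>Read from right to left, the tokens of a forest drive a stack machine that rebuilds the forest;
  substitution replaces the placeholders on the way.\<close>

definition unscan :: "('g \<times> nat) option \<Rightarrow> 'g trm list \<times> 'g trm list \<Rightarrow> 'g trm list \<times> 'g trm list" where
  "unscan x s = (case x of None \<Rightarrow> (tl (fst s), hd (fst s) # snd s)
     | Some y \<Rightarrow> (fst s, Node (fst y) (take (snd y) (snd s)) # drop (snd y) (snd s)))"

text \<open>The state holds the reversed tuple and a stack of finished trees. \<open>foldr\<close>
  handles the last token first, so a placeholder takes the last argument left, and a symbol finds
  its children on top of the stack.\<close>

lemma unscan_flat:
  "length us = holes t \<Longrightarrow> foldr unscan (flat t) (rev us @ rs, st) = (rs, fill t us # st)"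
  and unscan_toks: "length us = sum_list (map holes ts) \<Longrightarrow>
    foldr unscan (toks ts) (rev us @ rs, st) = (rs, fills ts us @ st)"
proof (induction t us and ts us arbitrary: rs st and rs st rule: fill_fills.induct)
  case (1 us)
  then obtain u where "us = [u]" by (auto simp: length_Suc_conv)
  then show ?case by (simp add: unscan_def)
next
  case (2 g ts us)
  then show ?case by (simp add: unscan_def flip: toks_def)
next
  case (3 us)
  then show ?case by (simp add: toks_def)
next
  case (4 t ts us)
  have "rev us = rev (drop (holes t) us) @ rev (take (holes t) us)"
    by (metis append_take_drop_id rev_append)
  then show ?case using 4 by (simp add: toks_def)
qed

lemma sum_holes_toks: "sum_list (map holes ts) = foldr (\<lambda>x n. if x = None then Suc n else n) (toks ts) 0"
proof -
  have count: "foldr (\<lambda>x n. if x = None then Suc n else n) xs n =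
      n + foldr (\<lambda>x n. if x = None then Suc n else n) xs 0" for n and xs :: "('a \<times> nat) option list"
    by (induction xs) auto
  have "foldr (\<lambda>x n. if x = None then Suc n else n) (flat t) 0 = holes t" for t :: "'a trm"
  proof (induction t)
    case (Node g ts)
    then show ?case
    proof (induction ts)
      case (Cons t ts)
      then show ?case using count[of "flat t" "sum_list (map holes ts)"] by simp
    qed simp
  qed simp
  then show ?thesis
  proof (induction ts)
    case (Cons t ts)
    then show ?case using count[of "flat t" "sum_list (map holes ts)"] by (simp add: toks_def)
  qed (simp add: toks_def)
qed

lemma computable_sum_holes: "computable f \<Longrightarrow> computable (\<lambda>x. sum_list (map holes (f x)))"
  unfolding sum_holes_toks
  by (rule computable_comp[of "\<lambda>ts. foldr (\<lambda>x n. if x = None then Suc n else n) (toks ts) 0"])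
    (intro computable_intros computable_toks)

lemma graft_toks: "graft ts us = (if length us = sum_list (map holes ts)
    then Some (snd (foldr unscan (toks ts) (rev us, []))) else None)"
  using unscan_toks[of us ts "[]" "[]"] by (simp add: graft_def)

lemma computable_graft:
  "computable f \<Longrightarrow> computable g \<Longrightarrow> computable (\<lambda>x. graft (f x) (g x))"
  unfolding graft_toks unscan_def
  by (rule computable_comp2[of "\<lambda>ts us. if length us = sum_list (map holes ts)
    then Some (snd (foldr (\<lambda>x s. case x of None \<Rightarrow> (tl (fst s), hd (fst s) # snd s)
     | Some y \<Rightarrow> (fst s, Node (fst y) (take (snd y) (snd s)) # drop (snd y) (snd s))) (toks ts) (rev us, []))) else None"])
    (intro computable_intros computable_toks computable_sum_holes)

lemma width_case: "width b = (case b of Init \<Rightarrow> 1 | Arity n \<Rightarrow> n)"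
  by (cases b) auto

lemma identity_map: "identity b = map (\<lambda>_. Hole) [0..<width b]"
  by (simp add: identity_def map_replicate_const)

lemma root_symbol_case: "root_symbol t = (case t of Hole \<Rightarrow> None | Node g ts \<Rightarrow> Some g)"
  by (cases t) auto

lemma pdesc_hd: "pdesc P k = (if k < length (snd P) then hd (drop k (snd P)) else (Init, [], [], None))"
  by (simp add: pdesc_def hd_drop_conv_nth)

lemma nth_root_hd: "nth_root z i = (case z of None \<Rightarrow> None | Some us \<Rightarrow>
     if i < length us then Some (root_symbol (hd (drop i us))) else None)"
  by (auto simp: nth_root_def hd_drop_conv_nth split: option.split)

lemma computable_width: "computable f \<Longrightarrow> computable (\<lambda>x. width (f x))"
  unfolding width_case
  by (rule computable_comp[of "\<lambda>b. case b of Init \<Rightarrow> 1 | Arity n \<Rightarrow> n"]) (intro computable_intros)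

lemma computable_identity: "computable f \<Longrightarrow> computable (\<lambda>x. identity (f x))"
  unfolding identity_map by (rule computable_comp[of "\<lambda>b. map (\<lambda>_. Hole) [0..<width b]"])
    (intro computable_intros computable_width)

lemma computable_root_symbol: "computable f \<Longrightarrow> computable (\<lambda>x. root_symbol (f x))"
  unfolding root_symbol_case
  by (rule computable_comp[of "\<lambda>t. case t of Hole \<Rightarrow> None | Node g ts \<Rightarrow> Some g"]) (intro computable_intros)

lemma computable_pdesc: "computable f \<Longrightarrow> computable g \<Longrightarrow> computable (\<lambda>x. pdesc (f x) (g x))"
  by (rule computable_comp2) (unfold pdesc_hd, intro computable_intros)

lemma computable_pbase: "computable f \<Longrightarrow> computable g \<Longrightarrow> computable (\<lambda>x. pbase (f x) (g x))"
  unfolding pbase_def by (intro computable_fst computable_pdesc)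

lemma computable_ptable: "computable f \<Longrightarrow> computable g \<Longrightarrow> computable (\<lambda>x. ptable (f x) (g x))"
  unfolding ptable_def by (intro computable_fst computable_snd computable_pdesc)

lemma computable_pfin: "computable f \<Longrightarrow> computable g \<Longrightarrow> computable (\<lambda>x. pfin (f x) (g x))"
  unfolding pfin_def by (intro computable_snd computable_pdesc)

lemma computable_ptrans:
  "computable f \<Longrightarrow> computable g \<Longrightarrow> computable h \<Longrightarrow> computable (\<lambda>x. ptrans (f x) (g x) (h x))"
  unfolding ptrans_def by (intro computable_map_of computable_ptable)

lemma computable_pextend: "computable f \<Longrightarrow> computable g \<Longrightarrow> computable (\<lambda>x. pextend (f x) (g x))"
  by (rule computable_comp2) (unfold pextend_def, intro computable_intros computable_graft)

lemma computable_pstep: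
  "computable f \<Longrightarrow> computable g \<Longrightarrow> computable h \<Longrightarrow> computable (\<lambda>x. pstep (f x) (g x) (h x))"
  by (rule computable_comp3) (unfold pstep_def, intro computable_intros computable_pextend computable_ptrans)

lemma computable_psteps:
  "computable f \<Longrightarrow> computable g \<Longrightarrow> computable h \<Longrightarrow> computable (\<lambda>x. psteps (f x) (g x) (h x))"
  by (rule computable_comp3) (unfold psteps_def, intro computable_intros computable_pstep)

lemma computable_pend: "computable f \<Longrightarrow> computable g \<Longrightarrow> computable (\<lambda>x. pend (f x) (g x))"
  by (rule computable_comp2) (unfold pend_def, intro computable_intros computable_graft computable_pfin)

lemma computable_pout:
  "computable f \<Longrightarrow> computable g \<Longrightarrow> computable h \<Longrightarrow> computable (\<lambda>x. pout (f x) (g x) (h x))"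
  by (rule computable_comp3)
    (unfold pout_def, intro computable_intros computable_pend computable_psteps computable_identity computable_pbase)

lemma computable_nth_root: "computable f \<Longrightarrow> computable g \<Longrightarrow> computable (\<lambda>x. nth_root (f x) (g x))"
  by (rule computable_comp2) (unfold nth_root_hd, intro computable_intros computable_root_symbol)

lemma decidable_ranked_by: "computable f \<Longrightarrow> computable g \<Longrightarrow> decidable (\<lambda>x. ranked_by (f x) (g x))"
  by (rule decidable_comp2) (unfold ranked_by_def, intro computable_intros computable_toks)

lemma decidable_upd_ok:
  "computable f \<Longrightarrow> computable g \<Longrightarrow> computable h \<Longrightarrow> computable k \<Longrightarrow>
    decidable (\<lambda>x. upd_ok (f x) (g x) (h x) (k x))"
  unfolding upd_ok_def
  by (intro computable_intros decidable_ranked_by computable_width computable_sum_holes)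

lemma decidable_target_ok:
  "computable f \<Longrightarrow> computable g \<Longrightarrow> computable h \<Longrightarrow> computable k \<Longrightarrow>
    decidable (\<lambda>x. target_ok (f x) (g x) (h x) (k x))"
  unfolding target_ok_def by (intro computable_intros decidable_upd_ok computable_pbase)

lemma decidable_wf_pres:
  "computable f \<Longrightarrow> computable g \<Longrightarrow> computable h \<Longrightarrow> decidable (\<lambda>x. wf_pres (f x) (g x) (h x))"
  by (rule decidable_comp3)
    (unfold wf_pres_def, intro computable_intros decidable_target_ok decidable_upd_ok computable_pbase
      computable_ptable computable_pfin computable_pdesc)

lemma decidable_link:
  "computable f \<Longrightarrow> computable g \<Longrightarrow> computable h \<Longrightarrow> computable k \<Longrightarrow>
    decidable (\<lambda>x. link (f x) (g x) (h x) (k x))"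
  by (rule decidable_comp4) (unfold link_def, intro computable_intros computable_pextend)

lemma decidable_sim_ok:
  "decidable (\<lambda>z. sim_ok al rk (fst z) (fst (snd z)) (fst (snd (snd z))) (snd (snd (snd z))))"
  unfolding sim_ok_def
  by (intro computable_intros decidable_target_ok decidable_link computable_pbase computable_pfin
      computable_pend computable_ptrans computable_pstep)

lemma decidable_tests_ok: "decidable (\<lambda>z. tests_ok (fst z) (snd z))"
  unfolding tests_ok_def
  by (intro computable_intros computable_psteps computable_pout computable_nth_root computable_pbase
      computable_width)

lemma decidable_check: "decidable (\<lambda>z. check al rk (fst z) (snd z))"
  unfolding check_def
  by (intro decidable_conj decidable_wf_pres decidable_comp4[OF decidable_sim_ok]
      decidable_comp2[OF decidable_tests_ok] computable_intros)

subsection \<open>Renaming letters and symbols\<close>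

lemma ranked_by_elem: "ranked_by rk ts \<Longrightarrow> t \<in> set ts \<Longrightarrow> ranked_by rk [t]"
  by (auto simp: ranked_by_def toks_def)

lemma ranked_by_Node:
  assumes "ranked_by rk [Node g ts]"
  shows "ranked_by rk ts" "(g, length ts) \<in> set rk"
  using assms by (simp_all add: ranked_by_def toks_def)

text \<open>In the application the types of letters and symbols are finite, so they have no
  bijective codes. The check is therefore performed on data renamed into the numbers.\<close>

locale renaming =
  fixes ea :: "'a \<Rightarrow> 'b" and eg :: "'g \<Rightarrow> 'h"
  assumes inj_ea: "inj ea" and inj_eg: "inj eg"
begin

abbreviation "rn_forest \<equiv> map (map_trm eg)"
abbreviation "rn_target \<equiv> map_prod id rn_forest"
abbreviation "rn_desc \<equiv> map_prod id (map_prod (map (map_prod rn_forest rn_forest))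
  (map_prod (map (map_prod ea rn_target)) (map_option rn_forest)))"
abbreviation "rn_pres \<equiv> map_prod (map_option rn_target) (map rn_desc)"
abbreviation "rn_table \<equiv> map (map_prod id rn_target)"
abbreviation "rn_rank \<equiv> map (map_prod eg id)"

lemma inj_rn: "inj (map_trm eg)" "inj rn_forest" "inj rn_target" "inj (map_option rn_forest)"
  "inj (map_option rn_target)"
  using inj_eg by (simp_all add: trm.inj_map prod.inj_map option.inj_map)

lemmas rn_eq_iff [simp] = inj_ea[THEN inj_eq] inj_eg[THEN inj_eq] inj_rn[THEN inj_eq]

lemma holes_rn [simp]: "holes (map_trm eg t) = holes t"
proof (induction t)
  case (Node g ts)
  then have "map holes (map (map_trm eg) ts) = map holes ts" by simp
  then show ?case by (simp only: trm.map holes.simps)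
qed simp

lemma sum_holes_rn [simp]: "sum_list (map holes (rn_forest ts)) = sum_list (map holes ts)"
  by (simp add: comp_def)

lemma fill_rn: "length us = holes t \<Longrightarrow> fill (map_trm eg t) (rn_forest us) = map_trm eg (fill t us)"
  and fills_rn: "length us = sum_list (map holes ts) \<Longrightarrow>
    fills (rn_forest ts) (rn_forest us) = rn_forest (fills ts us)"
proof (induction t us and ts us rule: fill_fills.induct)
  case (1 us)
  then show ?case by (cases us) auto
qed (auto simp: take_map drop_map)

lemma graft_rn [simp]: "graft (rn_forest ts) (rn_forest us) = map_option rn_forest (graft ts us)"
  unfolding graft_def sum_holes_rn by (simp add: fills_rn)

lemma toks_rn: "toks (rn_forest ts) = map (map_option (map_prod eg id)) (toks ts)"
proof -
  define f where "f = (map_option (map_prod eg id) :: ('g \<times> nat) option \<Rightarrow> _)"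
  have "flat (map_trm eg t) = map f (flat t)" for t
  proof (induction t)
    case Hole
    show ?case by (simp add: f_def)
  next
    case (Node g ts)
    then have "map flat (map (map_trm eg) ts) = map (map f) (map flat ts)" by simp
    moreover have "f (Some (g, n)) = Some (eg g, n)" for n by (simp add: f_def)
    ultimately show ?case by (simp only: trm.map flat.simps list.map map_concat length_map)
  qed
  then show ?thesis by (simp add: toks_def map_concat comp_def flip: f_def)
qed

lemma ranked_by_rn [simp]: "ranked_by (rn_rank rk) (rn_forest ts) \<longleftrightarrow> ranked_by rk ts"
proof -
  have "inj (map_prod eg (id :: nat \<Rightarrow> nat))" using inj_eg by (simp add: prod.inj_map)
  then have "map_prod eg id y \<in> set (rn_rank rk) \<longleftrightarrow> y \<in> set rk" for y
    by (simp add: inj_image_mem_iff)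
  then have "(case map_option (map_prod eg id) x of None \<Rightarrow> True | Some y \<Rightarrow> y \<in> set (rn_rank rk)) \<longleftrightarrow>
      (case x of None \<Rightarrow> True | Some y \<Rightarrow> y \<in> set rk)" for x
    by (cases x) auto
  then show ?thesis unfolding ranked_by_def toks_rn by simp
qed

lemma pdesc_rn: "pdesc (rn_pres P) k = rn_desc (pdesc P k)"
  by (simp add: pdesc_def)

lemma pbase_rn [simp]: "pbase (rn_pres P) k = pbase P k"
  unfolding pbase_def pdesc_rn by simp

lemma ptable_rn [simp]: "ptable (rn_pres P) k = map (map_prod ea rn_target) (ptable P k)"
  unfolding ptable_def pdesc_rn by simp

lemma pfin_rn [simp]: "pfin (rn_pres P) k = map_option rn_forest (pfin P k)"
  unfolding pfin_def pdesc_rn by simp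

lemma ptrans_rn [simp]: "ptrans (rn_pres P) k (ea a) = map_option rn_target (ptrans P k a)"
proof -
  have "map_of (map (map_prod ea f) xs) (ea a) = map_option f (map_of xs a)" for f :: "'x \<Rightarrow> 'y" and xs
    by (induction xs) auto
  then show ?thesis unfolding ptrans_def ptable_rn .
qed

lemma map_of_rn_table [simp]: "map_of (rn_table f) k = map_option rn_target (map_of f k)"
  by (induction f) auto

lemma pextend_rn [simp]: "pextend (rn_forest u) (map_option rn_target x) = map_option rn_target (pextend u x)"
  by (cases x) (auto simp: pextend_def option.map_comp comp_def)

lemma pstep_rn [simp]: "pstep (rn_pres P) (ea a) (map_option rn_target x) = map_option rn_target (pstep P a x)"
  by (cases x) (auto simp: pstep_def)

lemma psteps_rn [simp]:
  "psteps (rn_pres P) (map ea w) (map_option rn_target x) = map_option rn_target (psteps P w x)"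
  by (induction w arbitrary: x) (simp_all add: psteps_Cons)

lemma pend_rn [simp]: "pend (rn_pres P) (map_option rn_target x) = map_option rn_forest (pend P x)"
  by (cases x) (auto simp: pend_def split: option.split)

lemma pout_rn [simp]: "pout (rn_pres P) (map ea v) k = map_option rn_forest (pout P v k)"
proof -
  \<comment> \<open>Identity forests contain no symbols, so output runs start in the same place
    after renaming.\<close>
  have "rn_forest (identity b) = identity b" for b by (simp add: identity_def)
  then have "Some (k, identity (pbase P k)) = map_option rn_target (Some (k, identity (pbase P k)))"
    by simp
  then show ?thesis unfolding pout_def pbase_rn by (metis pend_rn psteps_rn)
qed

lemma upd_ok_rn [simp]: "upd_ok (rn_rank rk) (rn_forest us) b c \<longleftrightarrow> upd_ok rk us b c"
  unfolding upd_ok_def sum_holes_rn by simp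

lemma target_ok_rn [simp]: "target_ok (rn_rank rk) (rn_pres P) b (rn_target y) \<longleftrightarrow> target_ok rk P b y"
  unfolding target_ok_def pbase_rn by simp

lemma wf_pres_rn: "wf_pres (map ea al) (rn_rank rk) (rn_pres P) \<longleftrightarrow> wf_pres al rk P"
  unfolding wf_pres_def pdesc_rn
  by (simp add: inj_image_mem_iff[OF inj_ea] cong: option.case_cong)

lemma link_rn: "link (rn_table f) D (map_option rn_target x) (map_option rn_target y) \<longleftrightarrow> link f D x y"
proof (cases x)
  case (Some z)
  have "map_option rn_target y = pextend (snd (rn_target z)) (map_of (rn_table f) (fst (rn_target z))) \<longleftrightarrow>
      y = pextend (snd z) (map_of f (fst z))"
    by simp
  then show ?thesis unfolding link_def Some by simp
qed (simp add: link_def)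

lemma sim_ok_rn:
  "sim_ok (map ea al) (rn_rank rk) (rn_pres P) (rn_pres Q) (rn_table f) D \<longleftrightarrow> sim_ok al rk P Q f D"
proof -
  have some: "Some (rn_target y) = map_option rn_target (Some y)" for y by simp
  have "link (rn_table f) D (fst (rn_pres P)) (fst (rn_pres Q)) \<longleftrightarrow> link f D (fst P) (fst Q)"
    by (simp add: link_rn)
  moreover have "(fst e' < length (snd (rn_pres P)) \<and>
        target_ok (rn_rank rk) (rn_pres Q) (pbase (rn_pres P) (fst e')) (snd e') \<and>
        pfin (rn_pres P) (fst e') = pend (rn_pres Q) (Some (snd e')) \<and>
        (\<forall>a\<in>set (map ea al). link (rn_table f) D (ptrans (rn_pres P) (fst e') a)
           (pstep (rn_pres Q) a (Some (snd e'))))) \<longleftrightarrow>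
      fst e < length (snd P) \<and> target_ok rk Q (pbase P (fst e)) (snd e) \<and>
        pfin P (fst e) = pend Q (Some (snd e)) \<and>
        (\<forall>a\<in>set al. link f D (ptrans P (fst e) a) (pstep Q a (Some (snd e))))"
    if "e' = map_prod id rn_target e" for e e'
    unfolding that fst_map_prod snd_map_prod id_apply some pend_rn pbase_rn target_ok_rn pfin_rn rn_eq_iff
      set_map ball_simps ptrans_rn pstep_rn link_rn length_map ..
  moreover have "(k < length (snd (rn_pres P)) \<and> pfin (rn_pres P) k = None \<and>
        (\<forall>a\<in>set (map ea al). case ptrans (rn_pres P) k a of None \<Rightarrow> True | Some y \<Rightarrow> fst y \<in> set D)) \<longleftrightarrow>
      k < length (snd P) \<and> pfin P k = None \<and>
        (\<forall>a\<in>set al. case ptrans P k a of None \<Rightarrow> True | Some y \<Rightarrow> fst y \<in> set D)" for k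
    by (simp cong: option.case_cong)
  ultimately show ?thesis
    unfolding sim_ok_def by simp
qed

lemma nth_root_rn [simp]:
  "nth_root (map_option rn_forest z) i = map_option (map_option eg) (nth_root z i)"
proof -
  have "root_symbol (map_trm eg t) = map_option eg (root_symbol t)" for t by (cases t) auto
  then show ?thesis by (cases z) (auto simp: nth_root_def)
qed

lemma tests_ok_rn: "tests_ok (rn_pres Q) (map (map ea) V) \<longleftrightarrow> tests_ok Q V"
proof -
  have "inj (map_option (map_option eg))" using inj_eg by (simp add: option.inj_map)
  then have eq: "map_option (map_option eg) x = map_option (map_option eg) y \<longleftrightarrow> x = y" for x y
    by (blast dest: injD)
  have fst: "map_option fst (map_option rn_target x) = map_option fst x" for x
    by (cases x) auto
  show ?thesis
    unfolding tests_ok_def by (simp add: eq fst)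
qed

text \<open>The check substitutes, looks up and compares. Injective renamings commute with
  substitution and reflect equality, so both directions hold.\<close>

lemma check_rn:
  "check (map ea al) (rn_rank rk) (rn_pres P)
    (rn_pres Q, rn_table f, D, map (map ea) V) \<longleftrightarrow> check al rk P (Q, f, D, V)"
  unfolding check_def fst_conv snd_conv wf_pres_rn sim_ok_rn tests_ok_rn
  by (simp add: inj_image_mem_iff[OF inj_ea])

lemma ranked_by_range:
  assumes "ranked_by (rn_rank rk) us"
  shows "us \<in> range rn_forest"
proof -
  have *: "t \<in> range (map_trm eg)" if "ranked_by (rn_rank rk) [t]" for t
    using that
  proof (induction t)
    case Hole
    show ?case by (rule image_eqI[of _ _ Hole]) simp_all
  next
    case (Node h ts)
    note N = ranked_by_Node[OF Node.prems]
    then obtain g where g: "h = eg g" by auto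
    have "\<forall>t\<in>set ts. \<exists>s. t = map_trm eg s" using Node.IH ranked_by_elem[OF N(1)] by blast
    then obtain s where "\<forall>t\<in>set ts. t = map_trm eg (s t)" by metis
    then have "Node h ts = map_trm eg (Node g (map s ts))"
      by (simp add: g map_idI)
    then show ?case by blast
  qed
  have "\<forall>t\<in>set us. \<exists>s. t = map_trm eg s"
    using ranked_by_elem[OF assms] * by blast
  then obtain s where "\<forall>t\<in>set us. t = map_trm eg (s t)" by metis
  then have "us = rn_forest (map s us)" by (simp add: map_idI)
  then show ?thesis by blast
qed

lemma list_range: "(\<And>x. x \<in> set xs \<Longrightarrow> x \<in> range f) \<Longrightarrow> xs \<in> range (map f)"
proof (induction xs)
  case Nil
  show ?case by (rule image_eqI[of _ _ "[]"]) simp_all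
next
  case (Cons x xs)
  then obtain y ys where "x = f y" "xs = map f ys" by fastforce
  then have "x # xs = map f (y # ys)" by simp
  then show ?case by (simp only: rangeI)
qed

lemma option_range: "(\<And>x. z = Some x \<Longrightarrow> x \<in> range f) \<Longrightarrow> z \<in> range (map_option f)"
proof (cases z)
  case None
  then have "z = map_option f None" by simp
  then show ?thesis by blast
next
  case (Some x)
  moreover assume "\<And>x. z = Some x \<Longrightarrow> x \<in> range f"
  ultimately obtain y where "z = map_option f (Some y)" by auto
  then show ?thesis by blast
qed

lemma pair_range: "fst z \<in> range f \<Longrightarrow> snd z \<in> range g \<Longrightarrow> z \<in> range (map_prod f g)"
  by (cases z) (force simp: image_iff)

text \<open>The search may come up with any certificate over the numbers. The check forces its
  letters into \<open>map ea al\<close> and its symbols into the renamed rank table;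
  \<open>D\<close> consists of state numbers only.\<close>

lemma check_range:
  assumes "check (map ea al) (rn_rank rk) P' (Q, f, D, V)"
  obtains Q' f' V' where "Q = rn_pres Q'" "f = rn_table f'" "V = map (map ea) V'"
proof -
  have id: "x \<in> range id" for x :: 'z by simp
  have wf: "wf_pres (map ea al) (rn_rank rk) Q" and sim: "sim_ok (map ea al) (rn_rank rk) P' Q f D"
    and V: "\<forall>w\<in>set V. \<forall>a\<in>set w. a \<in> set (map ea al)"
    using assms by (simp_all add: check_def)
  have target: "y \<in> range rn_target" if "target_ok (rn_rank rk) Q b y" for b y
    using that by (intro pair_range id ranked_by_range[of rk]) (simp add: target_ok_def upd_ok_def)
  have "z \<in> range rn_desc" if "z \<in> set (snd Q)" for z
  proof -
    obtain k where k: "k < length (snd Q)" "z = pdesc Q k"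
      using \<open>z \<in> set (snd Q)\<close> by (auto simp: in_set_conv_nth pdesc_def)
    have *: "fst (snd z) = []" "case snd (snd (snd z)) of None \<Rightarrow> True | Some us \<Rightarrow> upd_ok (rn_rank rk) us (pbase Q k) (Arity 0)"
      "\<forall>e\<in>set (fst (snd (snd z))). fst e \<in> set (map ea al) \<and> target_ok (rn_rank rk) Q (pbase Q k) (snd e)"
      using wf k unfolding wf_pres_def pfin_def ptable_def by auto
    have "snd (snd (snd z)) \<in> range (map_option rn_forest)"
    proof (rule option_range)
      show "x \<in> range rn_forest" if "snd (snd (snd z)) = Some x" for x
        using *(2) that by (intro ranked_by_range[of rk]) (simp add: upd_ok_def)
    qed
    moreover have "fst (snd (snd z)) \<in> range (map (map_prod ea rn_target))"
    proof (rule list_range, rule pair_range)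
      fix e assume "e \<in> set (fst (snd (snd z)))"
      then have e: "fst e \<in> ea ` set al" "target_ok (rn_rank rk) Q (pbase Q k) (snd e)"
        using *(3) by simp_all
      then show "fst e \<in> range ea" by blast
      show "snd e \<in> range rn_target" by (rule target[OF e(2)])
    qed
    moreover have "fst (snd z) \<in> range (map (map_prod rn_forest rn_forest))"
      by (rule list_range) (simp add: *(1))
    ultimately show ?thesis by (intro pair_range id)
  qed
  moreover have "x \<in> range rn_target" if "fst Q = Some x" for x
  proof -
    have "target_ok (rn_rank rk) Q Init x" using wf that by (simp add: wf_pres_def)
    then show ?thesis by (rule target)
  qed
  ultimately have "Q \<in> range rn_pres"
    by (intro pair_range[of Q] option_range[of "fst Q"] list_range[of "snd Q"])
  moreover have "f \<in> range rn_table"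
  proof (rule list_range)
    fix e assume "e \<in> set f"
    then have "target_ok (rn_rank rk) Q (pbase P' (fst e)) (snd e)" using sim by (simp add: sim_ok_def)
    then show "e \<in> range (map_prod id rn_target)" by (intro pair_range id target)
  qed
  moreover have "w \<in> range (map ea)" if w: "w \<in> set V" for w
  proof (rule list_range)
    fix a assume "a \<in> set w"
    then have "a \<in> ea ` set al" using V w by simp
    then show "a \<in> range ea" by blast
  qed
  then have "V \<in> range (map (map ea))" by (rule list_range)
  ultimately show ?thesis using that by (elim rangeE)
qed

end

lemma trm_code_map: "trm_code e (map_trm h t) = trm_code (\<lambda>g. e (h g)) t"
proof (induction t)
  case (Node g ts)
  then have "map (trm_code e) (map (map_trm h) ts) = map (trm_code (\<lambda>g. e (h g))) ts" by simp
  then show ?case by (simp only: trm.map trm_code.simps)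
qed simp

text \<open>\<open>code\<close> is the identity on numbers and treats pairs, lists, options and
  terms as \<open>presentation_code\<close> does, so \<open>ea\<close> and \<open>eg\<close> may act
  before the coding or within it.\<close>

lemma code_presentation:
  fixes ea :: "'a \<Rightarrow> nat" and eg :: "'g \<Rightarrow> nat"
  assumes "inj ea" and "inj eg"
  shows "code (renaming.rn_pres ea eg P) = presentation_code ea eg P"
proof -
  have t: "code (map_trm eg t) = trm_code eg t" for t
    by (simp add: code_trm_def trm_code_map)
  have u: "code (map (map_trm eg) us) = upd_code eg us" for us
    by (simp add: code_list_def upd_code_def comp_def t)
  have o: "code (map_option h x) = option_code e x" if "\<And>y. code (h y) = e y"
    for h :: "'x \<Rightarrow> 'y::coded" and e x
    by (cases x) (simp_all add: code_option_def option_code_def that)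
  have p: "code (map_prod h h' x) = pair_code e e' x" if "\<And>y. code (h y) = e y" "\<And>y. code (h' y) = e' y"
    for h :: "'x \<Rightarrow> 'y::coded" and h' :: "'x2 \<Rightarrow> 'y2::coded" and e e' x
    by (cases x) (simp add: code_Pair pair_code_def that)
  have l: "code (map h xs) = list_encode (map e xs)" if "\<And>y. code (h y) = e y"
    for h :: "'x \<Rightarrow> 'y::coded" and e xs
    by (simp add: code_list_def comp_def that)
  have b: "code (id x) = base_code x" for x by (simp add: code_base_def)
  have n: "code (id x) = id x" for x :: nat by simp
  have a: "code (ea x) = ea x" for x by simp
  show ?thesis
    unfolding presentation_code_def state_desc_code_def target_code_def
    by (intro p o l u b n a)
qed

text \<open>\<open>al\<close> and the rank table are constants of the program; they can be listed
  because the alphabets are finite.\<close>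

lemma minimization_computable:
  fixes rank :: "'g \<Rightarrow> nat" and ea :: "'a \<Rightarrow> nat" and eg :: "'g \<Rightarrow> nat"
  assumes "infinite (UNIV :: 'q set)" and "finite (UNIV :: 'a set)" and "finite (UNIV :: 'g set)"
    and "inj ea" and "inj eg"
  shows "\<exists>p. \<forall>P (A :: ('q, 'a, 'g) transducer). presents rank P A \<longrightarrow>
    (\<exists>P' (M :: ('q, 'a, 'g) transducer).
       eval p [presentation_code ea eg P] = Some (presentation_code ea eg P') \<and> presents rank P' M \<and>
       algebraically_minimal rank (live_transducers_for rank (transduction A)) M)"
proof -
  interpret renaming ea eg using assms(4,5) by unfold_locales
  obtain al :: "'a list" where al: "set al = UNIV" using finite_list[OF assms(2)] by blast
  have "finite (range (\<lambda>g. (g, rank g)))" using assms(3) by simp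
  from finite_list[OF this] obtain rk where rk: "set rk = range (\<lambda>g. (g, rank g))" ..
  let ?check = "check (map ea al) (rn_rank rk)"
  from computable_search[OF decidable_check computable_fst[OF computable_id]]
  obtain p where p: "\<forall>x. (\<exists>y. ?check x y) \<longrightarrow> (\<exists>y. ?check x y \<and> eval p [code x] = Some (code (fst y)))" ..
  have "\<exists>P' (M :: ('q, 'a, 'g) transducer).
       eval p [presentation_code ea eg P] = Some (presentation_code ea eg P') \<and> presents rank P' M \<and>
       algebraically_minimal rank (live_transducers_for rank (transduction A)) M"
    if A: "presents rank P A" for P and A :: "('q, 'a, 'g) transducer"
  proof -
    obtain Q0 f0 D0 V0 where "check al rk P (Q0, f0, D0, V0)"
      using check_complete[OF assms(1,2) A al rk] by (metis prod_cases4)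
    then have "?check (rn_pres P) (rn_pres Q0, rn_table f0, D0, map (map ea) V0)"
      by (simp only: check_rn)
    then obtain y where y: "?check (rn_pres P) y" "eval p [code (rn_pres P)] = Some (code (fst y))"
      using p by blast
    obtain Q f D V where y': "y = (Q, f, D, V)" by (metis prod_cases4)
    \<comment> \<open>The certificate found need not be the one whose existence was shown, so it has
      to be renamed back before soundness applies.\<close>
    obtain Q' f' V' where Q': "Q = rn_pres Q'" "f = rn_table f'" "V = map (map ea) V'"
      using check_range y(1) unfolding y' by blast
    then have "check al rk P (Q', f', D, V')"
      using y(1) unfolding y' Q' by (simp only: check_rn)
    from check_sound[OF assms(1) A this al rk]
    obtain M :: "('q, 'a, 'g) transducer" where "presents rank Q' M"
      "algebraically_minimal rank (live_transducers_for rank (transduction A)) M" by blast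
    moreover have "eval p [presentation_code ea eg P] = Some (presentation_code ea eg Q')"
      using y(2) unfolding y' Q' fst_conv code_presentation[OF assms(4,5)] .
    ultimately show ?thesis by blast
  qed
  then show ?thesis by blast
qed

theorem theorem30:
  fixes rank :: "'g \<Rightarrow> nat"
  assumes "infinite (UNIV :: 'q set)"
  shows "(\<forall>\<phi> :: 'a list \<rightharpoonup> 'g trm.
            (transducers_for rank \<phi> :: ('q, 'a, 'g) transducer set) \<noteq> {} \<longrightarrow>
            (\<exists>M :: ('q, 'a, 'g) transducer.
               algebraically_minimal rank (live_transducers_for rank \<phi>) M)) \<and>
         (finite (UNIV :: 'a set) \<and> finite (UNIV :: 'g set) \<longrightarrow>
            (\<forall>(ea :: 'a \<Rightarrow> nat) (eg :: 'g \<Rightarrow> nat). inj ea \<and> inj eg \<longrightarrow>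
               (\<exists>p. \<forall>P (A :: ('q, 'a, 'g) transducer). presents rank P A \<longrightarrow>
                  (\<exists>P' (M :: ('q, 'a, 'g) transducer).
                     eval p [presentation_code ea eg P] = Some (presentation_code ea eg P') \<and> presents rank P' M \<and>
                     algebraically_minimal rank (live_transducers_for rank (transduction A)) M))))"
proof (intro conjI allI impI)
  fix \<phi> :: "'a list \<rightharpoonup> 'g trm"
  assume "(transducers_for rank \<phi> :: ('q, 'a, 'g) transducer set) \<noteq> {}"
  then obtain A :: "('q, 'a, 'g) transducer" where A: "is_transducer rank A" "transduction A = \<phi>"
    by (auto simp: transducers_for_def)
  then obtain M :: "('q, 'a, 'g) transducer" and I F E where
    "reduced rank M I F E" "transduction M = \<phi>"
    using reduced_exists by blast
  then show "\<exists>M :: ('q, 'a, 'g) transducer. algebraically_minimal rank (live_transducers_for rank \<phi>) M"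
    using reduced_minimal[OF assms] by blast
qed (use minimization_computable[OF assms] in blast)

end
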